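(* For a positive integer $n$, let $X(n)$ denote the multiset of the degrees of the irreducible (complex) characters of the symmetric group $S_n$, and let $m(n)$ denote the largest of the multiplicities of the elements of $X(n)$. For all sufficiently large $i$, if $n\geq 3\cdot 81^i$ then $m(n)\geq 2^i$. In particular, for all sufficiently large $n$, \[ m(n)\geq n^{1/7}.\] *)

theory Defs
  imports
    Complex_Main
    "HOL-Library.FuncSet"
    "HOL-Library.Multiset"
    "HOL-Algebra.Sym_Groups"
    "Jordan_Normal_Form.VS_Connect"
begin

definition general_linear_group :: "nat \<Rightarrow> complex mat monoid" where
  "general_linear_group d = units_of (ring_mat TYPE(complex) d ())"

definition is_representation :: "('g, 'm) monoid_scheme \<Rightarrow> nat \<Rightarrow> ('g \<Rightarrow> complex mat) \<Rightarrow> bool" where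
  "is_representation G d \<rho> \<longleftrightarrow> group_hom G (general_linear_group d) \<rho>"

definition invariant_subspace ::
  "('g, 'm) monoid_scheme \<Rightarrow> nat \<Rightarrow> ('g \<Rightarrow> complex mat) \<Rightarrow> complex vec set \<Rightarrow> bool" where
  "invariant_subspace G d \<rho> W \<longleftrightarrow>
     VectorSpace.subspace class_ring W (module_vec TYPE(complex) d) \<and>
     (\<forall>g \<in> carrier G. \<forall>w \<in> W. \<rho> g *\<^sub>v w \<in> W)"

definition irreducible_representation ::
  "('g, 'm) monoid_scheme \<Rightarrow> nat \<Rightarrow> ('g \<Rightarrow> complex mat) \<Rightarrow> bool" where
  "irreducible_representation G d \<rho> \<longleftrightarrow>
     is_representation G d \<rho> \<and> d > 0 \<and>
     (\<forall>W. invariant_subspace G d \<rho> W \<longrightarrow> W = {0\<^sub>v d} \<or> W = carrier_vec d)"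

definition mat_trace :: "complex mat \<Rightarrow> complex" where
  "mat_trace A = (\<Sum>i<dim_row A. A $$ (i, i))"

(* Characters are restricted to the carrier so that two of them are equal in HOL
   exactly when they agree on the group; otherwise they would be miscounted. *)
definition character_of ::
  "('g, 'm) monoid_scheme \<Rightarrow> ('g \<Rightarrow> complex mat) \<Rightarrow> 'g \<Rightarrow> complex" where
  "character_of G \<rho> = restrict (\<lambda>g. mat_trace (\<rho> g)) (carrier G)"

definition irreducible_characters :: "('g, 'm) monoid_scheme \<Rightarrow> ('g \<Rightarrow> complex) set" where
  "irreducible_characters G =
     {character_of G \<rho> | \<rho> d. irreducible_representation G d \<rho>}"

(* The value at the identity is the trace of an identity matrix, that is, the dimension
   of any representation affording the character, as a complex number. *)
definition character_degree :: "('g, 'm) monoid_scheme \<Rightarrow> ('g \<Rightarrow> complex) \<Rightarrow> complex" where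
  "character_degree G \<chi> = \<chi> \<one>\<^bsub>G\<^esub>"

(* mset_set is the empty multiset on infinite sets. A finite group has only finitely many
   irreducible characters, so this multiset does list all of their degrees. *)
definition degree_multiset :: "nat \<Rightarrow> complex multiset" where
  "degree_multiset n = image_mset (character_degree (sym_group n))
           (mset_set (irreducible_characters (sym_group n)))"

definition max_multiplicity :: "nat \<Rightarrow> nat" where
  "max_multiplicity n = Max (count (degree_multiset n) ` set_mset (degree_multiset n))"

end

theory Submission
  imports
    Defs
    "HOL-Number_Theory.Number_Theory"
    "HOL-Real_Asymp.Real_Asymp"
    "HOL-Algebra.Multiplicative_Group"
    "Jordan_Normal_Form.Schur_Decomposition"
begin

text \<open>
  A partition of $n$ is encoded by a 0-1 word; its hooks are the pairs consisting of a one and a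
  later zero, the length of a hook being the distance. The degree of the character is
  $n!$ divided by the product of the hook lengths, so it is determined by the exponents of the
  primes in that product. For a random word of length $m$ the number of hooks of each length
  deviates from its mean by $O(\sqrt m)$ only, hence the exponent of a large prime takes about
  $m^{1/2+o(1)}$ values, and the hook product takes at most
  $\prod_{p \le m} p^{1/2+o(1)}$ values. By a Chebyshev-type estimate this is at most $2^{0.94m}$,
  whereas there are about $2^m$ words; a pigeonhole argument therefore produces at least $n$
  partitions of $n$ with the same degree, for every large $n$.

  The characters come from Young's orthogonal form. Standard tableaux are replaced by their
  content sequences, so that the action of all partitions with at most $k$ parts is given by one
  formula. The Jucys--Murphy elements act diagonally with distinct joint eigenvalues, which yields
  irreducibility and separates the characters without any orthogonality relations.
\<close>

section \<open>A Chebyshev-type bound for the primorial\<close>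

text \<open>The margin is thin, and this dictates the constants. About p^(1/2) exponents for each
  prime p give the square root of the primorial of m, and the familiar bound 4^m for the primorial
  would turn this into 2^m, exactly the number of words. Hence the primorial is bounded by a
  multiple of (17/5)^m, and 1/2 is relaxed only to 13/25, since (17/5)^(13/25) < 2^(23/25); all
  other losses are paid from the remaining 2/25. Only the sum of the deviations over all hook
  lengths is under control, so the exponents of the large primes are bounded jointly: at most one
  large prime divides a given length, and the deviations of the exponents form an integer point of
  an l1 ball of radius O(m^(3/2)). The primes below m^(39/40) are too few to matter. A random word
  does not have exactly n hooks. Pigeonhole fixes its numbers of ones and of hooks, and a common
  prefix of length O(sqrt m) supplies the missing hooks; it is short enough to change the number of
  hooks of each length by O(sqrt m) only.\<close>

lemma prime_dvd_choose_of_mod_less: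
  fixes p :: nat
  assumes p: "prime p" and "N mod p < k mod p"
  shows "p dvd N choose k"
  using assms(2)
\<comment> \<open>The last-digit case of Lucas' theorem. The identity k C(N,k) = N C(N-1,k-1) lowers
  both last digits in base p by one until that of N is 0; then p divides N but not k.\<close>
proof (induction "N mod p" arbitrary: N k)
  case 0
  then have "k mod p \<noteq> 0" by simp
  then have kp: "\<not> p dvd k" "k > 0" by (auto simp: dvd_eq_mod_eq_0 intro!: Nat.gr0I)
  show ?case
  proof (cases "N = 0")
    case True then show ?thesis using kp by (simp add: binomial_eq_0)
  next
    case False
    then obtain N' k' where N: "N = Suc N'" "k = Suc k'" using kp by (metis gr0_conv_Suc neq0_conv)
    have "k * (N choose k) = N * (N' choose k')"
      using N by (metis Suc_times_binomial_eq mult.commute)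
    moreover have "p dvd N" using 0 by (simp add: dvd_eq_mod_eq_0)
    ultimately have "p dvd k * (N choose k)" by simp
    then show ?thesis using p kp by (simp add: prime_dvd_mult_iff)
  qed
next
  case (Suc r)
  have kp: "\<not> p dvd k" "k > 0" using Suc by (auto simp: dvd_eq_mod_eq_0 intro!: Nat.gr0I)
  have "N > 0" using Suc by (auto intro!: Nat.gr0I)
  then obtain N' k' where N: "N = Suc N'" "k = Suc k'" using kp by (metis gr0_conv_Suc)
  have rN: "r = N' mod p" using Suc(2) N by (auto simp: mod_Suc split: if_splits)
  have "k' mod p = k mod p - 1" using N kp by (auto simp: mod_Suc dvd_eq_mod_eq_0)
  then have "N' mod p < k' mod p" using rN Suc by linarith
  then have "p dvd (N' choose k')" using Suc(1)[of N' k'] rN by simp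
  moreover have "k * (N choose k) = N * (N' choose k')"
      using N by (metis Suc_times_binomial_eq mult.commute)
  ultimately have "p dvd k * (N choose k)" by simp
  then show ?case using p kp by (simp add: prime_dvd_mult_iff)
qed

definition primorial :: "nat \<Rightarrow> nat" where
  "primorial n = \<Prod>{p. prime p \<and> p \<le> n}"

lemma finite_primes_upto: "finite {p::nat. prime p \<and> p \<le> n}"
  by (rule finite_subset[of _ "{..n}"]) auto

lemma primorial_pos: "primorial n > 0"
  unfolding primorial_def by (rule prod_pos) (auto dest: prime_gt_0_nat)

lemma prod_distinct_primes_dvd:
  fixes N :: nat
  assumes "finite A" "\<And>p. p \<in> A \<Longrightarrow> prime p" "\<And>p. p \<in> A \<Longrightarrow> p dvd N"
  shows "\<Prod>A dvd N"
  using assms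
proof (induction A rule: finite_induct)
  case (insert x F)
  have "coprime x (\<Prod>F)"
    by (rule prod_coprime_right) (use insert in \<open>auto intro!: primes_coprime\<close>)
  then show ?case using insert by (simp add: divides_mult)
qed simp

lemma mod_from_bounds: 
  fixes a p q :: nat
  assumes "q * p \<le> a" "a < q * p + p" shows "a mod p = a - q * p"
proof -
  have "a = q * p + (a - q * p)" using assms by simp
  then have "a mod p = (q * p + (a - q * p)) mod p" by simp
  also have "\<dots> = (a - q*p) mod p" by simp
  also have "\<dots> = a - q * p" using assms by (intro mod_less) linarith
  finally show ?thesis .
qed

text \<open>The product of the two binomials is the multinomial coefficient (6n)!/((3n)!(2n)!n!). It
  is divisible by every prime in (n, 6n] and is at most (64 * 27 / 4)^n = 432^n. Iteration gives the
  growth rate 432^(1/5) < 17/5, where central binomial coefficients give 4.\<close>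

lemma primorial_six_mult: "primorial (6 * n) \<le> 432 ^ n * primorial n"
proof -
  let ?N = "(6 * n choose (3 * n)) * (3 * n choose (2 * n))"
  let ?A = "{p::nat. prime p \<and> n < p \<and> p \<le> 6 * n}"
  have fin: "finite ?A" by (rule finite_subset[of _ "{..6*n}"]) auto
  have dvd: "p dvd ?N" if "p \<in> ?A" for p
  proof -
    have p: "prime p" "n < p" "p \<le> 6 * n" using that by auto
    \<comment> \<open>In each range one of the two binomials has an upper entry with a smaller
      residue modulo p than its lower entry.\<close>
    consider "3 * n < p" | "2 * n < p" "p \<le> 3 * n" | "3 * n < 2 * p" "p \<le> 2 * n" | "2 * p \<le> 3 * n"
      by linarith
    then show ?thesis
    proof cases
      case 1
      have "(6 * n) mod p = 6 * n - 1 * p" by (rule mod_from_bounds) (use 1 p in auto)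
      moreover have "(3 * n) mod p = 3 * n - 0 * p" by (rule mod_from_bounds) (use 1 p in auto)
      ultimately have "p dvd (6 * n choose (3 * n))"
        by (intro prime_dvd_choose_of_mod_less) (use p 1 in auto)
      then show ?thesis by simp
    next
      case 2
      have "(3 * n) mod p = 3 * n - 1 * p" by (rule mod_from_bounds) (use 2 p in auto)
      moreover have "(2 * n) mod p = 2 * n - 0 * p" by (rule mod_from_bounds) (use 2 p in auto)
      ultimately have "p dvd (3 * n choose (2 * n))"
        by (intro prime_dvd_choose_of_mod_less) (use p 2 in auto)
      then show ?thesis by simp
    next
      case 3
      have "(6 * n) mod p = 6 * n - 3 * p" by (rule mod_from_bounds) (use 3 p in auto)
      moreover have "(3 * n) mod p = 3 * n - 1 * p" by (rule mod_from_bounds) (use 3 p in auto)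
      ultimately have "p dvd (6 * n choose (3 * n))"
        by (intro prime_dvd_choose_of_mod_less) (use p 3 in auto)
      then show ?thesis by simp
    next
      case 4
      have "(3 * n) mod p = 3 * n - 2 * p" by (rule mod_from_bounds) (use 4 p in auto)
      moreover have "(2 * n) mod p = 2 * n - 1 * p" by (rule mod_from_bounds) (use 4 p in auto)
      ultimately have "p dvd (3 * n choose (2 * n))"
        by (intro prime_dvd_choose_of_mod_less) (use p 4 in auto)
      then show ?thesis by simp
    qed
  qed
  have "\<Prod>?A dvd ?N" by (rule prod_distinct_primes_dvd) (use fin dvd in auto)
  moreover have "?N > 0" by simp
  ultimately have le: "\<Prod>?A \<le> ?N" by (rule dvd_imp_le)
  have b1: "(6 * n choose (3 * n)) \<le> 2 ^ (6 * n)"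
    using binomial_le_pow2 by blast
  \<comment> \<open>A single term of the expansion of (1 + 2)^(3n). The weight 2 makes it the
    largest term, so little is lost.\<close>
  have "(3 * n choose (2 * n)) * 2 ^ (2 * n) \<le> (\<Sum>k\<le>3 * n. (3 * n choose k) * 2 ^ k)"
    by (rule member_le_sum[of "2 * n" "{..3*n}" "\<lambda>k. (3 * n choose k) * 2 ^ k"]) auto
  also have "\<dots> = (2 + 1) ^ (3 * n)"
    using binomial[of 2 1 "3 * n"] by simp
  finally have b2: "(3 * n choose (2 * n)) * 4 ^ n \<le> 27 ^ n"
    by (simp add: power_mult)
  have "?N * 4 ^ n \<le> 64 ^ n * 27 ^ n"
  proof -
    have "?N * 4 ^ n = (6 * n choose (3 * n)) * ((3 * n choose (2 * n)) * 4 ^ n)" by simp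
    also have "\<dots> \<le> 2 ^ (6 * n) * 27 ^ n" using b1 b2 by (rule mult_le_mono)
    finally show ?thesis by (simp add: power_mult)
  qed
  also have "\<dots> = 432 ^ n * 4 ^ n" by (simp flip: power_mult_distrib)
  finally have N: "?N \<le> 432 ^ n" by simp
  have "{p. prime p \<and> p \<le> 6 * n} = ?A \<union> {p. prime p \<and> p \<le> n}" by auto
  then have "primorial (6 * n) = \<Prod>?A * primorial n"
    unfolding primorial_def by (simp only:) (rule prod.union_disjoint; use fin finite_primes_upto in auto)
  also have "\<dots> \<le> 432 ^ n * primorial n" using le N by (intro mult_right_mono) auto
  finally show ?thesis .
qed

lemma primorial_add_le: "primorial (m + r) \<le> primorial m * (m + r) ^ r"
proof (induction r)
  case (Suc r)
  have "primorial (m + Suc r) \<le> primorial (m + r) * (m + Suc r)"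
  proof (cases "prime (m + Suc r)")
    case True
    then have "{p. prime p \<and> p \<le> m + Suc r} = insert (m + Suc r) {p. prime p \<and> p \<le> m + r}"
      by (auto simp: le_Suc_eq)
    then show ?thesis unfolding primorial_def using finite_primes_upto by (simp add: mult.commute)
  next
    case False
    then have "{p. prime p \<and> p \<le> m + Suc r} = {p. prime p \<and> p \<le> m + r}"
      by (auto simp: le_Suc_eq)
    then show ?thesis unfolding primorial_def by simp
  qed
  also have "\<dots> \<le> (primorial m * (m + r) ^ r) * (m + Suc r)" using Suc by (intro mult_right_mono) auto
  also have "\<dots> \<le> (primorial m * (m + Suc r) ^ r) * (m + Suc r)"
    by (intro mult_right_mono mult_left_mono power_mono) auto
  finally show ?case by (simp add: algebra_simps)
qed simp

lemma primorial_bound: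
  obtains K :: real where "K > 0" "\<And>n. real (primorial n) \<le> K * (17 / 5) ^ n"
proof -
  \<comment> \<open>The two bases are 432 * 17/5 and (17/5)^6. The first is smaller because 432 <
    (17/5)^5, and the exponential gap absorbs the polynomial loss from rounding M down to a multiple
    of 6.\<close>
  have "eventually (\<lambda>n::nat. (6 * real n + 5) ^ 5 * (7344/5) ^ n \<le> (24137569/15625) ^ n) at_top"
    by real_asymp
  then obtain n0 where n0: "\<And>n. n \<ge> n0 \<Longrightarrow>
      (6 * real n + 5) ^ 5 * (7344/5) ^ n \<le> (24137569/15625) ^ n"
    by (auto simp: eventually_at_top_linorder)
  define K :: real where "K = (\<Sum>n<6 * n0 + 6. real (primorial n)) + 1"
  have K: "K > 0" unfolding K_def by (intro add_nonneg_pos sum_nonneg) auto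
  have "real (primorial M) \<le> K * (17 / 5) ^ M" for M
  proof (induction M rule: less_induct)
    case (less M)
    show ?case
    proof (cases "M < 6 * n0 + 6")
      case True
      have "real (primorial M) \<le> K"
        unfolding K_def using member_le_sum[of M "{..<6*n0+6}" "\<lambda>n. real (primorial n)"] True by simp
      also have "\<dots> \<le> K * (17/5) ^ M" using K by simp
      finally show ?thesis .
    next
      case False
      define n r where "n = M div 6" and "r = M mod 6"
      have M: "M = 6 * n + r" "r < 6" unfolding n_def r_def by auto
      have n: "n \<ge> n0" "n < M" "n > 0" using False M by linarith+
      have "real (primorial M) \<le> real (primorial (6 * n) * (6 * n + r) ^ r)"
        unfolding of_nat_le_iff using primorial_add_le[of "6 * n" r] M by simp
      also have "\<dots> \<le> real (primorial (6 * n) * (6 * n + 5) ^ 5)"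
      proof -
        have "(6 * n + r) ^ r \<le> (6 * n + 5) ^ r" using M by (intro power_mono) auto
        also have "\<dots> \<le> (6 * n + 5) ^ 5" using M by (intro power_increasing) auto
        finally show ?thesis by (metis mult_le_mono2 of_nat_le_iff)
      qed
      also have "\<dots> \<le> real (432 ^ n * primorial n * (6 * n + 5) ^ 5)"
        using primorial_six_mult[of n] by (metis mult_le_mono1 of_nat_le_iff)
      also have "\<dots> = 432 ^ n * (6 * real n + 5) ^ 5 * real (primorial n)" by simp
      also have "\<dots> \<le> 432 ^ n * (6 * real n + 5) ^ 5 * (K * (17/5) ^ n)"
        using less[OF n(2)] by (intro mult_left_mono) auto
      also have "\<dots> = K * ((6 * real n + 5) ^ 5 * (432 * (17/5)) ^ n)"
        by (simp only: power_mult_distrib mult_ac)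
      also have "\<dots> = K * ((6 * real n + 5) ^ 5 * (7344/5) ^ n)" by simp
      also have "\<dots> \<le> K * (24137569/15625) ^ n" using n0[OF n(1)] K by (intro mult_left_mono) auto
      also have "(24137569/15625 :: real) = (17/5) ^ 6" by (simp add: eval_nat_numeral)
      also have "K * ((17/5) ^ 6) ^ n = K * (17/5) ^ (6 * n)" by (simp only: power_mult)
      also have "\<dots> \<le> K * (17/5) ^ M" using K M by (intro mult_left_mono power_increasing) auto
      finally show ?thesis .
    qed
  qed
  then show ?thesis using K that by blast
qed

section \<open>Hook lengths of random words\<close>

text \<open>The characters of (Z/2)^m, evaluated at the word with ones at \<open>A\<close>. Their
  orthogonality reduces second moments over all words to counting terms.\<close>

definition walsh :: "nat set \<Rightarrow> nat set \<Rightarrow> int" where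
  "walsh S A = (\<Prod>i\<in>S. if i \<in> A then 1 else - 1)"

lemma walsh_mult_self: "walsh S A * walsh S A = 1"
proof -
  have "walsh S A * walsh S A = (\<Prod>i\<in>S. 1)"
    unfolding walsh_def prod.distrib[symmetric] by (rule prod.cong) auto
  then show ?thesis by simp
qed

lemma walsh_toggle:
  assumes "finite S"
  shows "walsh S (if x \<in> A then A - {x} else insert x A) = (if x \<in> S then - walsh S A else walsh S A)"
proof (cases "x \<in> S")
  case True
  let ?B = "if x \<in> A then A - {x} else insert x A"
  have "walsh S ?B = (if x \<in> ?B then 1 else - 1) * (\<Prod>i\<in>S-{x}. if i \<in> ?B then 1 else - 1)"
    unfolding walsh_def using assms True by (subst prod.remove[of S x]) auto
  also have "(\<Prod>i\<in>S-{x}. if i \<in> ?B then 1 else - 1) = (\<Prod>i\<in>S-{x}. if i \<in> A then 1 else - 1::int)"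
    by (rule prod.cong) auto
  also have "(if x \<in> ?B then 1 else - 1) = - (if x \<in> A then 1 else - 1 :: int)" by auto
  also have "- (if x \<in> A then 1 else - 1) * (\<Prod>i\<in>S-{x}. if i \<in> A then 1 else - 1::int) = - walsh S A"
    unfolding walsh_def using assms True by (subst prod.remove[of S x]) auto
  finally show ?thesis using True by simp
next
  case False
  then show ?thesis unfolding walsh_def by (auto intro!: prod.cong)
qed

text \<open>Toggling a point of the symmetric difference of \<open>S\<close> and \<open>T\<close>
  permutes the words and changes the sign of the summand.\<close>

lemma walsh_orthogonal:
  assumes S: "S \<subseteq> {..<m}" and T: "T \<subseteq> {..<m}" and ne: "S \<noteq> T"
  shows "(\<Sum>A\<in>Pow {..<m}. walsh S A * walsh T A) = 0"
proof -
  from ne obtain x where x: "x \<in> S \<longleftrightarrow> x \<notin> T" by blast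
  then have xm: "x < m" using S T by auto
  have fS: "finite S" "finite T" using S T by (auto intro: finite_subset)
  let ?\<tau> = "\<lambda>A. if x \<in> A then A - {x} else insert x A"
  have bij: "bij_betw ?\<tau> (Pow {..<m}) (Pow {..<m})"
    by (rule bij_betw_byWitness[of _ ?\<tau>]) (use xm in auto)
  have "(\<Sum>A\<in>Pow {..<m}. walsh S A * walsh T A) = (\<Sum>A\<in>Pow {..<m}. walsh S (?\<tau> A) * walsh T (?\<tau> A))"
    by (rule sum.reindex_bij_betw[OF bij, symmetric])
  also have "\<dots> = (\<Sum>A\<in>Pow {..<m}. - (walsh S A * walsh T A))"
    unfolding walsh_toggle[OF fS(1)] walsh_toggle[OF fS(2)] using x by (intro sum.cong) auto
  finally show ?thesis by (simp add: sum_negf)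
qed

lemma walsh_sum_square:
  assumes fin: "finite I" and sub: "\<And>i. i \<in> I \<Longrightarrow> S i \<subseteq> {..<m}" and inj: "inj_on S I"
  shows "(\<Sum>A\<in>Pow {..<m}. (\<Sum>i\<in>I. walsh (S i) A)\<^sup>2) = int (card I) * 2 ^ m"
proof -
  have "(\<Sum>A\<in>Pow {..<m}. (\<Sum>i\<in>I. walsh (S i) A)\<^sup>2)
      = (\<Sum>A\<in>Pow {..<m}. \<Sum>i\<in>I. \<Sum>j\<in>I. walsh (S i) A * walsh (S j) A)"
    by (simp add: power2_eq_square sum_product)
  also have "\<dots> = (\<Sum>i\<in>I. \<Sum>j\<in>I. \<Sum>A\<in>Pow {..<m}. walsh (S i) A * walsh (S j) A)"
    by (subst sum.swap, rule sum.cong[OF refl], subst sum.swap) simp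
  also have "\<dots> = (\<Sum>i\<in>I. \<Sum>j\<in>I. if i = j then 2 ^ m else 0)"
  proof (intro sum.cong refl)
    fix i j assume ij: "i \<in> I" "j \<in> I"
    show "(\<Sum>A\<in>Pow {..<m}. walsh (S i) A * walsh (S j) A) = (if i = j then 2 ^ m else 0)"
    proof (cases "i = j")
      case True then show ?thesis by (simp add: walsh_mult_self card_Pow)
    next
      case False
      then have "S i \<noteq> S j" using inj ij by (auto dest: inj_onD)
      then show ?thesis using walsh_orthogonal sub ij False by auto
    qed
  qed
  also have "\<dots> = int (card I) * 2 ^ m" using fin by simp
  finally show ?thesis .
qed

definition hooks :: "nat \<Rightarrow> nat set \<Rightarrow> nat \<Rightarrow> nat" where
  "hooks m A d = card {i. i \<in> A \<and> i + d < m \<and> i + d \<notin> A}"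

text \<open>(m - d)/4 is the mean of hooks m A d over all words A of length m.\<close>

definition hook_dev :: "nat \<Rightarrow> nat set \<Rightarrow> nat \<Rightarrow> int" where
  "hook_dev m A d = 4 * int (hooks m A d) - int (m - d)"

text \<open>With signs e_i = 1 for a one and -1 for a zero, the indicator of a one at i and a zero
  at j is (1 + e_i)(1 - e_j)/4; four times it minus 1 is e_i - e_j - e_i e_j.\<close>

lemma hook_dev_walsh:
  assumes "d > 0"
  shows "hook_dev m A d = (\<Sum>i<m - d. walsh {i} A) - (\<Sum>i<m - d. walsh {i + d} A) - (\<Sum>i<m - d. walsh {i, i + d} A)"
proof -
  have "{i. i \<in> A \<and> i + d < m \<and> i + d \<notin> A} = {i \<in> {..<m-d}. i \<in> A \<and> i + d \<notin> A}" by auto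
  then have "int (hooks m A d) = (\<Sum>i<m-d. if i \<in> A \<and> i + d \<notin> A then 1 else 0)"
    unfolding hooks_def by (simp add: sum.If_cases Int_def)
  then have "hook_dev m A d = (\<Sum>i<m-d. 4 * (if i \<in> A \<and> i + d \<notin> A then 1 else 0) - 1)"
    unfolding hook_dev_def by (simp add: sum_subtractf sum_distrib_left)
  also have "\<dots> = (\<Sum>i<m-d. walsh {i} A - walsh {i + d} A - walsh {i, i + d} A)"
    using assms by (intro sum.cong) (auto simp: walsh_def)
  finally show ?thesis by (simp add: sum_subtractf)
qed

lemma square_diff_diff_le: "(a - b - c)\<^sup>2 \<le> 3 * (a\<^sup>2 + b\<^sup>2 + c\<^sup>2)" for a b c :: int
proof -
  have "0 \<le> (a + b)\<^sup>2 + (a + c)\<^sup>2 + (b - c)\<^sup>2" by simp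
  then show ?thesis by (simp add: power2_eq_square algebra_simps)
qed

lemma hook_dev_second_moment:
  assumes d: "d > 0"
  shows "(\<Sum>A\<in>Pow {..<m}. (hook_dev m A d)\<^sup>2) \<le> 9 * int m * 2 ^ m"
proof -
  let ?a = "\<lambda>A. \<Sum>i<m - d. walsh {i} A" and ?b = "\<lambda>A. \<Sum>i<m - d. walsh {i + d} A"
    and ?c = "\<lambda>A. \<Sum>i<m - d. walsh {i, i + d} A"
  have a: "(\<Sum>A\<in>Pow {..<m}. (?a A)\<^sup>2) = int (m - d) * 2 ^ m"
    by (subst walsh_sum_square) (auto simp: inj_on_def)
  have b: "(\<Sum>A\<in>Pow {..<m}. (?b A)\<^sup>2) = int (m - d) * 2 ^ m"
    by (subst walsh_sum_square) (auto simp: inj_on_def)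
  have "inj_on (\<lambda>i. {i, i + d}) {..<m-d}"
    using d by (auto simp: inj_on_def doubleton_eq_iff)
  then have c: "(\<Sum>A\<in>Pow {..<m}. (?c A)\<^sup>2) = int (m - d) * 2 ^ m"
    by (subst walsh_sum_square) auto
  have "(\<Sum>A\<in>Pow {..<m}. (hook_dev m A d)\<^sup>2) \<le> (\<Sum>A\<in>Pow {..<m}. 3 * ((?a A)\<^sup>2 + (?b A)\<^sup>2 + (?c A)\<^sup>2))"
    unfolding hook_dev_walsh[OF d] by (intro sum_mono square_diff_diff_le)
  also have "\<dots> = 9 * int (m - d) * 2 ^ m"
    using a b c by (simp add: sum.distrib flip: sum_distrib_left)
  also have "\<dots> \<le> 9 * int m * 2 ^ m" by (intro mult_right_mono) auto
  finally show ?thesis .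
qed

text \<open>The second moment bounds the mean absolute deviation for each length by 3t, so the sum
  over all lengths has mean at most 3t^3. By Markov's inequality at most half of the words exceed
  twice this.\<close>

lemma card_small_hook_dev:
  assumes t: "t > 0" and m: "m = t\<^sup>2"
  shows "2 ^ m \<le> 2 * card {A \<in> Pow {..<m}. (\<Sum>d\<in>{1..<m}. \<bar>hook_dev m A d\<bar>) \<le> 6 * int t ^ 3}"
proof -
  let ?D = "\<lambda>A. \<Sum>d\<in>{1..<m}. \<bar>hook_dev m A d\<bar>"
  let ?G = "{A \<in> Pow {..<m}. ?D A \<le> 6 * int t ^ 3}"
  let ?B = "{A \<in> Pow {..<m}. \<not> ?D A \<le> 6 * int t ^ 3}"
  have each: "(\<Sum>A\<in>Pow {..<m}. \<bar>hook_dev m A d\<bar>) \<le> 3 * int t * 2 ^ m" if d: "d > 0" for d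
  proof -
    \<comment> \<open>AM-GM in place of Cauchy-Schwarz, centred at 3t, the square root of the second
      moment bound 9m.\<close>
    have amgm: "6 * int t * \<bar>x\<bar> \<le> x\<^sup>2 + 9 * int m" for x :: int
    proof -
      have "0 \<le> (\<bar>x\<bar> - 3 * int t)\<^sup>2" by simp
      also have "\<dots> = x\<^sup>2 - 6 * int t * \<bar>x\<bar> + 9 * (int t)\<^sup>2"
        by (simp add: power2_diff power_mult_distrib)
      finally show ?thesis unfolding m by simp
    qed
    have "6 * int t * (\<Sum>A\<in>Pow {..<m}. \<bar>hook_dev m A d\<bar>) \<le> (\<Sum>A\<in>Pow {..<m}. (hook_dev m A d)\<^sup>2 + 9 * int m)"
      unfolding sum_distrib_left by (intro sum_mono amgm)
    also have "\<dots> \<le> 18 * int m * 2 ^ m"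
      using hook_dev_second_moment[OF d, of m] by (simp add: sum.distrib card_Pow)
    also have "\<dots> = 6 * int t * (3 * int t * 2 ^ m)" unfolding m by (simp add: power2_eq_square)
    finally show ?thesis using t by simp
  qed
  have "int (card ?B) * (6 * int t ^ 3) = (\<Sum>A\<in>?B. 6 * int t ^ 3)" by simp
  also have "\<dots> \<le> (\<Sum>A\<in>?B. ?D A)" by (intro sum_mono) auto
  also have "\<dots> \<le> (\<Sum>A\<in>Pow {..<m}. ?D A)" by (intro sum_mono2) (auto intro: sum_nonneg)
  also have "\<dots> = (\<Sum>d\<in>{1..<m}. \<Sum>A\<in>Pow {..<m}. \<bar>hook_dev m A d\<bar>)" by (rule sum.swap)
  also have "\<dots> \<le> (\<Sum>d\<in>{1..<m}. 3 * int t * 2 ^ m)" by (intro sum_mono each) auto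
  also have "\<dots> \<le> int m * (3 * int t * 2 ^ m)" by simp (intro mult_right_mono, auto)
  also have "\<dots> = 3 * int t ^ 3 * 2 ^ m" unfolding m by (simp add: power2_eq_square power3_eq_cube)
  finally have "3 * int t ^ 3 * (2 * int (card ?B)) \<le> 3 * int t ^ 3 * 2 ^ m" by (simp add: mult_ac)
  then have "2 * int (card ?B) \<le> 2 ^ m" 
    by (rule mult_left_le_imp_le) (use t in simp)
  then have "int (2 * card ?B) \<le> int (2 ^ m)" by simp
  then have B: "2 * card ?B \<le> 2 ^ m" by (simp only: of_nat_le_iff)
  have "card (Pow {..<m}) = card ?G + card ?B"
    by (subst card_Un_disjoint[symmetric]) (auto intro!: arg_cong[where f=card])
  then have "2 ^ m = card ?G + card ?B" by (simp add: card_Pow)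
  then show ?thesis using B by linarith
qed

section \<open>The hook length formula\<close>

text \<open>Up to sign, the residues of $\prod_{l \in L} (1 - 1/(z - l))$. Their first moment turns the
  branching rule into the hook length formula.\<close>

definition residue_weight :: "real set \<Rightarrow> real \<Rightarrow> real" where
  "residue_weight L l = (\<Prod>l'\<in>L - {l}. 1 - 1 / (l - l'))"

lemma residue_weight_insert:
  assumes "finite L" "y \<notin> L"
  shows "l \<in> L \<Longrightarrow> residue_weight (insert y L) l = residue_weight L l * (1 - 1 / (l - y))"
    and "residue_weight (insert y L) y = (\<Prod>l\<in>L. 1 - 1 / (y - l))"
proof -
  show "residue_weight (insert y L) y = (\<Prod>l\<in>L. 1 - 1 / (y - l))"
    using assms by (simp add: residue_weight_def)
  assume "l \<in> L"
  then have "insert y L - {l} = insert y (L - {l})" using assms by auto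
  then show "residue_weight (insert y L) l = residue_weight L l * (1 - 1 / (l - y))"
    using assms by (simp add: residue_weight_def mult.commute)
qed

text \<open>Both sides are rational in z, tend to 1 at infinity and have the same simple poles and
  residues; the induction on \<open>L\<close> replaces this argument by algebra.\<close>

lemma partial_fractions:
  assumes "finite L" "z \<notin> L"
  shows "(\<Prod>l\<in>L. 1 - 1 / (z - l)) = 1 - (\<Sum>l\<in>L. residue_weight L l / (z - l))"
  using assms
proof (induction L arbitrary: z rule: finite_induct)
  case (insert y L)
  let ?w = "residue_weight L"
  have zl: "z \<noteq> l" if "l \<in> L" for l using insert.prems that by auto
  have zy: "z \<noteq> y" using insert.prems by auto
  have wy: "residue_weight (insert y L) y = 1 - (\<Sum>l\<in>L. ?w l / (y - l))"
    using insert by (simp add: residue_weight_insert)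
  have "(\<Sum>l\<in>insert y L. residue_weight (insert y L) l / (z - l))
      = residue_weight (insert y L) y / (z - y) + (\<Sum>l\<in>L. residue_weight (insert y L) l / (z - l))"
    using insert by simp
  also have "(\<Sum>l\<in>L. residue_weight (insert y L) l / (z - l)) = 
      (\<Sum>l\<in>L. ?w l / (z - l) * (1 - 1 / (z - y)) + ?w l / (y - l) / (z - y))"
  proof (rule sum.cong[OF refl])
    fix l assume l: "l \<in> L"
    have ne: "z - l \<noteq> 0" "z - y \<noteq> 0" "l - y \<noteq> 0" "y - l \<noteq> 0" using zl zy insert l by auto
    have "(1 - 1 / (l - y)) / (z - l) = 1 / (z - l) * (1 - 1 / (z - y)) + 1 / (y - l) / (z - y)"
      using ne by (simp add: divide_simps) (simp add: algebra_simps)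
    then have "?w l * ((1 - 1 / (l - y)) / (z - l)) = ?w l * (1 / (z - l) * (1 - 1 / (z - y)) + 1 / (y - l) / (z - y))"
      by simp
    then show "residue_weight (insert y L) l / (z - l) = ?w l / (z - l) * (1 - 1 / (z - y)) + ?w l / (y - l) / (z - y)"
      unfolding residue_weight_insert(1)[OF insert(1,2) l] by (simp add: distrib_left)
  qed
  also have "\<dots> = (\<Sum>l\<in>L. ?w l / (z - l)) * (1 - 1 / (z - y)) + (\<Sum>l\<in>L. ?w l / (y - l)) / (z - y)"
    by (simp add: sum.distrib sum_distrib_right sum_divide_distrib)
  finally have S: "(\<Sum>l\<in>insert y L. residue_weight (insert y L) l / (z - l)) = 
     (1 - (\<Sum>l\<in>L. ?w l / (y - l))) / (z - y) +
     ((\<Sum>l\<in>L. ?w l / (z - l)) * (1 - 1 / (z - y)) + (\<Sum>l\<in>L. ?w l / (y - l)) / (z - y))"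
    unfolding wy .
  have "(\<Prod>l\<in>insert y L. 1 - 1 / (z - l)) = (1 - 1 / (z - y)) * (1 - (\<Sum>l\<in>L. ?w l / (z - l)))"
    using insert by simp
  also have "\<dots> = 1 - (\<Sum>l\<in>insert y L. residue_weight (insert y L) l / (z - l))"
    unfolding S by (simp add: diff_divide_distrib algebra_simps)
  finally show ?case .
qed simp

text \<open>Here and in the next lemma the sums are the coefficients of 1/z and 1/z^2 at infinity in
  \<open>partial_fractions\<close>. The induction obtains them by evaluating the expansion at the
  new point \<open>y\<close>.\<close>

lemma sum_residue_weight: "finite L \<Longrightarrow> (\<Sum>l\<in>L. residue_weight L l) = real (card L)"
proof (induction L rule: finite_induct)
  case (insert y L)
  have "(\<Sum>l\<in>L. residue_weight (insert y L) l) = (\<Sum>l\<in>L. residue_weight L l + residue_weight L l / (y - l))"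
  proof (rule sum.cong[OF refl])
    fix l assume l: "l \<in> L"
    then have "y - l \<noteq> 0" "l - y \<noteq> 0" using insert by auto
    then have "1 - 1 / (l - y) = 1 + 1 / (y - l)" by (simp add: divide_simps) (simp add: algebra_simps)
    have "residue_weight (insert y L) l = residue_weight L l * (1 + 1 / (y - l))"
      unfolding residue_weight_insert(1)[OF insert(1,2) l] \<open>1 - 1 / (l - y) = 1 + 1 / (y - l)\<close> ..
    then show "residue_weight (insert y L) l = residue_weight L l + residue_weight L l / (y - l)"
      by (simp add: distrib_left)
  qed
  then show ?case using insert
    by (simp add: residue_weight_insert(2) partial_fractions sum.distrib)
qed simp

lemma sum_mult_residue_weight:
  "finite L \<Longrightarrow> (\<Sum>l\<in>L. l * residue_weight L l) = \<Sum>L - real (card L) * (real (card L) - 1) / 2"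
proof (induction L rule: finite_induct)
  case (insert y L)
  have "(\<Sum>l\<in>L. l * residue_weight (insert y L) l)
      = (\<Sum>l\<in>L. l * residue_weight L l - residue_weight L l + y * (residue_weight L l / (y - l)))"
  proof (rule sum.cong[OF refl])
    fix l assume l: "l \<in> L"
    then have "y - l \<noteq> 0" "l - y \<noteq> 0" using insert by auto
    then have "l * (1 - 1 / (l - y)) = l - 1 + y * (1 / (y - l))"
      by (simp add: divide_simps) (simp add: algebra_simps)
    then have "residue_weight L l * (l * (1 - 1 / (l - y))) = residue_weight L l * (l - 1 + y * (1 / (y - l)))"
      by simp
    then show "l * residue_weight (insert y L) l = l * residue_weight L l - residue_weight L l + y * (residue_weight L l / (y - l))"
      unfolding residue_weight_insert(1)[OF insert(1,2) l] by (simp add: algebra_simps)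
  qed
  also have "\<dots> = (\<Sum>l\<in>L. l * residue_weight L l) - real (card L) + y * (\<Sum>l\<in>L. residue_weight L l / (y - l))"
    using sum_residue_weight[OF insert(1)] by (simp only: sum.distrib sum_subtractf sum_distrib_left)
  finally show ?case using insert
    by (simp add: residue_weight_insert(2) partial_fractions) (simp add: field_simps)
qed simp

section \<open>Hooks of a set of positions\<close>

definition hook_count :: "nat \<Rightarrow> int set \<Rightarrow> nat" where
  "hook_count k X = (\<Sum>x\<in>X. card ({x<..<int k} - X))"

text \<open>Positions may be negative, and zeros are sought only below \<open>k\<close>, as if every
  position from \<open>k\<close> on held a one. With this convention \<open>hook_count\<close> is
  the size of the partition.\<close>

definition hook_product :: "nat \<Rightarrow> int set \<Rightarrow> real" where
  "hook_product k X = (\<Prod>x\<in>X. \<Prod>y\<in>{x<..<int k} - X. real_of_int (y - x))"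

lemma sum_card_greater:
  fixes X :: "int set"
  assumes "finite X"
  shows "2 * (\<Sum>x\<in>X. real (card {x'\<in>X. x < x'})) = real (card X) * (real (card X) - 1)"
proof -
  have c: "real (card {x'\<in>X. P x'}) = (\<Sum>x'\<in>X. if P x' then 1 else 0)" for P
    using assms by (simp add: sum.If_cases Int_def)
  have "(\<Sum>x\<in>X. real (card {x'\<in>X. x < x'})) = (\<Sum>x\<in>X. real (card {x'\<in>X. x' < x}))"
    unfolding c by (rule sum.swap)
  then have "2 * (\<Sum>x\<in>X. real (card {x'\<in>X. x < x'}))
      = (\<Sum>x\<in>X. real (card {x'\<in>X. x < x'}) + real (card {x'\<in>X. x' < x}))"
    by (simp add: sum.distrib)
  also have "\<dots> = (\<Sum>x\<in>X. real (card X) - 1)"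
  proof (rule sum.cong[OF refl])
    fix x assume x: "x \<in> X"
    have "{x'\<in>X. x < x'} \<union> {x'\<in>X. x' < x} = X - {x}" by auto
    then have "card {x'\<in>X. x < x'} + card {x'\<in>X. x' < x} = card (X - {x})"
      using assms card_Un_disjoint[of "{x'\<in>X. x < x'}" "{x'\<in>X. x' < x}"] by fastforce
    also have "\<dots> = card X - 1" using x assms by simp
    finally have "card {x'\<in>X. x < x'} + card {x'\<in>X. x' < x} = card X - 1" .
    moreover have "card X > 0" using x assms by (auto simp: card_gt_0_iff)
    ultimately have "card {x'\<in>X. x < x'} + card {x'\<in>X. x' < x} + 1 = card X" by linarith
    then have "real (card {x'\<in>X. x < x'} + card {x'\<in>X. x' < x} + 1) = real (card X)" by (simp only:)
    then show "real (card {x'\<in>X. x < x'}) + real (card {x'\<in>X. x' < x}) = real (card X) - 1" by simp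
  qed
  finally show ?thesis by simp
qed

text \<open>If X has k elements, the numbers k - 1 - x are the beta numbers of the partition. In
  this form the size is the right-hand side of \<open>sum_mult_residue_weight\<close> for the set of
  these numbers.\<close>

lemma hook_count_eq:
  assumes "finite X" "X \<subseteq> {..<int k}"
  shows "real (hook_count k X) = (\<Sum>x\<in>X. real_of_int (int k - 1 - x)) - real (card X) * (real (card X) - 1) / 2"
proof -
  have "real (card ({x<..<int k} - X)) = real_of_int (int k - 1 - x) - real (card {x'\<in>X. x < x'})" if "x \<in> X" for x
  proof -
    have "{x'\<in>X. x < x'} \<subseteq> {x<..<int k}" using assms by auto
    then have le: "card {x'\<in>X. x < x'} \<le> card {x<..<int k}" by (intro card_mono) auto
    moreover have "{x<..<int k} - X = {x<..<int k} - {x'\<in>X. x < x'}" by auto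
    then have "card ({x<..<int k} - X) = card {x<..<int k} - card {x'\<in>X. x < x'}"
      using assms by (simp only:) (rule card_Diff_subset, auto)
    moreover have "int (card {x<..<int k}) = int k - 1 - x" using assms that by auto
    ultimately show ?thesis by (metis of_int_of_nat_eq of_nat_diff)
  qed
  then have "real (hook_count k X) = (\<Sum>x\<in>X. real_of_int (int k - 1 - x)) - (\<Sum>x\<in>X. real (card {x'\<in>X. x < x'}))"
    unfolding hook_count_def by (simp add: sum_subtractf del: of_int_diff)
  then show ?thesis using sum_card_greater[OF assms(1)] by simp
qed

text \<open>In terms of l = k - 1 - x this is l times \<open>residue_weight\<close> at l. By
  \<open>hook_product_unmove\<close> it is the quotient of the hook products before and after the
  one at \<open>x\<close> moves to \<open>x + 1\<close>.\<close>

definition move_weight :: "nat \<Rightarrow> int set \<Rightarrow> int \<Rightarrow> real" where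
  "move_weight k X x = real_of_int (int k - 1 - x) * (\<Prod>x'\<in>X - {x}. 1 - 1 / real_of_int (x' - x))"

lemma sum_move_weight:
  assumes "finite X" "X \<subseteq> {..<int k}"
  shows "(\<Sum>x\<in>X. move_weight k X x) = real (hook_count k X)"
proof -
  let ?g = "\<lambda>x. real_of_int (int k - 1 - x)"
  have inj: "inj_on ?g A" for A by (auto simp: inj_on_def)
  have "(\<Sum>x\<in>X. move_weight k X x) = (\<Sum>x\<in>X. ?g x * residue_weight (?g ` X) (?g x))"
  proof (rule sum.cong[OF refl])
    fix x assume "x \<in> X"
    have "?g ` X - {?g x} = ?g ` (X - {x})" by auto
    then have "residue_weight (?g ` X) (?g x) = (\<Prod>x'\<in>X - {x}. 1 - 1 / (?g x - ?g x'))"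
      unfolding residue_weight_def by (simp only: prod.reindex[OF inj] comp_def)
    then show "move_weight k X x = ?g x * residue_weight (?g ` X) (?g x)"
      unfolding move_weight_def by simp
  qed
  also have "\<dots> = (\<Sum>l\<in>?g ` X. l * residue_weight (?g ` X) l)"
    by (simp only: sum.reindex[OF inj] comp_def)
  also have "\<dots> = (\<Sum>l\<in>?g ` X. l) - real (card (?g ` X)) * (real (card (?g ` X)) - 1) / 2"
    using assms by (intro sum_mult_residue_weight) auto
  also have "\<dots> = real (hook_count k X)"
    using assms by (simp only: card_image[OF inj] sum.reindex[OF inj] comp_def hook_count_eq)
  finally show ?thesis .
qed

lemma prod_interval_minus:
  assumes "finite Y" "Y \<subseteq> {..<int k}" "x < int k"
  shows "(\<Prod>y\<in>{x<..<int k} - Y. real_of_int (y - x)) * (\<Prod>y\<in>{y\<in>Y. x < y}. real_of_int (y - x)) = fact (nat (int k - 1 - x))"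
proof -
  have "{x<..<int k} = ({x<..<int k} - Y) \<union> {y\<in>Y. x < y}" using assms by auto
  then have "(\<Prod>y\<in>{x<..<int k} - Y. real_of_int (y - x)) * (\<Prod>y\<in>{y\<in>Y. x < y}. real_of_int (y - x))
      = (\<Prod>y\<in>{x<..<int k}. real_of_int (y - x))"
    using assms by (subst prod.union_disjoint[symmetric]) auto
  also have "\<dots> = (\<Prod>i\<in>{1..nat (int k - 1 - x)}. real i)"
    by (rule prod.reindex_bij_witness[of _ "\<lambda>i. int i + x" "\<lambda>y. nat (y - x)"]) (use assms in auto)
  also have "\<dots> = fact (nat (int k - 1 - x))" by (simp add: fact_prod)
  finally show ?thesis .
qed

text \<open>A one put at \<open>x\<close> destroys the hooks that ended at the zero there, and
  starts hooks to all zeros on its right. The lengths of the new hooks are 1, ..., k - 1 - x except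
  the distances to ones.\<close>

lemma hook_product_insert:
  assumes Y: "finite Y" "Y \<subseteq> {..<int k}" and x: "x \<notin> Y" "x < int k"
  shows "hook_product k (insert x Y) * (\<Prod>y\<in>{y\<in>Y. y < x}. real_of_int (x - y)) * (\<Prod>y\<in>{y\<in>Y. x < y}. real_of_int (y - x)) = hook_product k Y * fact (nat (int k - 1 - x))"
proof -
  have a: "(\<Prod>y\<in>{x'<..<int k} - insert x Y. real_of_int (y - x')) * (if x' < x then real_of_int (x - x') else 1)
      = (\<Prod>y\<in>{x'<..<int k} - Y. real_of_int (y - x'))" for x'
  proof (cases "x' < x")
    case True
    then have eq: "{x'<..<int k} - Y = insert x ({x'<..<int k} - insert x Y)" using x by auto
    have "(\<Prod>y\<in>{x'<..<int k} - Y. real_of_int (y - x')) =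
        real_of_int (x - x') * (\<Prod>y\<in>{x'<..<int k} - insert x Y. real_of_int (y - x'))"
      by (subst eq, subst prod.insert) auto
    then show ?thesis using True by (simp add: mult.commute)
  next
    case False
    then have "{x'<..<int k} - Y = ({x'<..<int k} - insert x Y) \<or> x = x'" by auto
    then show ?thesis
    proof
      assume "x = x'"
      then have "{x'<..<int k} - Y = ({x'<..<int k} - insert x Y)" by auto
      then show ?thesis using False by simp
    qed (use False in simp)
  qed
  have "(\<Prod>y\<in>{y\<in>Y. y < x}. real_of_int (x - y)) = (\<Prod>y\<in>Y. if y < x then real_of_int (x - y) else 1)"
    by (rule prod.inter_filter[OF Y(1)])
  then have rest: "hook_product k Y = (\<Prod>x'\<in>Y. \<Prod>y\<in>{x'<..<int k} - insert x Y. real_of_int (y - x')) * (\<Prod>y\<in>{y\<in>Y. y < x}. real_of_int (x - y))"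
    unfolding hook_product_def by (simp only: prod.distrib[symmetric] a)
  have "{x<..<int k} - insert x Y = {x<..<int k} - Y" by auto
  then have new: "hook_product k (insert x Y) = (\<Prod>y\<in>{x<..<int k} - Y. real_of_int (y - x)) * (\<Prod>x'\<in>Y. \<Prod>y\<in>{x'<..<int k} - insert x Y. real_of_int (y - x'))"
    unfolding hook_product_def using Y x by simp
  show ?thesis unfolding new rest prod_interval_minus[OF Y x(2), symmetric] by (simp only: mult_ac)
qed

text \<open>Removal of a box of content \<open>a\<close>; \<open>removable\<close> collects the
  contents of the removable boxes.\<close>

abbreviation unmove :: "int \<Rightarrow> int set \<Rightarrow> int set" where
  "unmove a X \<equiv> insert a (X - {a - 1})"

abbreviation removable :: "nat \<Rightarrow> int set \<Rightarrow> int set" where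
  "removable k X \<equiv> {a. a - 1 \<in> X \<and> a \<notin> X \<and> a < int k}"

lemma card_unmove:
  assumes "finite X" "a - 1 \<in> X" "a \<notin> X"
  shows "card (unmove a X) = card X"
proof -
  have "card (unmove a X) = Suc (card (X - {a - 1}))" using assms by (intro card_insert_disjoint) auto
  also have "\<dots> = card X" using assms by (intro card.remove[symmetric])
  finally show ?thesis .
qed

text \<open>Both sets arise from X without a - 1 by inserting one point, so
  \<open>hook_product_insert\<close> relates both products to the same third one. The factorials
  leave k - 1 - x, and the distances to the other ones change by 1, which gives the factors of
  \<open>move_weight\<close>.\<close>

lemma hook_product_unmove:
  assumes X: "finite X" "X \<subseteq> {..<int k}" and a: "a - 1 \<in> X" "a \<notin> X" "a < int k"
  shows "hook_product k X = hook_product k (unmove a X) * move_weight k X (a - 1)"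
proof -
  define x Y where "x = a - 1" and "Y = X - {x}"
  have Y: "finite Y" "Y \<subseteq> {..<int k}" "x \<notin> Y" "x + 1 \<notin> Y" "X = insert x Y" "unmove a X = insert (x + 1) Y"
    using X a by (auto simp: x_def Y_def)
  have xk: "x + 1 < int k" using a by (simp add: x_def)
  let ?A = "{y\<in>Y. y < x}" and ?B = "{y\<in>Y. x < y}"
  have AB: "{y\<in>Y. y < x + 1} = ?A" "{y\<in>Y. x + 1 < y} = ?B" 
    using Y by (auto intro: order.not_eq_order_implies_strict simp: order.strict_iff_order)
  define A0 A1 B0 B1 where "A0 = (\<Prod>y\<in>?A. real_of_int (x - y))" and "A1 = (\<Prod>y\<in>?A. real_of_int (x + 1 - y))"
    and "B0 = (\<Prod>y\<in>?B. real_of_int (y - x))" and "B1 = (\<Prod>y\<in>?B. real_of_int (y - (x + 1)))"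
  have fin: "finite ?A" "finite ?B" using Y by auto
  have pos: "A0 \<noteq> 0" "A1 \<noteq> 0" "B0 \<noteq> 0" "B1 \<noteq> 0"
    unfolding A0_def A1_def B0_def B1_def using fin Y
    by (auto simp: prod_zero_iff simp del: of_int_diff of_int_add)
  have e0: "hook_product k X * A0 * B0 = hook_product k Y * fact (nat (int k - 1 - x))"
    unfolding A0_def B0_def Y(5) using Y xk by (intro hook_product_insert) auto
  have e1: "hook_product k (unmove a X) * A1 * B1 = hook_product k Y * fact (nat (int k - 1 - (x + 1)))"
    using hook_product_insert[OF Y(1,2) Y(4) xk] unfolding AB Y(6) A1_def B1_def by simp
  have "nat (int k - 1 - x) = Suc (nat (int k - 1 - (x + 1)))" using xk by simp
  then have f: "fact (nat (int k - 1 - x)) = real_of_int (int k - 1 - x) * fact (nat (int k - 1 - (x + 1)))"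
    using xk by (simp only: fact_Suc) simp
  have "hook_product k X * A0 * B0 = real_of_int (int k - 1 - x) * (hook_product k (unmove a X) * A1 * B1)"
    unfolding e0 e1 f by simp
  then have main: "hook_product k X = hook_product k (unmove a X) * (real_of_int (int k - 1 - x) * (A1 / A0 * (B1 / B0)))"
    using pos by (simp add: field_simps)
  have AB_Y: "?A \<union> ?B = Y" and disj: "?A \<inter> ?B = {}" using Y by auto
  have "(\<Prod>y\<in>Y. 1 - 1 / real_of_int (y - x)) = (\<Prod>y\<in>?A. 1 - 1 / real_of_int (y - x)) * (\<Prod>y\<in>?B. 1 - 1 / real_of_int (y - x))"
    using prod.union_disjoint[OF fin disj, of "\<lambda>y. 1 - 1 / real_of_int (y - x)"] unfolding AB_Y .
  also have "(\<Prod>y\<in>?A. 1 - 1 / real_of_int (y - x)) = (\<Prod>y\<in>?A. real_of_int (x + 1 - y) / real_of_int (x - y))"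
    by (rule prod.cong[OF refl]) (auto simp: divide_simps algebra_simps)
  also have "(\<Prod>y\<in>?B. 1 - 1 / real_of_int (y - x)) = (\<Prod>y\<in>?B. real_of_int (y - (x + 1)) / real_of_int (y - x))"
    by (rule prod.cong[OF refl]) (auto simp: divide_simps)
  finally have "(\<Prod>y\<in>Y. 1 - 1 / real_of_int (y - x)) = A1 / A0 * (B1 / B0)"
    unfolding A0_def A1_def B0_def B1_def by (simp add: prod_dividef)
  moreover have "X - {x} = Y" by (simp add: Y_def)
  ultimately have "move_weight k X (a - 1) = real_of_int (int k - 1 - x) * (A1 / A0 * (B1 / B0))"
    unfolding move_weight_def x_def[symmetric] by (simp only:)
  then show ?thesis using main by simp
qed

lemma hook_count_unmove:
  assumes X: "finite X" "X \<subseteq> {..<int k}" and a: "a - 1 \<in> X" "a \<notin> X" "a < int k"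
  shows "hook_count k X = Suc (hook_count k (unmove a X))"
proof -
  have card: "card (unmove a X) = card X" using X a by (intro card_unmove) auto
  have "(\<Sum>x\<in>X. real_of_int (int k - 1 - x)) = real_of_int (int k - 1 - (a - 1)) + (\<Sum>x\<in>X-{a-1}. real_of_int (int k - 1 - x))"
    by (rule sum.remove[OF X(1) a(1)])
  moreover have "(\<Sum>x\<in>unmove a X. real_of_int (int k - 1 - x)) = real_of_int (int k - 1 - a) + (\<Sum>x\<in>X-{a-1}. real_of_int (int k - 1 - x))"
    using X a by simp
  ultimately have "real (hook_count k X) = real (hook_count k (unmove a X)) + 1"
  proof -
    have "finite (unmove a X)" "unmove a X \<subseteq> {..<int k}" using X a by auto
    from hook_count_eq[OF this, unfolded card] hook_count_eq[OF X] show ?thesis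
      using \<open>(\<Sum>x\<in>X. real_of_int (int k - 1 - x)) = _\<close> \<open>(\<Sum>x\<in>unmove a X. real_of_int (int k - 1 - x)) = _\<close>
      by simp
  qed
  then show ?thesis by linarith
qed

lemma hook_count_0_imp:
  assumes X: "finite X" "X \<subseteq> {..<int k}" "card X = k" and "hook_count k X = 0"
  shows "X = {0..<int k}"
proof (cases "k = 0")
  case True then show ?thesis using X by simp
next
  case False
  then have ne: "X \<noteq> {}" using X by auto
  define m where "m = Min X"
  have m: "m \<in> X" "\<And>x. x \<in> X \<Longrightarrow> m \<le> x" using X ne by (auto simp: m_def)
  have "card ({m<..<int k} - X) = 0" using assms m unfolding hook_count_def by simp
  then have "{m<..<int k} \<subseteq> X" by simp
  then have eq: "X = {m..<int k}" using m X by (auto simp: order.order_iff_strict)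
  have "m < int k" using m X by auto
  then have "m = 0" using X(3) eq by simp
  then show ?thesis using eq by simp
qed

text \<open>A partition with at most k parts is the set of positions of the k ones of its word, shifted so
  that the empty partition is {0..<k}. Moving a one from c to c - 1 adds a box of content c.\<close>

primrec state :: "nat \<Rightarrow> (nat \<Rightarrow> int) \<Rightarrow> nat \<Rightarrow> int set" where
  "state k c 0 = {0..<int k}"
| "state k c (Suc j) = insert (c j - 1) (state k c j - {c j})"

text \<open>The content sequences of the standard tableaux with n boxes and at most k rows. The
  value 0 from index \<open>n\<close> on makes equal sequences equal functions and the set of paths
  finite.\<close>

definition paths :: "nat \<Rightarrow> nat \<Rightarrow> (nat \<Rightarrow> int) set" where
  "paths k n = {c. (\<forall>j<n. c j \<in> state k c j \<and> c j - 1 \<notin> state k c j) \<and> (\<forall>j\<ge>n. c j = 0)}"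

definition paths_to :: "nat \<Rightarrow> nat \<Rightarrow> int set \<Rightarrow> (nat \<Rightarrow> int) set" where
  "paths_to k n X = {c \<in> paths k n. state k c n = X}"

lemma state_cong: "(\<And>j. j < n \<Longrightarrow> c j = c' j) \<Longrightarrow> state k c n = state k c' n"
  by (induction n) auto

lemma state_upd [simp]: "n \<le> j \<Longrightarrow> state k (c(j := a)) n = state k c n"
  by (rule state_cong) auto

lemma finite_state [simp]: "finite (state k c n)"
  by (induction n) auto

lemma paths_Suc:
  "c \<in> paths k (Suc n) \<longleftrightarrow> c(n := 0) \<in> paths k n \<and> c n \<in> state k c n \<and> c n - 1 \<notin> state k c n"
proof -
  have "(\<forall>j\<ge>n. (c(n := 0)) j = 0) \<longleftrightarrow> (\<forall>j\<ge>Suc n. c j = 0)"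
    by (metis Suc_le_eq fun_upd_apply nat_less_le)
  then show ?thesis unfolding paths_def mem_Collect_eq less_Suc_eq by auto
qed

lemma finite_paths: "finite (paths k n)"
proof (induction n)
  case 0
  have "paths k 0 \<subseteq> {\<lambda>_. 0}" by (auto simp: paths_def)
  then show ?case by (rule finite_subset) simp
next
  case (Suc n)
  have "paths k (Suc n) \<subseteq> (\<Union>c\<in>paths k n. (\<lambda>a. c(n := a)) ` state k c n)"
  proof
    fix c assume "c \<in> paths k (Suc n)"
    then have "c(n := 0) \<in> paths k n" "c n \<in> state k (c(n := 0)) n" "c = (c(n := 0))(n := c n)"
      by (auto simp: paths_Suc)
    then show "c \<in> (\<Union>c\<in>paths k n. (\<lambda>a. c(n := a)) ` state k c n)" by blast
  qed
  then show ?case by (rule finite_subset) (use Suc in auto)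
qed

lemma finite_paths_to: "finite (paths_to k n X)"
  by (rule finite_subset[OF _ finite_paths[of k n]]) (auto simp: paths_to_def)

lemma state_less: "c \<in> paths k n \<Longrightarrow> state k c n \<subseteq> {..<int k}"
proof (induction n arbitrary: c)
  case (Suc n)
  then have "c(n := 0) \<in> paths k n" and c: "c n \<in> state k c n" by (auto simp: paths_Suc)
  with Suc.IH have "state k c n \<subseteq> {..<int k}" by fastforce
  then show ?case using c by auto
qed auto

text \<open>The branching rule: a tableau is a tableau with one box less together with its last
  box.\<close>

lemma paths_to_Suc:
  "paths_to k (Suc n) X = (\<Union>a\<in>removable k X. (\<lambda>c. c(n := a)) ` paths_to k n (unmove a X))"
proof (intro equalityI subsetI)
  fix c assume "c \<in> paths_to k (Suc n) X"
  then have c: "c(n := 0) \<in> paths k n" "c n \<in> state k c n" "c n - 1 \<notin> state k c n"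
     "X = insert (c n - 1) (state k c n - {c n})"
    by (auto simp: paths_to_def paths_Suc)
  have "c n < int k" using state_less[OF c(1)] c(2) by auto
  moreover have "state k c n = unmove (c n) X" using c by auto
  then have "c(n := 0) \<in> paths_to k n (unmove (c n) X)" using c by (simp add: paths_to_def)
  then have "c \<in> (\<lambda>c'. c'(n := c n)) ` paths_to k n (unmove (c n) X)"
    by (intro image_eqI[of _ _ "c(n := 0)"]) simp_all
  moreover have "c n - 1 \<in> X" "c n \<notin> X" using c by auto
  ultimately show "c \<in> (\<Union>a\<in>removable k X. (\<lambda>c. c(n := a)) ` paths_to k n (unmove a X))"
    by (intro UN_I[of "c n"]) auto
next
  fix c assume "c \<in> (\<Union>a\<in>removable k X. (\<lambda>c. c(n := a)) ` paths_to k n (unmove a X))"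
  then obtain a c' where a: "a - 1 \<in> X" "a \<notin> X" and c': "c' \<in> paths k n" "state k c' n = unmove a X" and c: "c = c'(n := a)"
    by (auto simp: paths_to_def)
  have "c'(n := 0) = c'" using c' by (auto simp: paths_def)
  then show "c \<in> paths_to k (Suc n) X" using a c' by (auto simp: paths_to_def paths_Suc c)
qed

text \<open>By the branching rule and \<open>hook_product_unmove\<close> the induction step reduces
  to the statement that the weights of the removable boxes add up to the number of boxes, which is
  \<open>sum_move_weight\<close>.\<close>

theorem hook_length_formula:
  assumes "finite X" "X \<subseteq> {..<int k}" "card X = k" "hook_count k X = n"
  shows "real (card (paths_to k n X)) * hook_product k X = fact n"
  using assms
proof (induction n arbitrary: X)
  case 0
  then have X: "X = {0..<int k}" by (intro hook_count_0_imp) auto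
  have "paths_to k 0 X = {\<lambda>_. 0}" unfolding X by (auto simp: paths_to_def paths_def)
  moreover have "{x<..<int k} - X = {}" if "x \<in> X" for x using that X by auto
  then have "hook_product k X = (\<Prod>x\<in>X. 1)"
    unfolding hook_product_def by (intro prod.cong refl) (metis prod.empty)
  then have "hook_product k X = 1" by simp
  ultimately show ?case by simp
next
  case (Suc n)
  let ?R = "removable k X"
  have finR: "finite ?R"
  proof (rule finite_subset)
    show "?R \<subseteq> (\<lambda>x. x + 1) ` X" by (auto intro: image_eqI[of _ _ "_ - 1"])
  qed (use Suc.prems in simp)
  have inj: "inj_on (\<lambda>c. c(n := a)) (paths_to k n Z)" for a Z
  proof (rule inj_onI)
    fix c c' assume "c \<in> paths_to k n Z" "c' \<in> paths_to k n Z" and eq: "c(n := a) = c'(n := a)"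
    then have "c n = 0" "c' n = 0" by (auto simp: paths_to_def paths_def)
    then show "c = c'" using eq by (metis fun_upd_triv fun_upd_upd)
  qed
  have "card (paths_to k (Suc n) X) = (\<Sum>a\<in>?R. card ((\<lambda>c. c(n := a)) ` paths_to k n (unmove a X)))"
    unfolding paths_to_Suc
  proof (rule card_UN_disjoint[OF finR])
    show "\<forall>a\<in>?R. finite ((\<lambda>c. c(n := a)) ` paths_to k n (unmove a X))" using finite_paths_to by auto
    show "\<forall>a\<in>?R. \<forall>b\<in>?R. a \<noteq> b \<longrightarrow> (\<lambda>c. c(n := a)) ` paths_to k n (unmove a X) \<inter> (\<lambda>c. c(n := b)) ` paths_to k n (unmove b X) = {}"
      by (auto dest: fun_upd_eqD)
  qed
  also have "\<dots> = (\<Sum>a\<in>?R. card (paths_to k n (unmove a X)))" by (simp add: card_image[OF inj])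
  finally have "real (card (paths_to k (Suc n) X)) * hook_product k X = (\<Sum>a\<in>?R. real (card (paths_to k n (unmove a X))) * hook_product k X)"
    by (simp add: sum_distrib_right)
  also have "\<dots> = (\<Sum>a\<in>?R. fact n * move_weight k X (a - 1))"
  proof (rule sum.cong[OF refl])
    fix a assume a: "a \<in> ?R"
    have "hook_count k (unmove a X) = n" using hook_count_unmove[of X k a] Suc.prems a by simp
    moreover have "card (unmove a X) = card X" by (rule card_unmove) (use Suc.prems a in auto)
    then have "card (unmove a X) = k" using Suc.prems(3) by (simp only:)
    ultimately have "real (card (paths_to k n (unmove a X))) * hook_product k (unmove a X) = fact n"
      using Suc.prems a by (intro Suc.IH) auto
    then show "real (card (paths_to k n (unmove a X))) * hook_product k X = fact n * move_weight k X (a - 1)"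
      using hook_product_unmove[of X k a] Suc.prems a by simp
  qed
  also have "\<dots> = fact n * (\<Sum>a\<in>?R. move_weight k X (a - 1))" by (simp add: sum_distrib_left)
  also have "(\<Sum>a\<in>?R. move_weight k X (a - 1)) = (\<Sum>x\<in>{x\<in>X. x + 1 \<notin> X \<and> x + 1 < int k}. move_weight k X x)"
    by (rule sum.reindex_bij_witness[of _ "\<lambda>x. x + 1" "\<lambda>a. a - 1"]) auto
  also have "\<dots> = (\<Sum>x\<in>X. move_weight k X x)"
  \<comment> \<open>All other ones have weight 0: with a one directly to the right the factor 1 -
    1/1 vanishes, and at k - 1 the leading factor does.\<close>
  proof (rule sum.mono_neutral_left)
    show "\<forall>x\<in>X - {x\<in>X. x + 1 \<notin> X \<and> x + 1 < int k}. move_weight k X x = 0"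
    proof
      fix x assume x: "x \<in> X - {x\<in>X. x + 1 \<notin> X \<and> x + 1 < int k}"
      consider "x + 1 \<in> X" | "int k - 1 - x = 0" using x Suc.prems by force
      then show "move_weight k X x = 0"
      proof cases
        case 1
        then have "x + 1 \<in> X - {x}" by auto
        then have "(\<Prod>x'\<in>X - {x}. 1 - 1 / real_of_int (x' - x)) = 0"
          using Suc.prems by (intro prod_zero bexI[of _ "x + 1"]) auto
        then show ?thesis unfolding move_weight_def by simp
      qed (simp add: move_weight_def)
    qed
  qed (use Suc.prems in auto)
  also have "\<dots> = real (Suc n)" using Suc.prems by (simp add: sum_move_weight)
  finally show ?case by (simp add: mult.commute)
qed

section \<open>Finitely many irreducible characters\<close>

lemma mat_trace_mult_commute:
  assumes "A \<in> carrier_mat n m" "B \<in> carrier_mat m n"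
  shows "mat_trace (A * B) = mat_trace (B * A)"
proof -
  have "mat_trace (A * B) = (\<Sum>i<n. \<Sum>j<m. A $$ (i, j) * B $$ (j, i))"
    unfolding mat_trace_def using assms by (simp add: scalar_prod_def atLeast0LessThan)
  also have "\<dots> = (\<Sum>j<m. \<Sum>i<n. B $$ (j, i) * A $$ (i, j))"
    by (subst sum.swap) (simp add: mult.commute)
  also have "\<dots> = mat_trace (B * A)"
    unfolding mat_trace_def using assms by (simp add: scalar_prod_def atLeast0LessThan)
  finally show ?thesis .
qed

text \<open>Triangularise: the trace is the sum of the eigenvalues, and applying A^N to an
  eigenvector shows that each of them is an N-th root of unity.\<close>

lemma mat_trace_finite_order:
  assumes A: "A \<in> carrier_mat d d" and N: "A ^\<^sub>m N = 1\<^sub>m d"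
  shows "\<exists>es. length es = d \<and> set es \<subseteq> {z. z ^ N = 1} \<and> mat_trace A = sum_list es"
proof -
  obtain es where es: "char_poly A = (\<Prod>a\<leftarrow>es. [:- a, 1:])" "length es = d"
    using char_poly_factorized[OF A] by auto
  obtain B P Q where BPQ: "schur_decomposition A es = (B, P, Q)" by (cases "schur_decomposition A es")
  have sim: "similar_mat_wit A B P Q" and diag: "diag_mat B = es"
    using schur_decomposition[OF A es(1) BPQ] by auto
  from similar_mat_witD2[OF A sim]
  have S: "Q * P = 1\<^sub>m d" "A = P * B * Q" "B \<in> carrier_mat d d" "P \<in> carrier_mat d d" "Q \<in> carrier_mat d d"
    by auto
  have "mat_trace A = mat_trace (Q * (P * B))"
    unfolding S(2) by (rule mat_trace_mult_commute[OF mult_carrier_mat[OF S(4,3)] S(5)])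
  also have "Q * (P * B) = B" using S by (simp flip: assoc_mult_mat)
  also have "mat_trace B = sum_list es"
    unfolding diag[symmetric] diag_mat_def mat_trace_def by (simp add: sum_list_sum_nth atLeast0LessThan)
  finally have tr: "mat_trace A = sum_list es" .
  have "a ^ N = 1" if a: "a \<in> set es" for a
  proof -
    have "poly (char_poly A) a = 0" unfolding es(1) using a by (induction es) auto
    then obtain v where v: "v \<in> carrier_vec d" "v \<noteq> 0\<^sub>v d" "A *\<^sub>v v = a \<cdot>\<^sub>v v"
      using eigenvalue_root_char_poly[OF A] A unfolding eigenvalue_def eigenvector_def by auto
    have "(A ^\<^sub>m m) *\<^sub>v v = a ^ m \<cdot>\<^sub>v v" for m
    proof (induction m)
      case 0
      then show ?case using v A by simp
    next
      case (Suc m)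
      have "(A ^\<^sub>m Suc m) *\<^sub>v v = A ^\<^sub>m m *\<^sub>v (A *\<^sub>v v)"
        using A v by (simp add: assoc_mult_mat_vec[of _ d d _ d])
      also have "\<dots> = a \<cdot>\<^sub>v (A ^\<^sub>m m *\<^sub>v v)" unfolding v(3) using A v by (simp add: mult_mat_vec[of _ d d])
      finally show ?case using Suc by (simp add: smult_smult_assoc)
    qed
    from this[of N] have eq: "v = a ^ N \<cdot>\<^sub>v v" using N v by simp
    obtain i where i: "i < d" "v $ i \<noteq> 0" using v by (auto simp: vec_eq_iff)
    have "v $ i = a ^ N * v $ i" using arg_cong[OF eq, of "\<lambda>w. w $ i"] i v by simp
    then show ?thesis using i by simp
  qed
  then show ?thesis using es tr by auto
qed

context
  fixes G :: "('g, 'm) monoid_scheme" (structure) and d :: nat and \<rho> :: "'g \<Rightarrow> complex mat"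
  assumes G: "group G" and finG: "finite (carrier G)" and hom: "is_representation G d \<rho>"
begin

lemma representation_carrier: "g \<in> carrier G \<Longrightarrow> \<rho> g \<in> carrier_mat d d"
proof -
  assume "g \<in> carrier G"
  then have "\<rho> g \<in> carrier (general_linear_group d)"
    using group_hom.hom_closed[OF hom[unfolded is_representation_def]] by simp
  then show ?thesis by (auto simp: general_linear_group_def units_of_def Units_def ring_mat_simps)
qed

lemma representation_mult: "g \<in> carrier G \<Longrightarrow> h \<in> carrier G \<Longrightarrow> \<rho> (g \<otimes> h) = \<rho> g * \<rho> h"
  using group_hom.hom_mult[OF hom[unfolded is_representation_def], of g h]
  by (simp add: general_linear_group_def units_of_def ring_mat_simps)

lemma representation_one: "\<rho> \<one> = 1\<^sub>m d"
  using group_hom.hom_one[OF hom[unfolded is_representation_def]]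
  by (simp add: general_linear_group_def units_of_def ring_mat_simps)

lemma representation_pow: "g \<in> carrier G \<Longrightarrow> \<rho> (g [^] (m::nat)) = \<rho> g ^\<^sub>m m"
proof (induction m)
  case 0
  then show ?case using representation_carrier[of g] by (simp add: representation_one)
next
  case (Suc m)
  then show ?case using group.is_monoid[OF G] by (simp add: representation_mult monoid.nat_pow_closed)
qed

lemma representation_trace:
  assumes g: "g \<in> carrier G"
  shows "\<exists>es. length es = d \<and> set es \<subseteq> {z. z ^ card (carrier G) = 1} \<and> mat_trace (\<rho> g) = sum_list es"
proof (rule mat_trace_finite_order[OF representation_carrier[OF g]])
  show "\<rho> g ^\<^sub>m card (carrier G) = 1\<^sub>m d"
    using group.pow_order_eq_1[OF G g] representation_pow[OF g, of "card (carrier G)"] representation_one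
    by (simp add: Coset.order_def)
qed

text \<open>The orbit of a non-zero vector spans an invariant subspace, hence the whole
  space.\<close>

lemma irreducible_representation_dim_le:
  assumes irr: "irreducible_representation G d \<rho>"
  shows "d \<le> card (carrier G)"
proof -
  interpret vec_space "TYPE(complex)" d .
  have d: "d > 0" using irr by (simp add: irreducible_representation_def)
  define v where "v = (unit_vec d 0 :: complex vec)"
  have v: "v \<in> carrier_vec d" "v \<noteq> 0\<^sub>v d" using d by (auto simp: v_def)
  define S where "S = (\<lambda>g. \<rho> g *\<^sub>v v) ` carrier G"
  have S: "S \<subseteq> carrier_vec d" unfolding S_def using mult_mat_vec_carrier[OF representation_carrier v(1)] by auto
  have finS: "finite S" unfolding S_def using finG by simp
  have sub: "VectorSpace.subspace class_ring (span S) V" by (rule span_is_subspace) (use S in simp)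
  have sm: "submodule class_ring (span S) V" by (rule span_is_submodule) (use S in simp)
  have inv: "\<rho> h *\<^sub>v w \<in> span S" if h: "h \<in> carrier G" and w: "w \<in> span S" for h w
  proof -
    \<comment> \<open>The preimage of the span under \<open>\<rho> h\<close> is a subspace that
      contains the orbit, hence it contains the span.\<close>
    let ?N = "{w \<in> carrier_vec d. \<rho> h *\<^sub>v w \<in> span S}"
    have rh: "\<rho> h \<in> carrier_mat d d" using representation_carrier[OF h] .
    have "submodule class_ring ?N V"
    proof (rule submodule.intro)
      show "Module.module class_ring V" by (rule vec_module)
      show "v \<oplus>\<^bsub>V\<^esub> w \<in> ?N" if "v \<in> ?N" "w \<in> ?N" for v w
        using that submodule.m_closed[OF sm] rh by (auto simp: mult_add_distrib_mat_vec[of _ d d] module_vec_simps)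
      have "\<rho> h *\<^sub>v 0\<^sub>v d = 0\<^sub>v d" using rh by (intro eq_vecI) auto
      then show "\<zero>\<^bsub>V\<^esub> \<in> ?N" using submodule.zero_closed[OF sm] rh by (auto simp: module_vec_simps)
      show "c \<odot>\<^bsub>V\<^esub> v \<in> ?N" if "c \<in> carrier class_ring" "v \<in> ?N" for c v
        using that submodule.smult_closed[OF sm, of c] rh by (auto simp: mult_mat_vec[of _ d d] module_vec_simps)
    qed (auto simp: module_vec_simps)
    moreover have "S \<subseteq> ?N"
    proof
      fix u assume "u \<in> S"
      then obtain g where g: "g \<in> carrier G" "u = \<rho> g *\<^sub>v v" by (auto simp: S_def)
      have "\<rho> h *\<^sub>v u = \<rho> (h \<otimes> g) *\<^sub>v v"
        using g h v rh representation_carrier[OF g(1)]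
        by (simp add: representation_mult assoc_mult_mat_vec[of _ d d _ d])
      then have "\<rho> h *\<^sub>v u \<in> S" unfolding S_def using g h group.is_monoid[OF G] by (auto intro: monoid.m_closed)
      then show "u \<in> ?N" using in_own_span[of S] S \<open>u \<in> S\<close> by auto
    qed
    ultimately have "span S \<subseteq> ?N" by (intro span_is_subset)
    then show ?thesis using w by auto
  qed
  have "invariant_subspace G d \<rho> (span S)" unfolding invariant_subspace_def using sub inv by auto
  moreover have "v \<in> span S"
  proof -
    have "v = \<rho> \<one> *\<^sub>v v" using v by (simp add: representation_one)
    then have "v \<in> S" unfolding S_def using monoid.one_closed[OF group.is_monoid[OF G]] by blast
    then show ?thesis using in_own_span[of S] S by auto
  qed
  then have "span S \<noteq> {0\<^sub>v d}" using v by auto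
  ultimately have "span S = carrier_vec d" using irr unfolding irreducible_representation_def by blast
  then have "dim \<le> card S" using S by (intro gen_ge_dim finS) auto
  also have "card S \<le> card (carrier G)" unfolding S_def using finG by (rule card_image_le)
  finally show ?thesis by (simp add: dim_is_n)
qed

end

text \<open>Lower bounds for multiplicities depend on this, since \<open>mset_set\<close> of an
  infinite set is empty. All values lie in the finite set of sums of at most |G| complex numbers z
  with z^|G| = 1.\<close>

lemma finite_irreducible_characters:
  fixes G :: "('g, 'm) monoid_scheme" (structure)
  assumes G: "group G" and finG: "finite (carrier G)"
  shows "finite (irreducible_characters G)"
proof -
  let ?N = "card (carrier G)"
  let ?U = "{z :: complex. z ^ ?N = 1}"
  have N: "?N > 0" using finG monoid.one_closed[OF group.is_monoid[OF G]] by (auto simp: card_gt_0_iff)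
  have U: "finite ?U" by (rule finite_subset[OF _ finite_roots_unity[of ?N]]) (use N in auto)
  let ?T = "sum_list ` {es. set es \<subseteq> ?U \<and> length es \<le> ?N}"
  have T: "finite ?T" using finite_lists_length_le[OF U] by simp
  have "irreducible_characters G \<subseteq> carrier G \<rightarrow>\<^sub>E ?T"
  proof
    fix \<chi> assume "\<chi> \<in> irreducible_characters G"
    then obtain \<rho> d where \<chi>: "\<chi> = character_of G \<rho>" and irr: "irreducible_representation G d \<rho>"
      unfolding irreducible_characters_def by auto
    then have rep: "is_representation G d \<rho>" by (simp add: irreducible_representation_def)
    have "mat_trace (\<rho> g) \<in> ?T" if "g \<in> carrier G" for g
      using representation_trace[OF G finG rep that] irreducible_representation_dim_le[OF G finG rep irr]
      by (auto simp: image_iff)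
    then show "\<chi> \<in> carrier G \<rightarrow>\<^sub>E ?T" unfolding \<chi> character_of_def by (auto simp: PiE_def)
  qed
  then show ?thesis by (rule finite_subset) (intro finite_PiE finG T)
qed

section \<open>Extending the Coxeter generators\<close>

text \<open>The generator \<open>f k\<close> stands for the transposition of k + 1 and k + 2,
  because \<open>sym_group n\<close> acts on {1..n}.\<close>

definition coxeter_relations :: "nat \<Rightarrow> (nat \<Rightarrow> 'a \<Rightarrow> 'a) \<Rightarrow> bool" where
  "coxeter_relations n f \<longleftrightarrow>
     (\<forall>k. Suc k < n \<longrightarrow> f k \<circ> f k = id) \<and>
     (\<forall>k. Suc (Suc k) < n \<longrightarrow> f k \<circ> f (Suc k) \<circ> f k = f (Suc k) \<circ> f k \<circ> f (Suc k)) \<and>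
     (\<forall>k l. Suc k < l \<longrightarrow> Suc l < n \<longrightarrow> f k \<circ> f l = f l \<circ> f k)"

lemma coxeter_relations_commute:
  "coxeter_relations n f \<Longrightarrow> Suc k < l \<Longrightarrow> Suc l < n \<Longrightarrow> f k \<circ> f l = f l \<circ> f k"
  unfolding coxeter_relations_def by blast

lemma coxeter_relations_mono:
  "coxeter_relations n f \<Longrightarrow> m \<le> n \<Longrightarrow> coxeter_relations m f"
  unfolding coxeter_relations_def by (meson less_le_trans)

definition word :: "(nat \<Rightarrow> 'a \<Rightarrow> 'a) \<Rightarrow> nat list \<Rightarrow> 'a \<Rightarrow> 'a" where
  "word f ws = foldr (\<lambda>k g. f k \<circ> g) ws id"

abbreviation adj_transp :: "nat \<Rightarrow> nat \<Rightarrow> nat" where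
  "adj_transp k \<equiv> Transposition.transpose (Suc k) (Suc (Suc k))"

lemma word_simps [simp]: "word f [] = id" "word f (k # ws) = f k \<circ> word f ws"
  by (simp_all add: word_def)

lemma word_append: "word f (us @ vs) = word f us \<circ> word f vs"
  by (induction us) (simp_all add: comp_assoc)

text \<open>The product f (n-1) ... f j. For j = 0, ..., n these represent the cosets of S_n in
  S_(n+1).\<close>

abbreviation desc_word :: "(nat \<Rightarrow> 'a \<Rightarrow> 'a) \<Rightarrow> nat \<Rightarrow> nat \<Rightarrow> 'a \<Rightarrow> 'a" where
  "desc_word f n j \<equiv> word f (rev [j..<n])"

lemma desc_word_step: "j < n \<Longrightarrow> desc_word f n j = desc_word f n (Suc j) \<circ> f j"
  by (simp add: upt_conv_Cons word_append)

lemma desc_word_commute: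
  assumes f: "coxeter_relations (Suc n) f" and "j \<le> n" "Suc k < j"
  shows "desc_word f n j \<circ> f k = f k \<circ> desc_word f n j"
  using assms(2,3)
proof (induction j rule: inc_induct)
  case (step j)
  have fc: "f j \<circ> f k = f k \<circ> f j"
    by (rule coxeter_relations_commute[OF f, symmetric]) (use step.hyps step.prems in auto)
  have IH: "desc_word f n (Suc j) \<circ> f k = f k \<circ> desc_word f n (Suc j)"
    by (rule step.IH) (use step.prems in simp)
  note D = desc_word_step[OF step.hyps(2), of f]
  have "desc_word f n j \<circ> f k = desc_word f n (Suc j) \<circ> (f j \<circ> f k)"
    unfolding D by (simp only: comp_assoc)
  also have "\<dots> = (desc_word f n (Suc j) \<circ> f k) \<circ> f j" unfolding fc by (simp only: comp_assoc)
  also have "\<dots> = f k \<circ> desc_word f n j" unfolding IH D by (simp only: comp_assoc)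
  finally show ?case .
qed simp

text \<open>Coming from the right, \<open>f k\<close> commutes with all factors up to its neighbour
  \<open>f (k - 1)\<close>; there the braid relation lowers its index by one, and the result
  commutes with the factors that remain on the left.\<close>

lemma desc_word_braid:
  assumes f: "coxeter_relations (Suc n) f" and kn: "k < n" and "j < k"
  shows "desc_word f n j \<circ> f k = f (k - 1) \<circ> desc_word f n j"
proof -
  obtain k' where k: "k = Suc k'" using assms by (cases k) auto
  have "j \<le> k'" using assms k by simp
  then have "desc_word f n j \<circ> f (Suc k') = f k' \<circ> desc_word f n j"
  proof (induction j rule: inc_induct)
    case base
    have D: "desc_word f n k' = desc_word f n (Suc (Suc k')) \<circ> f (Suc k') \<circ> f k'"
      using kn k by (simp add: desc_word_step)
    have br: "f (Suc k') \<circ> f k' \<circ> f (Suc k') = f k' \<circ> f (Suc k') \<circ> f k'"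
      using f kn k unfolding coxeter_relations_def by auto
    have cm: "desc_word f n (Suc (Suc k')) \<circ> f k' = f k' \<circ> desc_word f n (Suc (Suc k'))"
      using f kn k by (intro desc_word_commute) auto
    have "desc_word f n k' \<circ> f (Suc k') = desc_word f n (Suc (Suc k')) \<circ> (f (Suc k') \<circ> f k' \<circ> f (Suc k'))"
      unfolding D by (simp only: comp_assoc)
    also have "\<dots> = (desc_word f n (Suc (Suc k')) \<circ> f k') \<circ> f (Suc k') \<circ> f k'"
      unfolding br by (simp only: comp_assoc)
    also have "\<dots> = f k' \<circ> desc_word f n k'" unfolding D cm by (simp only: comp_assoc)
    finally show ?case .
  next
    case (step j)
    have fc: "f j \<circ> f (Suc k') = f (Suc k') \<circ> f j"
      by (rule coxeter_relations_commute[OF f]) (use step.hyps kn k in auto)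
    have jn: "j < n" using step.hyps kn k by simp
    have "desc_word f n j \<circ> f (Suc k') = desc_word f n (Suc j) \<circ> (f j \<circ> f (Suc k'))"
      unfolding desc_word_step[OF jn] by (simp only: comp_assoc)
    also have "\<dots> = (desc_word f n (Suc j) \<circ> f (Suc k')) \<circ> f j"
      unfolding fc by (simp only: comp_assoc)
    also have "\<dots> = f k' \<circ> desc_word f n j"
      unfolding step.IH desc_word_step[OF jn] by (simp only: comp_assoc)
    finally show ?case .
  qed
  then show ?thesis using k by simp
qed

text \<open>A generator appended on the right either passes through \<open>desc_word\<close> into
  the smaller group or changes \<open>j\<close> by one.\<close>

lemma coxeter_normal_form:
  assumes f: "coxeter_relations (Suc n) f" and "set ws \<subseteq> {..<n}"
  shows "\<exists>us j. set us \<subseteq> {k. Suc k < n} \<and> j \<le> n \<and> word f ws = word f us \<circ> desc_word f n j"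
  using assms(2)
proof (induction ws rule: rev_induct)
  case Nil
  show ?case by (intro exI[of _ "[]"] exI[of _ n]) simp
next
  case (snoc k ws)
  have "set ws \<subseteq> {..<n}" using snoc.prems by simp
  from snoc.IH[OF this] obtain us j
    where uj: "set us \<subseteq> {k. Suc k < n}" "j \<le> n" "word f ws = word f us \<circ> desc_word f n j"
    by blast
  have k: "k < n" using snoc by simp
  have ff: "f k \<circ> f k = id" using f k unfolding coxeter_relations_def by auto
  have w: "word f (ws @ [k]) = word f us \<circ> (desc_word f n j \<circ> f k)"
    using uj by (simp add: word_append comp_assoc)
  consider "Suc k < j" | "Suc k = j" | "k = j" | "j < k" by linarith
  then show ?case
  proof cases
    case 1
    have "word f (ws @ [k]) = word f (us @ [k]) \<circ> desc_word f n j"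
      unfolding w desc_word_commute[OF f uj(2) 1] by (simp add: word_append comp_assoc)
    then show ?thesis using uj 1 by (intro exI[of _ "us @ [k]"] exI[of _ j]) auto
  next
    case 2
    then have "word f (ws @ [k]) = word f us \<circ> desc_word f n k"
      unfolding w desc_word_step[OF k] by simp
    then show ?thesis using uj k by (intro exI[of _ us] exI[of _ k]) auto
  next
    case 3
    have "desc_word f n j \<circ> f k = desc_word f n (Suc k) \<circ> (f k \<circ> f k)"
      using 3 desc_word_step[OF k, of f] by (simp only: comp_assoc)
    then have "word f (ws @ [k]) = word f us \<circ> desc_word f n (Suc k)"
      unfolding w ff by simp
    then show ?thesis using uj k by (intro exI[of _ us] exI[of _ "Suc k"]) auto
  next
    case 4
    have "word f (ws @ [k]) = word f (us @ [k - 1]) \<circ> desc_word f n j"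
      unfolding w desc_word_braid[OF f k 4] by (simp add: word_append comp_assoc)
    then show ?thesis using uj 4 k by (intro exI[of _ "us @ [k - 1]"] exI[of _ j]) auto
  qed
qed

lemma adj_transp_coxeter: "coxeter_relations n adj_transp"
  unfolding coxeter_relations_def
  by (auto simp: fun_eq_iff Transposition.transpose_def)

lemma coxeter_relations_map_prod:
  assumes "coxeter_relations n f" "coxeter_relations n g"
  shows "coxeter_relations n (\<lambda>k. map_prod (f k) (g k))"
  using assms unfolding coxeter_relations_def
  by (auto simp: map_prod.comp map_prod.id intro!: arg_cong2[where f = map_prod])

lemma word_map_prod: "word (\<lambda>k. map_prod (f k) (g k)) ws = map_prod (word f ws) (word g ws)"
  by (induction ws) (simp_all only: word_simps map_prod.comp map_prod.id)

lemma map_prod_eqD: "map_prod f g = map_prod f' g' \<Longrightarrow> f = f' \<and> g = g'"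
proof -
  assume "map_prod f g = map_prod f' g'"
  then have "map_prod f g (x, y) = map_prod f' g' (x, y)" for x y by simp
  then have "f x = f' x \<and> g y = g' y" for x y by simp
  then show ?thesis by (simp add: fun_eq_iff)
qed

lemma desc_word_adj_transp: "j \<le> n \<Longrightarrow> desc_word adj_transp n j (Suc j) = Suc n"
proof (induction j rule: inc_induct)
  case (step j)
  then show ?case by (simp add: desc_word_step)
qed simp

lemma word_adj_transp_fixes:
  "set ws \<subseteq> {k. Suc k < n} \<Longrightarrow> x > n \<Longrightarrow> word adj_transp ws x = x"
  by (induction ws) (auto simp: transpose_apply_other)

text \<open>Pairing an arbitrary family with the transpositions themselves keeps the Coxeter relations, so
  both components are brought to normal form by the same words.\<close>

lemma word_relator:
  assumes f: "coxeter_relations n f" and "set ws \<subseteq> {k. Suc k < n}" and "word adj_transp ws = id"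
  shows "word f ws = id"
  using assms
proof (induction n arbitrary: ws)
  case (Suc n)
  let ?g = "\<lambda>k. map_prod (f k) (adj_transp k)"
  have "coxeter_relations (Suc n) ?g" using Suc adj_transp_coxeter by (intro coxeter_relations_map_prod)
  then obtain us j where uj: "set us \<subseteq> {k. Suc k < n}" "j \<le> n" 
     and w: "word ?g ws = word ?g us \<circ> desc_word ?g n j"
    using coxeter_normal_form[of n ?g ws] Suc by auto
  have w2: "word f ws = word f us \<circ> desc_word f n j" "word adj_transp ws = word adj_transp us \<circ> desc_word adj_transp n j"
    using map_prod_eqD[OF w[unfolded word_map_prod map_prod.comp]] by auto
  \<comment> \<open>The coset can be read off the permutation: \<open>us\<close> fixes n + 1 and
    \<open>desc_word\<close> sends j + 1 there, so the identity forces j = n.\<close>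
  have "word adj_transp ws (Suc j) = Suc n"
    unfolding w2 using uj by (simp add: desc_word_adj_transp word_adj_transp_fixes)
  then have "j = n" using Suc by simp
  then have "word f ws = word f us" "word adj_transp us = word adj_transp ws" using w2 by simp_all
  then have "word f ws = word f us" "word adj_transp us = id" using Suc.prems(3) by (simp_all only:)
  moreover have "coxeter_relations n f" using coxeter_relations_mono[OF Suc(2)] by simp
  ultimately show ?case using Suc.IH uj by simp
qed simp

lemma word_rev:
  assumes f: "coxeter_relations n f" and "set ws \<subseteq> {k. Suc k < n}"
  shows "word f ws \<circ> word f (rev ws) = id"
  using assms(2)
proof (induction ws)
  case (Cons k ws)
  have ff: "f k \<circ> f k = id" using f Cons unfolding coxeter_relations_def by auto
  have IH: "word f ws \<circ> word f (rev ws) = id" by (rule Cons.IH) (use Cons.prems in simp)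
  have "word f (rev (k # ws)) = word f (rev ws) \<circ> f k" by (simp add: word_append)
  then have "word f (k # ws) \<circ> word f (rev (k # ws)) = f k \<circ> (word f ws \<circ> word f (rev ws)) \<circ> f k"
    by (simp only: word_simps comp_assoc)
  then show ?case unfolding IH by (simp only: ff comp_id)
qed simp

text \<open>The reversed word is the inverse, so two words for the same permutation combine to a
  relator.\<close>

lemma word_cong_adj_transp:
  assumes f: "coxeter_relations n f" and ws: "set ws \<subseteq> {k. Suc k < n}" and vs: "set vs \<subseteq> {k. Suc k < n}"
    and eq: "word adj_transp ws = word adj_transp vs"
  shows "word f ws = word f vs"
proof -
  have "word adj_transp (rev vs @ ws) = word adj_transp (rev vs) \<circ> word adj_transp (rev (rev vs))"
    by (simp add: word_append eq)
  also have "\<dots> = id" using vs by (intro word_rev[OF adj_transp_coxeter]) auto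
  finally have "word adj_transp (rev vs @ ws) = id" .
  moreover have "set (rev vs @ ws) \<subseteq> {k. Suc k < n}" using ws vs by simp
  ultimately have "word f (rev vs @ ws) = id" using word_relator[OF f] by blast
  then have "word f vs \<circ> (word f (rev vs) \<circ> word f ws) = word f vs" by (simp add: word_append)
  then have "(word f vs \<circ> word f (rev vs)) \<circ> word f ws = word f vs" by (simp only: comp_assoc)
  then show ?thesis unfolding word_rev[OF f vs] by simp
qed

lemma permutes_eq_word:
  assumes "\<pi> permutes {1..n}"
  shows "\<exists>ws. set ws \<subseteq> {k. Suc k < n} \<and> word adj_transp ws = \<pi>"
  using assms
proof (induction n arbitrary: \<pi>)
  case 0
  then show ?case by (intro exI[of _ "[]"]) auto
next
  case (Suc n)
  obtain i where i: "\<pi> i = Suc n" using permutes_surj[OF Suc(2)] by (metis surjD)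
  then have "i \<in> {1..Suc n}" using permutes_in_image[OF Suc(2), of i] by auto
  then obtain j where j: "i = Suc j" "j \<le> n" by (cases i) auto
  have pj: "\<pi> (Suc j) = Suc n" using i j by simp
  let ?vs = "rev [j..<n]"
  have vs: "set ?vs \<subseteq> {k. Suc k < Suc n}" by auto
  have cancel: "word adj_transp (rev ?vs) \<circ> word adj_transp ?vs = id"
    using word_rev[OF adj_transp_coxeter, of "rev ?vs" "Suc n"] vs by (simp only: rev_rev_ident set_rev)
  define \<sigma> where "\<sigma> = \<pi> \<circ> word adj_transp (rev ?vs)"
  have wp: "word adj_transp ws permutes {1..Suc n}" if "set ws \<subseteq> {k. Suc k < Suc n}" for ws
    using that by (induction ws) (auto intro!: permutes_compose permutes_swap_id permutes_id)
  have "\<sigma> permutes {1..Suc n}" unfolding \<sigma>_def by (intro permutes_compose[OF wp Suc(2)]) (use vs in auto)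
  moreover have "\<sigma> (Suc n) = Suc n"
  proof -
    have "(word adj_transp (rev ?vs) \<circ> desc_word adj_transp n j) (Suc j) = Suc j"
      unfolding cancel by simp
    then have "word adj_transp (rev ?vs) (Suc n) = Suc j"
      using desc_word_adj_transp[OF j(2)] by (simp only: comp_apply)
    then show ?thesis unfolding \<sigma>_def using pj by (simp only: comp_apply)
  qed
  moreover have "x = Suc n" if "x \<in> {1..Suc n} - {1..n}" for x using that by auto
  ultimately have "\<sigma> permutes {1..n}" using permutes_superset by blast
  then obtain ws where ws: "set ws \<subseteq> {k. Suc k < n}" "word adj_transp ws = \<sigma>" using Suc.IH by blast
  have "word adj_transp (ws @ ?vs) = \<pi> \<circ> (word adj_transp (rev ?vs) \<circ> word adj_transp ?vs)"
    unfolding word_append ws(2) \<sigma>_def by (simp only: comp_assoc)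
  then have "word adj_transp (ws @ ?vs) = \<pi>" unfolding cancel by simp
  then show ?case using ws vs by (intro exI[of _ "ws @ ?vs"]) auto
qed

text \<open>The last property is recorded because linearity and invariance of supports are proved
  for the generators and reach \<open>R\<close> through words.\<close>

theorem coxeter_extension:
  assumes f: "coxeter_relations n f"
  obtains R where "R id = id"
    "\<And>\<pi> \<sigma>. \<pi> permutes {1..n} \<Longrightarrow> \<sigma> permutes {1..n} \<Longrightarrow> R (\<pi> \<circ> \<sigma>) = R \<pi> \<circ> R \<sigma>"
    "\<And>k. Suc k < n \<Longrightarrow> R (adj_transp k) = f k"
    "\<And>\<pi>. \<pi> permutes {1..n} \<Longrightarrow> \<exists>ws. set ws \<subseteq> {k. Suc k < n} \<and> R \<pi> = word f ws"
proof -
  define W where "W \<pi> = (SOME ws. set ws \<subseteq> {k. Suc k < n} \<and> word adj_transp ws = \<pi>)" for \<pi>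
  have W: "set (W \<pi>) \<subseteq> {k. Suc k < n}" "word adj_transp (W \<pi>) = \<pi>" if "\<pi> permutes {1..n}" for \<pi>
    using someI_ex[OF permutes_eq_word[OF that]] unfolding W_def by auto
  define R where "R \<pi> = word f (W \<pi>)" for \<pi>
  have R: "R \<pi> = word f ws" if "set ws \<subseteq> {k. Suc k < n}" "word adj_transp ws = \<pi>" "\<pi> permutes {1..n}" for \<pi> ws
    unfolding R_def using W[OF that(3)] that by (intro word_cong_adj_transp[OF f]) auto
  show ?thesis
  proof (rule that[of R])
    show "R id = id" using R[of "[]" id] permutes_id by simp
    show "R (\<pi> \<circ> \<sigma>) = R \<pi> \<circ> R \<sigma>" if "\<pi> permutes {1..n}" "\<sigma> permutes {1..n}" for \<pi> \<sigma>
    proof -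
      have "R (\<pi> \<circ> \<sigma>) = word f (W \<pi> @ W \<sigma>)"
        using that W by (intro R permutes_compose) (auto simp: word_append)
      then show ?thesis by (simp add: word_append R_def)
    qed
    show "R (adj_transp k) = f k" if "Suc k < n" for k
      using R[of "[k]" "adj_transp k"] that by (simp add: permutes_swap_id)
    show "\<exists>ws. set ws \<subseteq> {k. Suc k < n} \<and> R \<pi> = word f ws" if "\<pi> permutes {1..n}" for \<pi>
      using W[OF that] unfolding R_def by blast
  qed
qed

section \<open>Young's orthogonal form\<close>

text \<open>\<open>c j\<close> is the content of the box with entry j + 1, so on tableaux this
  exchanges the entries j + 1 and j + 2.\<close>

definition swap_at :: "nat \<Rightarrow> (nat \<Rightarrow> int) \<Rightarrow> nat \<Rightarrow> int" where
  "swap_at j c = c(j := c (Suc j), Suc j := c j)"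

definition axial_dist :: "nat \<Rightarrow> (nat \<Rightarrow> int) \<Rightarrow> int" where
  "axial_dist j c = c (Suc j) - c j"

definition off_diag :: "int \<Rightarrow> complex" where
  "off_diag d = complex_of_real (sqrt (1 - (1 / real_of_int d)\<^sup>2))"

text \<open>Young's orthogonal form. The coefficient off_diag vanishes exactly when the swapped sequence is not
  the content sequence of a standard tableau, so no case distinction is needed.\<close>

definition young_raw :: "nat \<Rightarrow> ((nat \<Rightarrow> int) \<Rightarrow> complex) \<Rightarrow> (nat \<Rightarrow> int) \<Rightarrow> complex" where
  "young_raw j F c = F c / of_int (axial_dist j c) + off_diag (axial_dist j c) * F (swap_at j c)"

text \<open>Acting as the identity off the paths makes the Coxeter relations equations between
  operators on all functions, as \<open>coxeter_extension\<close> requires.\<close>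

definition young :: "nat \<Rightarrow> nat \<Rightarrow> nat \<Rightarrow> ((nat \<Rightarrow> int) \<Rightarrow> complex) \<Rightarrow> (nat \<Rightarrow> int) \<Rightarrow> complex" where
  "young k n j F c = (if c \<in> paths k n then young_raw j F c else F c)"

lemma swap_at_apply [simp]:
  "swap_at j c j = c (Suc j)" "swap_at j c (Suc j) = c j" "i \<noteq> j \<Longrightarrow> i \<noteq> Suc j \<Longrightarrow> swap_at j c i = c i"
  by (auto simp: swap_at_def)

lemma swap_at_swap_at [simp]: "swap_at j (swap_at j c) = c"
  by (auto simp: swap_at_def fun_eq_iff)

lemma axial_dist_swap_at [simp]: "axial_dist j (swap_at j c) = - axial_dist j c"
  by (simp add: axial_dist_def)

lemma off_diag_uminus [simp]: "off_diag (- d) = off_diag d"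
  by (simp add: off_diag_def)

lemma off_diag_1 [simp]: "off_diag 1 = 0"
  by (simp add: off_diag_def)

lemma off_diag_square: "off_diag d * off_diag d = 1 - (1 / of_int d)\<^sup>2"
proof -
  have "(1 / real_of_int d)\<^sup>2 \<le> 1"
  proof (cases "d = 0")
    case False
    then have "1 \<le> d\<^sup>2" by (metis int_one_le_iff_zero_less zero_less_power2)
    then have "1 \<le> (real_of_int d)\<^sup>2" by (metis of_int_1_le_iff of_int_power)
    then show ?thesis using False by (simp add: power_divide divide_le_eq)
  qed simp
  then have "sqrt (1 - (1 / real_of_int d)\<^sup>2) * sqrt (1 - (1 / real_of_int d)\<^sup>2) = 1 - (1 / real_of_int d)\<^sup>2"
    by simp
  then have "off_diag d * off_diag d = complex_of_real (1 - (1 / real_of_int d)\<^sup>2)"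
    unfolding off_diag_def of_real_mult[symmetric] by simp
  then show ?thesis by simp
qed

text \<open>On the pair c, \<open>swap_at j c\<close> the operator is a symmetric matrix with
  diagonal 1/d, -1/d and off-diagonal entry the root of 1 - 1/d^2. The case d = 0 is covered because
  1/0 = 0.\<close>

lemma young_raw_involution: "young_raw j (young_raw j F) c = F c"
proof -
  let ?x = "1 / of_int (axial_dist j c) :: complex" and ?r = "off_diag (axial_dist j c)"
  have "young_raw j (young_raw j F) c = (F c * ?x + ?r * F (swap_at j c)) * ?x + ?r * (- F (swap_at j c) * ?x + ?r * F c)"
    by (simp add: young_raw_def)
  also have "\<dots> = F c * (?x\<^sup>2 + ?r * ?r)" by (simp add: algebra_simps power2_eq_square)
  finally show ?thesis by (simp add: off_diag_square)
qed

lemma young_raw_commute: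
  assumes "Suc i < j"
  shows "young_raw i (young_raw j F) c = young_raw j (young_raw i F) c"
proof -
  have "swap_at i (swap_at j c) = swap_at j (swap_at i c)" using assms by (auto simp: swap_at_def fun_eq_iff)
  moreover have "axial_dist i (swap_at j c) = axial_dist i c" "axial_dist j (swap_at i c) = axial_dist j c"
    using assms by (auto simp: axial_dist_def)
  ultimately show ?thesis by (simp add: young_raw_def algebra_simps add_divide_distrib)
qed

text \<open>With d and e the two axial distances, all coefficients agree by the single relation
  \<open>rel\<close> between 1/d, 1/e and 1/(d + e). The three contents being distinct keeps the
  denominators non-zero.\<close>

lemma young_raw_braid:
  assumes "c j \<noteq> c (Suc j)" "c (Suc j) \<noteq> c (Suc (Suc j))" "c j \<noteq> c (Suc (Suc j))"
  shows "young_raw j (young_raw (Suc j) (young_raw j F)) c = young_raw (Suc j) (young_raw j (young_raw (Suc j) F)) c"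
proof -
  let ?s = "swap_at j" and ?t = "swap_at (Suc j)"
  define d e where "d = axial_dist j c" and "e = axial_dist (Suc j) c"
  have sts: "?t (?s (?t c)) = ?s (?t (?s c))" by (auto simp: swap_at_def fun_eq_iff)
  have ax: "axial_dist j c = d" "axial_dist (Suc j) c = e"
    "axial_dist j (?s c) = - d" "axial_dist (Suc j) (?s c) = d + e"
    "axial_dist j (?t c) = d + e" "axial_dist (Suc j) (?t c) = - e"
    "axial_dist j (?t (?s c)) = e" "axial_dist (Suc j) (?t (?s c)) = - (d + e)"
    "axial_dist j (?s (?t c)) = - (d + e)" "axial_dist (Suc j) (?s (?t c)) = d"
    unfolding d_def e_def axial_dist_def by auto
  define \<alpha> \<beta> \<gamma> :: complex where "\<alpha> = 1 / of_int d" and "\<beta> = 1 / of_int e" and "\<gamma> = 1 / of_int (d + e)"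
  have nz: "d \<noteq> 0" "e \<noteq> 0" "d + e \<noteq> 0" using assms by (auto simp: d_def e_def axial_dist_def)
  have nz': "(of_int d :: complex) \<noteq> 0" "(of_int e :: complex) \<noteq> 0" "(of_int d + of_int e :: complex) \<noteq> 0"
    using nz by (auto simp flip: of_int_add)
  have rel: "\<alpha> * \<beta> = \<gamma> * (\<alpha> + \<beta>)"
    unfolding \<alpha>_def \<beta>_def \<gamma>_def using nz' by (simp add: field_simps)
  define p q r where "p = off_diag d" and "q = off_diag e" and "r = off_diag (d + e)"
  have pp: "p * p = 1 - \<alpha> * \<alpha>" and qq: "q * q = 1 - \<beta> * \<beta>"
    unfolding p_def q_def \<alpha>_def \<beta>_def by (simp_all add: off_diag_square power2_eq_square)
  have dv: "x / of_int d = x * \<alpha>" "x / of_int e = x * \<beta>" "x / of_int (d + e) = x * \<gamma>"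
     "x / of_int (- d) = - x * \<alpha>" "x / of_int (- e) = - x * \<beta>" "x / of_int (- (d + e)) = - x * \<gamma>" for x :: complex
  proof -
    have gen: "x / of_int y = x * (1 / of_int y)" "x / of_int (- y) = - x * (1 / of_int y)" for y
      by simp_all
    show "x / of_int d = x * \<alpha>" "x / of_int e = x * \<beta>" "x / of_int (d + e) = x * \<gamma>"
     "x / of_int (- d) = - x * \<alpha>" "x / of_int (- e) = - x * \<beta>" "x / of_int (- (d + e)) = - x * \<gamma>"
      unfolding \<alpha>_def \<beta>_def \<gamma>_def by (rule gen)+
  qed
  have L: "young_raw j (young_raw (Suc j) (young_raw j F)) c =
     (\<alpha> * \<alpha> * \<beta> + p * p * \<gamma>) * F c + p * (\<alpha> * \<beta> - \<alpha> * \<gamma>) * F (?s c) + \<alpha> * q * \<gamma> * F (?t c)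
      + \<alpha> * q * r * F (?s (?t c)) + p * r * \<beta> * F (?t (?s c)) + p * q * r * F (?s (?t (?s c)))"
    unfolding young_raw_def ax off_diag_uminus swap_at_swap_at p_def[symmetric] q_def[symmetric] r_def[symmetric] dv
    by (simp add: algebra_simps)
  have R: "young_raw (Suc j) (young_raw j (young_raw (Suc j) F)) c =
     (\<beta> * \<beta> * \<alpha> + q * q * \<gamma>) * F c + q * (\<alpha> * \<beta> - \<beta> * \<gamma>) * F (?t c) + \<beta> * p * \<gamma> * F (?s c)
      + \<beta> * p * r * F (?t (?s c)) + q * r * \<alpha> * F (?s (?t c)) + p * q * r * F (?s (?t (?s c)))"
    unfolding young_raw_def ax off_diag_uminus swap_at_swap_at sts p_def[symmetric] q_def[symmetric] r_def[symmetric] dv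
    by (simp add: algebra_simps)
  have "\<alpha> * \<alpha> * \<beta> + p * p * \<gamma> = \<beta> * \<beta> * \<alpha> + q * q * \<gamma>"
    unfolding pp qq using arg_cong[OF rel, of "\<lambda>x. x * (\<alpha> - \<beta>)"] by (simp add: algebra_simps)
  moreover have "\<alpha> * \<beta> - \<alpha> * \<gamma> = \<beta> * \<gamma>" "\<alpha> * \<beta> - \<beta> * \<gamma> = \<alpha> * \<gamma>"
    using rel by (simp_all add: algebra_simps)
  ultimately show ?thesis unfolding L R by (simp add: algebra_simps)
qed

lemma pathsD:
  assumes "c \<in> paths k n" "j < n"
  shows "c j \<in> state k c j" "c j - 1 \<notin> state k c j"
  using assms by (auto simp: paths_def)

lemma paths_adjacent_neq:
  assumes "c \<in> paths k n" "Suc j < n"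
  shows "c j \<noteq> c (Suc j)"
  using pathsD[OF assms(1), of j] pathsD[OF assms(1), of "Suc j"] assms by auto

text \<open>Between two boxes of content a, boxes of both contents a + 1 and a - 1 have to be added,
  but only one step lies in between.\<close>

lemma paths_triple_neq:
  assumes "c \<in> paths k n" "Suc (Suc j) < n"
  shows "c j \<noteq> c (Suc (Suc j))"
proof
  assume eq: "c j = c (Suc (Suc j))"
  have "c (Suc (Suc j)) \<in> state k c (Suc (Suc j))" "c (Suc (Suc j)) - 1 \<notin> state k c (Suc (Suc j))"
    using pathsD[OF assms(1), of "Suc (Suc j)"] assms by auto
  then have "c j = c (Suc j) - 1" "c j - 1 = c (Suc j)" unfolding state.simps eq[symmetric] by auto
  then show False by simp
qed

text \<open>Two consecutive boxes whose contents differ by at least 2 do not touch and can be added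
  in either order; only the shape in between changes.\<close>

lemma swap_at_paths:
  assumes c: "c \<in> paths k n" and j: "Suc j < n" and d: "\<bar>axial_dist j c\<bar> \<noteq> 1"
  shows "swap_at j c \<in> paths k n" "state k (swap_at j c) n = state k c n"
proof -
  let ?c = "swap_at j c"
  have sj: "state k ?c i = state k c i" if "i \<le> j" for i
    using that by (intro state_cong) auto
  have ne: "c j \<noteq> c (Suc j)" using paths_adjacent_neq[OF c j] .
  have d': "c (Suc j) \<noteq> c j - 1" "c (Suc j) \<noteq> c j + 1" using d unfolding axial_dist_def by auto
  have a: "c j \<in> state k c j" "c j - 1 \<notin> state k c j" using pathsD[OF c] j by auto
  have b: "c (Suc j) \<in> state k c j" "c (Suc j) - 1 \<notin> state k c j"
    using pathsD[OF c, of "Suc j"] j ne d' by auto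
  have s2: "state k ?c (Suc (Suc j)) = state k c (Suc (Suc j))"
    using sj[of j] ne d' by auto
  have s3: "state k ?c (Suc (Suc j) + i) = state k c (Suc (Suc j) + i)" for i
  proof (induction i)
    case 0 then show ?case using s2 by simp
  next
    case (Suc i) then show ?case by simp
  qed
  have s: "state k ?c i = state k c i" if "i \<noteq> Suc j" for i
  proof (cases "i \<le> j")
    case False
    then have "i = Suc (Suc j) + (i - Suc (Suc j))" using that by simp
    then show ?thesis using s3 by metis
  qed (rule sj)
  show "state k ?c n = state k c n" using s j by auto
  have "?c i \<in> state k ?c i \<and> ?c i - 1 \<notin> state k ?c i" if i: "i < n" for i
  proof -
    consider "i = j" | "i = Suc j" | "i \<noteq> j" "i \<noteq> Suc j" by blast
    then show ?thesis
    proof cases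
      case 1 then show ?thesis using sj[of j] b by simp
    next
      case 2 then show ?thesis using sj[of j] a ne d' by auto
    next
      case 3 then show ?thesis using s[of i] pathsD[OF c i] by simp
    qed
  qed
  moreover have "?c i = 0" if "i \<ge> n" for i
    using that j c by (auto simp: paths_def)
  ultimately show "?c \<in> paths k n" by (auto simp: paths_def)
qed

lemma off_diag_swap_paths:
  assumes "c \<in> paths k n" "Suc j < n" "off_diag (axial_dist j c) \<noteq> 0"
  shows "swap_at j c \<in> paths k n" "state k (swap_at j c) n = state k c n"
proof -
  have "axial_dist j c = 1 \<or> axial_dist j c = - 1" if "\<bar>axial_dist j c\<bar> = 1"
    using that by linarith
  moreover have "off_diag (-1) = 0" using off_diag_uminus[of 1] by simp
  ultimately have "\<bar>axial_dist j c\<bar> \<noteq> 1" using assms(3) by auto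
  then show "swap_at j c \<in> paths k n" "state k (swap_at j c) n = state k c n"
    using swap_at_paths assms by auto
qed

lemma young_raw_cong:
  assumes "c \<in> paths k n" "Suc j < n" "\<And>c. c \<in> paths k n \<Longrightarrow> F c = G c"
  shows "young_raw j F c = young_raw j G c"
  using off_diag_swap_paths(1)[OF assms(1,2)] assms(1,3) unfolding young_raw_def by fastforce

lemma young_on_paths: "c \<in> paths k n \<Longrightarrow> young k n j F c = young_raw j F c"
  by (simp add: young_def)

lemma young_off_paths: "c \<notin> paths k n \<Longrightarrow> young k n j F c = F c"
  by (simp add: young_def)

lemma young_coxeter: "coxeter_relations n (young k n)"
  unfolding coxeter_relations_def
proof (intro conjI allI impI ext)
  fix j F c assume j: "Suc j < n"
  show "(young k n j \<circ> young k n j) F c = id F c"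
  proof (cases "c \<in> paths k n")
    case True
    have "young_raw j (young k n j F) c = young_raw j (young_raw j F) c"
      by (rule young_raw_cong[OF True j]) (rule young_on_paths)
    then show ?thesis using True by (simp add: young_on_paths young_raw_involution)
  qed (simp add: young_off_paths)
next
  fix i j F c assume ij: "Suc i < j" and j: "Suc j < n"
  have i: "Suc i < n" using ij j by simp
  show "(young k n i \<circ> young k n j) F c = (young k n j \<circ> young k n i) F c"
  proof (cases "c \<in> paths k n")
    case True
    have "young_raw i (young k n j F) c = young_raw i (young_raw j F) c"
      by (rule young_raw_cong[OF True i]) (rule young_on_paths)
    moreover have "young_raw j (young k n i F) c = young_raw j (young_raw i F) c"
      by (rule young_raw_cong[OF True j]) (rule young_on_paths)
    ultimately show ?thesis using True by (simp add: young_on_paths young_raw_commute[OF ij])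
  qed (simp add: young_off_paths)
next
  fix j F c assume j: "Suc (Suc j) < n"
  have j': "Suc j < n" using j by simp
  show "(young k n j \<circ> young k n (Suc j) \<circ> young k n j) F c = (young k n (Suc j) \<circ> young k n j \<circ> young k n (Suc j)) F c"
  proof (cases "c \<in> paths k n")
    case True
    have three: "young k n a (young k n b (young k n a F)) c = young_raw a (young_raw b (young_raw a F)) c"
      if a: "Suc a < n" and b: "Suc b < n" for a b
    proof -
      have "young k n b (young k n a F) c' = young_raw b (young_raw a F) c'" if c': "c' \<in> paths k n" for c'
        unfolding young_on_paths[OF c'] by (rule young_raw_cong[OF c' b]) (rule young_on_paths)
      then show ?thesis unfolding young_on_paths[OF True] by (intro young_raw_cong[OF True a])
    qed
    show ?thesis using three[OF j' j] three[OF j j'] True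
      young_raw_braid[OF paths_adjacent_neq[OF True j'] paths_adjacent_neq[OF True j] paths_triple_neq[OF True j], of F]
      by simp
  qed (simp add: young_off_paths)
qed

section \<open>Extension to a linear representation of the symmetric group\<close>

definition linear_op :: "(('b \<Rightarrow> complex) \<Rightarrow> 'b \<Rightarrow> complex) \<Rightarrow> bool" where
  "linear_op P \<longleftrightarrow> (\<forall>a F G. P (\<lambda>c. a * F c + G c) = (\<lambda>c. a * P F c + P G c))"

lemma linear_opD: "linear_op P \<Longrightarrow> P (\<lambda>c. a * F c + G c) = (\<lambda>c. a * P F c + P G c)"
  by (simp add: linear_op_def)

lemma linear_op_young: "linear_op (young k n j)"
  unfolding linear_op_def young_def young_raw_def by (auto simp: fun_eq_iff algebra_simps add_divide_distrib)

lemma linear_op_word: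
  assumes "\<And>j. linear_op (f j)"
  shows "linear_op (word f ws)"
  by (induction ws) (use assms in \<open>simp_all add: linear_op_def\<close>)

lemma linear_op_zero: "linear_op P \<Longrightarrow> P (\<lambda>_. 0) = (\<lambda>_. 0)"
proof -
  assume "linear_op P"
  from linear_opD[OF this, of "-1" "\<lambda>_. 0" "\<lambda>_. 0"] show ?thesis by simp
qed

lemma linear_op_sum:
  assumes P: "linear_op P" and "finite I"
  shows "P (\<lambda>c. \<Sum>i\<in>I. a i * F i c) = (\<lambda>c. \<Sum>i\<in>I. a i * P (F i) c)"
  using assms(2)
proof (induction I rule: finite_induct)
  case empty then show ?case using linear_op_zero[OF P] by simp
next
  case (insert i I)
  then have "P (\<lambda>c. \<Sum>i\<in>insert i I. a i * F i c) = P (\<lambda>c. a i * F i c + (\<Sum>i\<in>I. a i * F i c))" by simp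
  also have "\<dots> = (\<lambda>c. a i * P (F i) c + P (\<lambda>c. \<Sum>i\<in>I. a i * F i c) c)"
    by (rule linear_opD[OF P])
  finally show ?case using insert by simp
qed

text \<open>Swaps with a non-zero coefficient keep the final shape, so the functions supported on
  one shape form an invariant subspace.\<close>

lemma young_support:
  assumes F: "\<And>c. c \<notin> paths_to k n X \<Longrightarrow> F c = 0" and j: "Suc j < n" and c: "c \<notin> paths_to k n X"
  shows "young k n j F c = 0"
proof (cases "c \<in> paths k n")
  case True
  have "off_diag (axial_dist j c) * F (swap_at j c) = 0"
  proof (rule ccontr)
    assume "\<not> ?thesis"
    then have "off_diag (axial_dist j c) \<noteq> 0" "swap_at j c \<in> paths_to k n X" using F by auto
    then show False using off_diag_swap_paths[OF True j] True c by (auto simp: paths_to_def)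
  qed
  then show ?thesis using True F[OF c] by (simp add: young_on_paths young_raw_def)
qed (use F[OF c] in \<open>simp add: young_off_paths\<close>)

definition is_young_rep :: "nat \<Rightarrow> nat \<Rightarrow> ((nat \<Rightarrow> nat) \<Rightarrow> ((nat \<Rightarrow> int) \<Rightarrow> complex) \<Rightarrow> (nat \<Rightarrow> int) \<Rightarrow> complex) \<Rightarrow> bool" where
  "is_young_rep k n R \<longleftrightarrow> R id = id \<and>
     (\<forall>\<pi> \<sigma>. \<pi> permutes {1..n} \<longrightarrow> \<sigma> permutes {1..n} \<longrightarrow> R (\<pi> \<circ> \<sigma>) = R \<pi> \<circ> R \<sigma>) \<and>
     (\<forall>j. Suc j < n \<longrightarrow> R (adj_transp j) = young k n j) \<and>
     (\<forall>\<pi>. \<pi> permutes {1..n} \<longrightarrow> (\<exists>ws. set ws \<subseteq> {j. Suc j < n} \<and> R \<pi> = word (young k n) ws))"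

lemma ex_young_rep: "\<exists>R. is_young_rep k n R"
  unfolding is_young_rep_def by (rule coxeter_extension[OF young_coxeter, of n k]) blast

lemma linear_op_young_rep:
  assumes "is_young_rep k n R" "\<pi> permutes {1..n}"
  shows "linear_op (R \<pi>)"
  using assms unfolding is_young_rep_def by (metis linear_op_word linear_op_young)

lemma young_rep_comp:
  "is_young_rep k n R \<Longrightarrow> \<pi> permutes {1..n} \<Longrightarrow> \<sigma> permutes {1..n} \<Longrightarrow> R (\<pi> \<circ> \<sigma>) F = R \<pi> (R \<sigma> F)"
  unfolding is_young_rep_def by simp

lemma young_rep_id: "is_young_rep k n R \<Longrightarrow> R id F = F"
  unfolding is_young_rep_def by simp

lemma young_rep_support:
  assumes R: "is_young_rep k n R" "\<pi> permutes {1..n}"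
    and F: "\<And>c. c \<notin> paths_to k n X \<Longrightarrow> F c = 0" and c: "c \<notin> paths_to k n X"
  shows "R \<pi> F c = 0"
proof -
  obtain ws where ws: "set ws \<subseteq> {j. Suc j < n}" "R \<pi> = word (young k n) ws"
    using R unfolding is_young_rep_def by blast
  have "\<forall>c. c \<notin> paths_to k n X \<longrightarrow> word (young k n) ws F c = 0"
    using ws(1)
  proof (induction ws)
    case (Cons j ws)
    then show ?case by (auto intro!: young_support[where X = X])
  qed (use F in simp)
  then show ?thesis using ws c by simp
qed

section \<open>The group algebra and the Jucys-Murphy elements\<close>

context
  fixes k n :: nat and R :: "(nat \<Rightarrow> nat) \<Rightarrow> ((nat \<Rightarrow> int) \<Rightarrow> complex) \<Rightarrow> (nat \<Rightarrow> int) \<Rightarrow> complex"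
  assumes R: "is_young_rep k n R"
begin

text \<open>The image of the group algebra of S_n under \<open>R\<close>, built one summand at a
  time so that statements linear in the operator follow by induction.\<close>

inductive_set group_alg :: "(((nat \<Rightarrow> int) \<Rightarrow> complex) \<Rightarrow> (nat \<Rightarrow> int) \<Rightarrow> complex) set" where
  zero: "(\<lambda>F c. 0) \<in> group_alg"
| add: "P \<in> group_alg \<Longrightarrow> \<pi> permutes {1..n} \<Longrightarrow> (\<lambda>F c. a * R \<pi> F c + P F c) \<in> group_alg"

lemma group_alg_lincomb:
  assumes "P \<in> group_alg" "Q \<in> group_alg"
  shows "(\<lambda>F c. a * P F c + Q F c) \<in> group_alg"
  using assms
proof (induction rule: group_alg.induct)
  case (add P \<pi> b)
  then have "(\<lambda>F c. (a * b) * R \<pi> F c + (a * P F c + Q F c)) \<in> group_alg" by (intro group_alg.add)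
  then show ?case by (simp add: algebra_simps)
qed simp

lemma group_alg_rep: "\<pi> permutes {1..n} \<Longrightarrow> R \<pi> \<in> group_alg"
  using group_alg.add[OF group_alg.zero, of \<pi> 1] by simp

lemma group_alg_rep_comp:
  assumes "P \<in> group_alg" and \<pi>: "\<pi> permutes {1..n}"
  shows "(\<lambda>F. R \<pi> (P F)) \<in> group_alg"
  using assms(1)
proof (induction rule: group_alg.induct)
  case zero
  then show ?case using linear_op_zero[OF linear_op_young_rep[OF R \<pi>]] group_alg.zero by simp
next
  case (add P \<sigma> a)
  have "(\<lambda>F. R \<pi> (\<lambda>c. a * R \<sigma> F c + P F c)) = (\<lambda>F c. a * R (\<pi> \<circ> \<sigma>) F c + R \<pi> (P F) c)"
    unfolding linear_opD[OF linear_op_young_rep[OF R \<pi>]] young_rep_comp[OF R \<pi> add(2)] ..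
  then show ?case using group_alg.add[OF add(3) permutes_compose[OF add(2) \<pi>]] by simp
qed

lemma group_alg_comp:
  assumes "P \<in> group_alg" "Q \<in> group_alg"
  shows "(\<lambda>F. P (Q F)) \<in> group_alg"
  using assms
proof (induction rule: group_alg.induct)
  case zero
  then show ?case using group_alg.zero by simp
next
  case (add P \<pi> a)
  then show ?case using group_alg_lincomb[OF group_alg_rep_comp[OF add(4,2)] add(3)] by simp
qed

lemma group_alg_young: "Suc j < n \<Longrightarrow> young k n j \<in> group_alg"
proof -
  assume j: "Suc j < n"
  then have "adj_transp j permutes {1..n}" by (intro permutes_swap_id) auto
  then show ?thesis using group_alg_rep[of "adj_transp j"] R j unfolding is_young_rep_def by simp
qed

text \<open>The recursion J_(j+1) = s_j J_j s_j + s_j of the Jucys-Murphy elements, where J_j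
  multiplies by the content \<open>c j\<close>. The off-diagonal terms cancel because the two
  contents differ by the axial distance.\<close>

lemma young_raw_jucys_murphy:
  assumes c: "c \<in> paths k n" "Suc j < n"
  shows "young_raw j (\<lambda>c. of_int (c j) * young_raw j F c) c + young_raw j F c = of_int (c (Suc j)) * F c"
proof -
  define d where "d = axial_dist j c"
  define r where "r = off_diag d"
  define \<alpha> :: complex where "\<alpha> = 1 / of_int d"
  have d: "d \<noteq> 0" using paths_adjacent_neq[OF c] by (auto simp: d_def axial_dist_def)
  have b: "(of_int (c (Suc j)) :: complex) = of_int (c j) + of_int d" by (simp add: d_def axial_dist_def)
  have da: "of_int d * \<alpha> = 1" using d by (simp add: \<alpha>_def)
  have rr: "r * r = 1 - \<alpha> * \<alpha>" unfolding r_def \<alpha>_def off_diag_square by (simp add: power2_eq_square)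
  have dv: "x / of_int d = x * \<alpha>" "x / of_int (- d) = - x * \<alpha>" for x by (simp_all add: \<alpha>_def)
  let ?y = "F (swap_at j c)"
  let ?a = "of_int (c j) :: complex" and ?d = "of_int d :: complex"
  have "young_raw j (\<lambda>c. of_int (c j) * young_raw j F c) c + young_raw j F c
     = ?a * (F c * \<alpha> + r * ?y) * \<alpha> + r * ((?a + ?d) * (- ?y * \<alpha> + r * F c)) + (F c * \<alpha> + r * ?y)"
    unfolding young_raw_def axial_dist_swap_at off_diag_uminus swap_at_swap_at d_def[symmetric] dv r_def[symmetric] swap_at_apply b by simp
  also have "\<dots> = (?a * \<alpha> * \<alpha> + (?a + ?d) * (r * r) + \<alpha>) * F c + r * (1 - ?d * \<alpha>) * ?y"
    by (simp add: algebra_simps)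
  also have "\<dots> = (?a + ?d - (?d * \<alpha>) * \<alpha> + \<alpha>) * F c + r * (1 - ?d * \<alpha>) * ?y"
    unfolding rr by (simp add: algebra_simps)
  also have "\<dots> = of_int (c (Suc j)) * F c" unfolding da b by simp
  finally show ?thesis .
qed

lemma jucys_murphy:
  "j < n \<Longrightarrow> \<exists>P\<in>group_alg. \<forall>F. \<forall>c\<in>paths k n. P F c = of_int (c j) * F c"
proof (induction j)
  case 0
  \<comment> \<open>The first box has content 0, so the first Jucys-Murphy element is represented by
    the zero operator.\<close>
  have "c 0 = 0" if "c \<in> paths k n" for c
    using pathsD[OF that 0] by auto
  then show ?case using group_alg.zero by (intro bexI[of _ "\<lambda>F c. 0"]) auto
next
  case (Suc j)
  then obtain P where P: "P \<in> group_alg" "\<And>F c. c \<in> paths k n \<Longrightarrow> P F c = of_int (c j) * F c"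
    by auto
  let ?Y = "young k n j"
  note Y = group_alg_young[OF Suc.prems]
  have "(\<lambda>F. ?Y (P (?Y F))) \<in> group_alg" by (intro group_alg_comp[OF Y] group_alg_comp[OF P(1) Y])
  from group_alg_lincomb[OF this Y, of 1]
  have mem: "(\<lambda>F c. ?Y (P (?Y F)) c + ?Y F c) \<in> group_alg" by simp
  have "?Y (P (?Y F)) c + ?Y F c = of_int (c (Suc j)) * F c" if c: "c \<in> paths k n" for F c
  proof -
    have "?Y (P (?Y F)) c = young_raw j (\<lambda>c. of_int (c j) * young_raw j F c) c"
      unfolding young_on_paths[OF c]
      by (rule young_raw_cong[OF c Suc.prems]) (simp add: P young_on_paths)
    then show ?thesis using young_raw_jucys_murphy[OF c Suc.prems] by (simp add: young_on_paths[OF c])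
  qed
  then show ?case using mem by (intro bexI[of _ "\<lambda>F c. ?Y (P (?Y F)) c + ?Y F c"]) auto
qed

text \<open>Distinct paths differ in some content, so Lagrange interpolation in the Jucys-Murphy
  operators isolates a single path.\<close>

lemma path_projection:
  assumes c0: "c0 \<in> paths k n"
  shows "\<exists>P\<in>group_alg. \<forall>F. \<forall>c\<in>paths k n. P F c = (if c = c0 then F c else 0)"
proof -
  have "\<exists>P\<in>group_alg. \<exists>\<phi>. (\<forall>F. \<forall>c\<in>paths k n. P F c = \<phi> c * F c) \<and> \<phi> c0 = 1 \<and> (\<forall>c\<in>S. \<phi> c = 0)"
    if "finite S" "S \<subseteq> paths k n - {c0}" for S
    using that
  proof (induction S rule: finite_induct)
    case empty
    show ?case
      using group_alg_rep[OF permutes_id] young_rep_id[OF R] by (intro bexI[of _ "R id"] exI[of _ "\<lambda>_. 1"]) auto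
  next
    case (insert c1 S)
    then obtain P \<phi> where "P \<in> group_alg \<and> (\<forall>F. \<forall>c\<in>paths k n. P F c = \<phi> c * F c) \<and> \<phi> c0 = 1 \<and> (\<forall>c\<in>S. \<phi> c = 0)"
      by auto
    then have P: "P \<in> group_alg" "\<And>F c. c \<in> paths k n \<Longrightarrow> P F c = \<phi> c * F c" "\<phi> c0 = 1" "\<And>c. c \<in> S \<Longrightarrow> \<phi> c = 0"
      by auto
    have c1: "c1 \<in> paths k n" "c1 \<noteq> c0" using insert by auto
    then obtain j where j: "c1 j \<noteq> c0 j" by (auto simp: fun_eq_iff)
    have "j < n"
    proof (rule ccontr)
      assume "\<not> j < n"
      then have "c1 j = 0" "c0 j = 0" using c0 c1 by (auto simp: paths_def)
      then show False using j by simp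
    qed
    then obtain Q where Q: "Q \<in> group_alg" "\<And>F c. c \<in> paths k n \<Longrightarrow> Q F c = of_int (c j) * F c"
      using jucys_murphy by blast
    define b :: complex where "b = 1 / (of_int (c0 j) - of_int (c1 j))"
    have bne: "(of_int (c0 j) :: complex) - of_int (c1 j) \<noteq> 0" using j by (simp flip: of_int_diff)
    \<comment> \<open>Another Lagrange factor, equal to 1 at \<open>c0\<close> and 0 at
      \<open>c1\<close>.\<close>
    define \<psi> where "\<psi> c = \<phi> c * (b * (of_int (c j) - of_int (c1 j)))" for c :: "nat \<Rightarrow> int"
    let ?P = "\<lambda>F c. b * Q (P F) c + (- b * of_int (c1 j) * P F c + 0)"
    have "(\<lambda>F c. - b * of_int (c1 j) * P F c + 0) \<in> group_alg"
      by (rule group_alg_lincomb[OF P(1) group_alg.zero])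
    then have mem: "?P \<in> group_alg"
      by (intro group_alg_lincomb[OF group_alg_comp[OF Q(1) P(1)]])
    have "?P F c = \<psi> c * F c" if "c \<in> paths k n" for F c
      using that by (simp add: P Q \<psi>_def algebra_simps)
    moreover have "\<psi> c0 = 1" using bne P by (simp add: \<psi>_def b_def)
    moreover have "\<forall>c\<in>insert c1 S. \<psi> c = 0" using P by (auto simp: \<psi>_def)
    ultimately show ?case using mem by (intro bexI[of _ ?P] exI[of _ \<psi>]) auto
  qed
  from this[of "paths k n - {c0}"] finite_paths obtain P \<phi> where
    "P \<in> group_alg \<and> (\<forall>F. \<forall>c\<in>paths k n. P F c = \<phi> c * F c) \<and> \<phi> c0 = 1 \<and> (\<forall>c\<in>paths k n - {c0}. \<phi> c = 0)"
    by blast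
  then show ?thesis by (intro bexI[of _ P]) auto
qed

end

section \<open>Connectedness of the tableaux of one shape\<close>

lemma paths_to_SucI:
  assumes "c \<in> paths_to k n (unmove a X)" "a - 1 \<in> X" "a \<notin> X" "a < int k"
  shows "c(n := a) \<in> paths_to k (Suc n) X"
  using assms unfolding paths_to_Suc by blast

lemma paths_to_SucD:
  assumes "c \<in> paths_to k (Suc n) X"
  shows "c(n := 0) \<in> paths_to k n (unmove (c n) X)" "c n - 1 \<in> X" "c n \<notin> X" "c n < int k"
proof -
  obtain a c' where a: "a - 1 \<in> X" "a \<notin> X" "a < int k" and c': "c' \<in> paths_to k n (unmove a X)" and c: "c = c'(n := a)"
    using assms unfolding paths_to_Suc by auto
  have "c'(n := 0) = c'" using c' by (auto simp: paths_to_def paths_def)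
  then show "c(n := 0) \<in> paths_to k n (unmove (c n) X)" "c n - 1 \<in> X" "c n \<notin> X" "c n < int k"
    using a c' c by simp_all
qed

text \<open>The contents of two removable boxes differ by at least two, so the last two steps of a suitable path
  can be exchanged; this connects tableaux with different last boxes.\<close>

lemma path_with_last:
  assumes "c \<in> paths_to k (Suc n) X" "b - 1 \<in> X" "b \<notin> X" "b < int k"
  shows "\<exists>w\<in>paths_to k (Suc n) X. w n = b"
    and "b \<noteq> c n \<Longrightarrow> \<exists>m w. n = Suc m \<and> w \<in> paths_to k (Suc n) X \<and> w n = c n \<and>
       swap_at m w \<in> paths_to k (Suc n) X \<and> swap_at m w n = b"
  using assms
proof (atomize (full), induction n arbitrary: c X)
  case 0
  have "c 0 - 1 \<in> X" "c 0 \<notin> X" "state k (c(0 := 0)) 0 = unmove (c 0) X"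
    using paths_to_SucD[OF 0(1)] by (auto simp: paths_to_def)
  then have X: "unmove (c 0) X = {0..<int k}" by simp
  have "c 0 \<in> {0..<int k}" "c 0 - 1 \<notin> {0..<int k}" unfolding X[symmetric] by auto
  then have "c 0 = 0" by auto
  have "b = c 0"
  proof (rule ccontr)
    assume "b \<noteq> c 0"
    then have "b - 1 \<in> unmove (c 0) X" "b \<notin> unmove (c 0) X" using 0 by auto
    then show False unfolding X using 0 by auto
  qed
  then show ?case using 0 by auto
next
  case (Suc n)
  define a where "a = c (Suc n)"
  have a: "c(Suc n := 0) \<in> paths_to k (Suc n) (unmove a X)" "a - 1 \<in> X" "a \<notin> X" "a < int k"
    using paths_to_SucD[OF Suc.prems(1)] by (auto simp: a_def)
  show ?case
  proof (cases "b = a")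
    case True
    then show ?thesis using Suc.prems a_def by auto
  next
    case False
    have "b - 1 \<in> unmove a X" "b \<notin> unmove a X" using Suc.prems False by auto
    \<comment> \<open>After removal of the last box \<open>a\<close>, the induction hypothesis
      provides a tableau that ends with \<open>b\<close>; adding \<open>a\<close> again leaves
      \<open>b\<close> in the next-to-last place.\<close>
    then obtain u where u: "u \<in> paths_to k (Suc n) (unmove a X)" "u n = b"
      using Suc.IH[OF a(1)] Suc.prems(4) by blast
    define w where "w = u(Suc n := a)"
    have w: "w \<in> paths_to k (Suc (Suc n)) X" "w (Suc n) = a" "w n = b"
      unfolding w_def using u a by (auto intro!: paths_to_SucI)
    have "b \<noteq> a + 1" "b \<noteq> a - 1" using a Suc.prems by auto
    then have "\<bar>axial_dist n w\<bar> \<noteq> 1" using w by (auto simp: axial_dist_def)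
    then have sw: "swap_at n w \<in> paths_to k (Suc (Suc n)) X"
      using swap_at_paths[of w k "Suc (Suc n)" n] w by (auto simp: paths_to_def)
    have "swap_at n w (Suc n) = b" using w by simp
    then show ?thesis using w sw a_def by blast
  qed
qed

definition swap_rel :: "nat \<Rightarrow> nat \<Rightarrow> int set \<Rightarrow> ((nat \<Rightarrow> int) \<times> (nat \<Rightarrow> int)) set" where
  "swap_rel k n X = {(c, swap_at j c) | c j. Suc j < n \<and> c \<in> paths_to k n X \<and> swap_at j c \<in> paths_to k n X}"

lemma swap_rel_upd:
  assumes "(c, c') \<in> swap_rel k n (unmove a X)" "a - 1 \<in> X" "a \<notin> X" "a < int k"
  shows "(c(n := a), c'(n := a)) \<in> swap_rel k (Suc n) X"
proof -
  obtain j where j: "Suc j < n" "c \<in> paths_to k n (unmove a X)" "c' = swap_at j c" "swap_at j c \<in> paths_to k n (unmove a X)"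
    using assms unfolding swap_rel_def by auto
  have "c'(n := a) = swap_at j (c(n := a))" using j by (auto simp: swap_at_def fun_eq_iff)
  moreover have "c(n := a) \<in> paths_to k (Suc n) X" "c'(n := a) \<in> paths_to k (Suc n) X"
    using j assms by (auto intro!: paths_to_SucI)
  ultimately show ?thesis unfolding swap_rel_def using j by auto
qed

text \<open>Tableaux with the same last box are joined by induction, others through one exchange of
  the last two steps. Irreducibility rests on this: a basis vector can be carried to every other
  one.\<close>

lemma paths_to_connected:
  assumes "c \<in> paths_to k n X" "c' \<in> paths_to k n X"
  shows "(c, c') \<in> (swap_rel k n X)\<^sup>*"
  using assms
proof (induction n arbitrary: c c' X)
  case 0
  then have "c = c'" by (auto simp: paths_to_def paths_def)
  then show ?case by simp
next
  case (Suc n)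
  have same: "(c, c') \<in> (swap_rel k (Suc n) X)\<^sup>*" if c: "c \<in> paths_to k (Suc n) X" and c': "c' \<in> paths_to k (Suc n) X" and eq: "c n = c' n" for c c'
  proof -
    note d = paths_to_SucD[OF c] and d' = paths_to_SucD[OF c', folded eq]
    have "(c(n := 0), c'(n := 0)) \<in> (swap_rel k n (unmove (c n) X))\<^sup>*" by (rule Suc.IH[OF d(1) d'(1)])
    then have "((c(n := 0))(n := c n), (c'(n := 0))(n := c n)) \<in> (swap_rel k (Suc n) X)\<^sup>*"
    proof (induction rule: rtrancl_induct)
      case (step y z)
      from step.IH swap_rel_upd[OF step.hyps(2) d(2-4)] show ?case by (rule rtrancl_into_rtrancl)
    qed simp
    moreover have "(c(n := 0))(n := c n) = c" by simp
    moreover have "(c'(n := 0))(n := c n) = c'" unfolding eq by simp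
    ultimately show ?thesis by (simp only:)
  qed
  show ?case
  proof (cases "c' n = c n")
    case True
    then show ?thesis using same Suc.prems by simp
  next
    case False
    obtain m w where w: "n = Suc m" "w \<in> paths_to k (Suc n) X" "w n = c n"
       "swap_at m w \<in> paths_to k (Suc n) X" "swap_at m w n = c' n"
      using path_with_last(2)[OF Suc.prems(1) paths_to_SucD(2-4)[OF Suc.prems(2)] False] by blast
    have "(c, w) \<in> (swap_rel k (Suc n) X)\<^sup>*" using same Suc.prems w by simp
    moreover have "(w, swap_at m w) \<in> swap_rel k (Suc n) X" unfolding swap_rel_def using w by auto
    moreover have "(swap_at m w, c') \<in> (swap_rel k (Suc n) X)\<^sup>*" using same Suc.prems w by simp
    ultimately show ?thesis by (meson rtrancl.rtrancl_into_rtrancl rtrancl_trans)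
  qed
qed

section \<open>Traces and the separation of characters\<close>

definition delta :: "'b \<Rightarrow> 'b \<Rightarrow> complex" where
  "delta c0 c = (if c = c0 then 1 else 0)"

text \<open>If both orders of the two boxes are possible, the boxes do not touch, and the axial
  distance is at least 2 in absolute value.\<close>

lemma off_diag_nonzero:
  assumes c: "c \<in> paths k n" and s: "swap_at j c \<in> paths k n" and j: "Suc j < n"
  shows "off_diag (axial_dist j c) \<noteq> 0"
proof -
  have st: "state k (swap_at j c) j = state k c j" by (rule state_cong) auto
  have a: "c j \<in> state k c j" "c j - 1 \<notin> state k c j" using pathsD[OF c] j by auto
  have b: "c (Suc j) \<in> state k c j" "c (Suc j) - 1 \<notin> state k c j"
    using pathsD[OF s, of j] j unfolding st by auto
  have "axial_dist j c \<noteq> 0" using paths_adjacent_neq[OF c j] by (simp add: axial_dist_def)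
  moreover have "c (Suc j) \<noteq> c j + 1" "c (Suc j) \<noteq> c j - 1" using a b by auto
  ultimately have "2 \<le> \<bar>axial_dist j c\<bar>" by (auto simp: axial_dist_def)
  then have d: "2 \<le> \<bar>real_of_int (axial_dist j c)\<bar>" by linarith
  then have "\<bar>1 / real_of_int (axial_dist j c)\<bar> < 1" by (simp add: field_simps)
  then have "(1 / real_of_int (axial_dist j c))\<^sup>2 < 1" by (simp add: abs_square_less_1)
  then show ?thesis by (simp add: off_diag_def)
qed

definition young_char :: "nat \<Rightarrow> nat \<Rightarrow> ('p \<Rightarrow> ((nat \<Rightarrow> int) \<Rightarrow> complex) \<Rightarrow> (nat \<Rightarrow> int) \<Rightarrow> complex) \<Rightarrow> int set \<Rightarrow> 'p \<Rightarrow> complex" where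
  "young_char k n R X \<pi> = (\<Sum>c\<in>paths_to k n X. R \<pi> (delta c) c)"

text \<open>Equality of the characters extends linearly to \<open>group_alg\<close>. This contains
  the projection onto one path of shape \<open>X\<close>, whose trace is 1 on shape \<open>X\<close>
  and 0 on every other shape.\<close>

lemma young_char_inj:
  assumes R: "is_young_rep k n R"
    and eq: "\<And>\<pi>. \<pi> permutes {1..n} \<Longrightarrow> young_char k n R X \<pi> = young_char k n R Y \<pi>"
    and ne: "paths_to k n X \<noteq> {}"
  shows "X = Y"
proof (rule ccontr)
  assume XY: "X \<noteq> Y"
  obtain c0 where c0: "c0 \<in> paths_to k n X" using ne by auto
  then have c0Y: "c0 \<notin> paths_to k n Y" "c0 \<in> paths k n" using XY by (auto simp: paths_to_def)
  have "(\<Sum>c\<in>paths_to k n X. P (delta c) c) = (\<Sum>c\<in>paths_to k n Y. P (delta c) c)" if "P \<in> group_alg n R" for P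
    using that
  proof (induction rule: group_alg.induct[OF R, consumes 1, case_names zero add])
    case (add P \<pi> a)
    then show ?case using eq[OF add(2)] by (simp add: sum.distrib young_char_def flip: sum_distrib_left)
  qed simp
  moreover obtain P where P: "P \<in> group_alg n R" "\<And>F c. c \<in> paths k n \<Longrightarrow> P F c = (if c = c0 then F c else 0)"
    using path_projection[OF R c0Y(2)] by auto
  ultimately have "(\<Sum>c\<in>paths_to k n X. P (delta c) c) = (\<Sum>c\<in>paths_to k n Y. P (delta c) c)" by blast
  moreover have "(\<Sum>c\<in>paths_to k n X. P (delta c) c) = (\<Sum>c\<in>paths_to k n X. if c = c0 then 1 else 0)"
    by (rule sum.cong) (auto simp: P paths_to_def delta_def)
  moreover have "(\<Sum>c\<in>paths_to k n Y. P (delta c) c) = (\<Sum>c\<in>paths_to k n Y. 0)"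
    by (rule sum.cong) (use c0Y in \<open>auto simp: P paths_to_def delta_def\<close>)
  ultimately show False using c0 finite_paths_to by simp
qed

section \<open>Matrix form and irreducibility\<close>

definition rep_mat :: "('p \<Rightarrow> ('b \<Rightarrow> complex) \<Rightarrow> 'b \<Rightarrow> complex) \<Rightarrow> nat \<Rightarrow> (nat \<Rightarrow> 'b) \<Rightarrow> 'p \<Rightarrow> complex mat" where
  "rep_mat R d e \<pi> = mat d d (\<lambda>(i, j). R \<pi> (delta (e j)) (e i))"

text \<open>Identifies coordinate vectors with functions on the paths, so that
  \<open>group_alg\<close> can be applied to vectors of an invariant subspace.\<close>

definition vec_fun :: "nat \<Rightarrow> (nat \<Rightarrow> 'b) \<Rightarrow> complex vec \<Rightarrow> 'b \<Rightarrow> complex" where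
  "vec_fun d e v c = (\<Sum>j<d. v $ j * delta (e j) c)"

context
  fixes k n :: nat and R :: "(nat \<Rightarrow> nat) \<Rightarrow> ((nat \<Rightarrow> int) \<Rightarrow> complex) \<Rightarrow> (nat \<Rightarrow> int) \<Rightarrow> complex"
    and X :: "int set" and d :: nat and e :: "nat \<Rightarrow> nat \<Rightarrow> int"
  assumes R: "is_young_rep k n R"
    and e: "bij_betw e {..<d} (paths_to k n X)"
begin

abbreviation (input) "\<rho> \<equiv> rep_mat R d e"
abbreviation (input) "fn \<equiv> vec_fun d e"

lemma basis_inj: "i < d \<Longrightarrow> j < d \<Longrightarrow> e i = e j \<longleftrightarrow> i = j"
  using e by (auto simp: bij_betw_def inj_on_def)

lemma basis_mem: "i < d \<Longrightarrow> e i \<in> paths_to k n X"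
  using e by (auto simp: bij_betw_def)

lemma basis_surj: "c \<in> paths_to k n X \<Longrightarrow> \<exists>i<d. c = e i"
  using e by (auto simp: bij_betw_def image_iff)

lemma rep_mat_carrier: "\<rho> \<pi> \<in> carrier_mat d d"
  by (simp add: rep_mat_def)

lemma vec_fun_at: "i < d \<Longrightarrow> fn v (e i) = v $ i"
  unfolding vec_fun_def delta_def by (simp add: basis_inj if_distrib cong: if_cong sum.cong_simp)

lemma vec_fun_off: "c \<notin> paths_to k n X \<Longrightarrow> fn v c = 0"
  unfolding vec_fun_def delta_def using basis_mem by (auto intro!: sum.neutral)

lemma expand_delta:
  assumes "\<And>c. c \<notin> paths_to k n X \<Longrightarrow> F c = 0" "linear_op P"
  shows "P F c = (\<Sum>j<d. F (e j) * P (delta (e j)) c)"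
proof -
  have "F = (\<lambda>c. \<Sum>j<d. F (e j) * delta (e j) c)"
  proof
    fix c
    show "F c = (\<Sum>j<d. F (e j) * delta (e j) c)"
    proof (cases "c \<in> paths_to k n X")
      case True
      then obtain i where i: "i < d" "c = e i" using basis_surj by auto
      then show ?thesis unfolding delta_def by (simp add: basis_inj if_distrib cong: if_cong sum.cong_simp)
    next
      case False
      then show ?thesis using assms(1) basis_mem unfolding delta_def by (auto intro!: sum.neutral)
    qed
  qed
  then have "P F c = P (\<lambda>c. \<Sum>j<d. F (e j) * delta (e j) c) c" by (rule arg_cong)
  also have "\<dots> = (\<Sum>j<d. F (e j) * P (delta (e j)) c)"
    unfolding linear_op_sum[OF assms(2) finite_lessThan] ..
  finally show ?thesis .
qed

lemma delta_support: "j < d \<Longrightarrow> c \<notin> paths_to k n X \<Longrightarrow> delta (e j) c = 0"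
  using basis_mem by (auto simp: delta_def)

lemma rep_mat_mult:
  assumes "\<pi> permutes {1..n}" "\<sigma> permutes {1..n}"
  shows "\<rho> (\<pi> \<circ> \<sigma>) = \<rho> \<pi> * \<rho> \<sigma>"
proof (rule eq_matI)
  fix i j assume "i < dim_row (\<rho> \<pi> * \<rho> \<sigma>)" "j < dim_col (\<rho> \<pi> * \<rho> \<sigma>)"
  then have ij: "i < d" "j < d" by (auto simp: rep_mat_def)
  have "\<rho> (\<pi> \<circ> \<sigma>) $$ (i, j) = R \<pi> (R \<sigma> (delta (e j))) (e i)"
    using ij young_rep_comp[OF R assms] by (simp add: rep_mat_def)
  also have "\<dots> = (\<Sum>l<d. R \<sigma> (delta (e j)) (e l) * R \<pi> (delta (e l)) (e i))"
    by (rule expand_delta)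
      (use young_rep_support[OF R assms(2) delta_support[OF ij(2)]] linear_op_young_rep[OF R assms(1)] in auto)
  also have "\<dots> = (\<rho> \<pi> * \<rho> \<sigma>) $$ (i, j)"
    using ij by (simp add: rep_mat_def scalar_prod_def mult.commute atLeast0LessThan)
  finally show "\<rho> (\<pi> \<circ> \<sigma>) $$ (i, j) = (\<rho> \<pi> * \<rho> \<sigma>) $$ (i, j)" .
qed (auto simp: rep_mat_def)

lemma rep_mat_id: "\<rho> id = 1\<^sub>m d"
  by (rule eq_matI) (auto simp: rep_mat_def young_rep_id[OF R] delta_def basis_inj)

lemma vec_fun_rep:
  assumes "\<pi> permutes {1..n}" "v \<in> carrier_vec d"
  shows "fn (\<rho> \<pi> *\<^sub>v v) = R \<pi> (fn v)"
proof
  fix c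
  show "fn (\<rho> \<pi> *\<^sub>v v) c = R \<pi> (fn v) c"
  proof (cases "c \<in> paths_to k n X")
    case True
    then obtain i where i: "i < d" "c = e i" using basis_surj by auto
    have "R \<pi> (fn v) c = (\<Sum>j<d. fn v (e j) * R \<pi> (delta (e j)) c)"
      by (rule expand_delta) (use vec_fun_off linear_op_young_rep[OF R assms(1)] in auto)
    also have "\<dots> = (\<Sum>j<d. v $ j * R \<pi> (delta (e j)) c)"
      by (rule sum.cong) (auto simp: vec_fun_at)
    also have "\<dots> = fn (\<rho> \<pi> *\<^sub>v v) c"
      using i assms by (simp add: vec_fun_at rep_mat_def scalar_prod_def mult.commute atLeast0LessThan)
    finally show ?thesis by simp
  next
    case False
    then show ?thesis using vec_fun_off young_rep_support[OF R assms(1) vec_fun_off] by simp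
  qed
qed

lemma rep_mat_group_hom: "group_hom (sym_group n) (general_linear_group d) \<rho>"
proof -
  interpret ring "ring_mat TYPE(complex) d ()" by (rule ring_mat)
  have "monoid (ring_mat TYPE(complex) d ())" by (rule monoid_axioms)
  then have gl: "group (general_linear_group d)" unfolding general_linear_group_def by (rule monoid.units_group)
  have unit: "\<rho> \<pi> \<in> Units (ring_mat TYPE(complex) d ())" if \<pi>: "\<pi> permutes {1..n}" for \<pi>
  proof -
    have i: "Hilbert_Choice.inv \<pi> permutes {1..n}" using \<pi> by (rule permutes_inv)
    have "\<rho> (Hilbert_Choice.inv \<pi>) * \<rho> \<pi> = 1\<^sub>m d" "\<rho> \<pi> * \<rho> (Hilbert_Choice.inv \<pi>) = 1\<^sub>m d"
      using rep_mat_mult[OF i \<pi>] rep_mat_mult[OF \<pi> i] permutes_inv_o[OF \<pi>] rep_mat_id by simp_all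
    then show ?thesis unfolding Units_def using rep_mat_carrier by (auto simp: ring_mat_simps)
  qed
  have "\<rho> \<in> hom (sym_group n) (general_linear_group d)"
    by (rule homI) (auto simp: general_linear_group_def units_of_def sym_group_def ring_mat_simps rep_mat_mult unit)
  then show ?thesis using gl sym_group_is_group by (simp add: group_hom_def group_hom_axioms_def)
qed

lemma rep_mat_irreducible:
  assumes d: "d > 0"
  shows "irreducible_representation (sym_group n) d \<rho>"
  unfolding irreducible_representation_def is_representation_def
proof (intro conjI allI impI rep_mat_group_hom d)
  fix W assume W: "invariant_subspace (sym_group n) d \<rho> W"
  then have sub: "submodule class_ring W (module_vec TYPE(complex) d)"
    and inv: "\<And>\<pi> w. \<pi> permutes {1..n} \<Longrightarrow> w \<in> W \<Longrightarrow> \<rho> \<pi> *\<^sub>v w \<in> W"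
    unfolding invariant_subspace_def VectorSpace.subspace_def by (auto simp: sym_group_carrier)
  have Wc: "W \<subseteq> carrier_vec d" and W0: "0\<^sub>v d \<in> W" and Wadd: "\<And>v w. v \<in> W \<Longrightarrow> w \<in> W \<Longrightarrow> v + w \<in> W"
    and Wsmult: "\<And>a v. v \<in> W \<Longrightarrow> a \<cdot>\<^sub>v v \<in> W"
    using sub unfolding submodule_def by (auto simp: module_vec_simps class_ring_simps)
  \<comment> \<open>An invariant subspace is stable under the whole group algebra, in particular
    under the projections onto single paths.\<close>
  have alg: "\<exists>w\<in>W. fn w = P (fn v)" if "P \<in> group_alg n R" "v \<in> W" for P v
    using that
  proof (induction rule: group_alg.induct[OF R, consumes 1, case_names zero add])
    case zero
    show ?case by (rule bexI[OF _ W0]) (simp add: vec_fun_def fun_eq_iff)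
  next
    case (add P \<pi> a)
    then obtain w where w: "w \<in> W" "fn w = P (fn v)" by auto
    have v: "v \<in> carrier_vec d" "w \<in> carrier_vec d" using w add Wc by auto
    have rv: "\<rho> \<pi> *\<^sub>v v \<in> W" using inv add by auto
    have "fn (a \<cdot>\<^sub>v (\<rho> \<pi> *\<^sub>v v) + w) c = a * fn (\<rho> \<pi> *\<^sub>v v) c + fn w c" for c
    proof -
      let ?u = "\<rho> \<pi> *\<^sub>v v"
      have u: "?u \<in> carrier_vec d" using rv Wc by auto
      have "fn (a \<cdot>\<^sub>v ?u + w) c = (\<Sum>j<d. a * (?u $ j * delta (e j) c) + w $ j * delta (e j) c)"
        unfolding vec_fun_def
      proof (rule sum.cong[OF refl])
        fix j assume "j \<in> {..<d}"
        then have "(a \<cdot>\<^sub>v u + w) $ j = a * u $ j + w $ j" if "u \<in> carrier_vec d" for u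
          using that v(2) by simp
        from this[OF u] have "(a \<cdot>\<^sub>v ?u + w) $ j = a * ?u $ j + w $ j" .
        then show "(a \<cdot>\<^sub>v ?u + w) $ j * delta (e j) c = a * (?u $ j * delta (e j) c) + w $ j * delta (e j) c"
          by (simp only: distrib_right mult.assoc)
      qed
      then show ?thesis unfolding vec_fun_def by (simp only: sum.distrib sum_distrib_left)
    qed
    then have "fn (a \<cdot>\<^sub>v (\<rho> \<pi> *\<^sub>v v) + w) = (\<lambda>c. a * R \<pi> (fn v) c + P (fn v) c)"
      using vec_fun_rep[OF add(2) v(1)] w by auto
    then show ?case using rv w by (intro bexI[of _ "a \<cdot>\<^sub>v (\<rho> \<pi> *\<^sub>v v) + w"] Wadd Wsmult) auto
  qed
  \<comment> \<open>Projection onto the path \<open>e i\<close> leaves a non-zero multiple of a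
    basis vector.\<close>
  have unit: "unit_vec d i \<in> W" if v: "v \<in> W" and i: "i < d" "v $ i \<noteq> 0" for v i
  proof -
    have "e i \<in> paths k n" using basis_mem[OF i(1)] by (simp add: paths_to_def)
    then obtain P where P: "P \<in> group_alg n R" "\<And>F c. c \<in> paths k n \<Longrightarrow> P F c = (if c = e i then F c else 0)"
      using path_projection[OF R] by blast
    obtain w where w: "w \<in> W" "fn w = P (fn v)" using alg[OF P(1) v] by auto
    have "w = v $ i \<cdot>\<^sub>v unit_vec d i"
    proof (rule eq_vecI)
      fix j assume "j < dim_vec (v $ i \<cdot>\<^sub>v unit_vec d i)"
      then have j: "j < d" by simp
      have "w $ j = P (fn v) (e j)" using vec_fun_at[OF j, of w] w by simp
      also have "\<dots> = (if e j = e i then fn v (e j) else 0)" 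
        using basis_mem[OF j] by (intro P(2)) (simp add: paths_to_def)
      finally show "w $ j = (v $ i \<cdot>\<^sub>v unit_vec d i) $ j" using i j by (auto simp: basis_inj vec_fun_at)
    qed (use w Wc in auto)
    then have "unit_vec d i = (1 / v $ i) \<cdot>\<^sub>v w" using i by (simp add: smult_smult_assoc)
    then show ?thesis using Wsmult[OF w(1)] by simp
  qed
  show "W = {0\<^sub>v d} \<or> W = carrier_vec d"
  proof (rule disjCI)
    assume "W \<noteq> carrier_vec d"
    show "W = {0\<^sub>v d}"
    proof (rule ccontr)
      assume "W \<noteq> {0\<^sub>v d}"
      then obtain v where v: "v \<in> W" "v \<noteq> 0\<^sub>v d" using W0 by auto
      then have "v \<in> carrier_vec d" using Wc by auto
      then obtain i where i: "i < d" "v $ i \<noteq> 0" using v(2) by (auto simp: vec_eq_iff)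
      have all: "unit_vec d j \<in> W" if j: "j < d" for j
      proof -
        have "(e i, e j) \<in> (swap_rel k n X)\<^sup>*" using paths_to_connected basis_mem i j by blast
        then have "\<exists>l<d. e j = e l \<and> unit_vec d l \<in> W"
        proof (induction rule: rtrancl_induct)
          case base
          then show ?case using unit[OF v(1) i] i by auto
        next
          case (step c c')
          then obtain l s where l: "l < d" "c = e l" "unit_vec d l \<in> W"
            and s: "Suc s < n" "c \<in> paths_to k n X" "c' = swap_at s c" "c' \<in> paths_to k n X"
            unfolding swap_rel_def by auto
          obtain l' where l': "l' < d" "c' = e l'" using basis_surj[OF s(4)] by auto
          have adj: "adj_transp s permutes {1..n}" using s by (intro permutes_swap_id) auto
          have Rs: "R (adj_transp s) = young k n s" using R s unfolding is_young_rep_def by blast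
          \<comment> \<open>A swap turns the basis vector of \<open>c\<close> into a vector with a
            non-zero coordinate at the neighbour \<open>c'\<close>, so the basis vector of
            \<open>c'\<close> lies in \<open>W\<close> too.\<close>
          define w where "w = \<rho> (adj_transp s) *\<^sub>v unit_vec d l"
          have "w \<in> W" unfolding w_def using inv[OF adj l(3)] .
          moreover have "w $ l' = off_diag (axial_dist s c')"
          proof -
            have fl: "fn (unit_vec d l) = delta c"
            proof
              fix c2
              have "fn (unit_vec d l) c2 = (\<Sum>j<d. if j = l then delta (e j) c2 else 0)"
                unfolding vec_fun_def using l(1) by (intro sum.cong) auto
              then show "fn (unit_vec d l) c2 = delta c c2" using l by simp
            qed
            have cs: "c \<in> paths k n" "c' \<in> paths k n" using s by (auto simp: paths_to_def)
            have "c' \<noteq> c" using paths_adjacent_neq[OF cs(1) s(1)] s(3) by (metis swap_at_apply(1))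
            have "w $ l' = fn w c'" using vec_fun_at[OF l'(1)] l' by simp
            also have "\<dots> = young k n s (delta c) c'"
              unfolding w_def using vec_fun_rep[OF adj] Rs fl by simp
            also have "\<dots> = off_diag (axial_dist s c')"
              using cs \<open>c' \<noteq> c\<close> s(3) by (simp add: young_def young_raw_def delta_def)
            finally show ?thesis .
          qed
          moreover have "off_diag (axial_dist s c') \<noteq> 0"
            using off_diag_nonzero[of c k n s] s by (auto simp: paths_to_def)
          ultimately have "unit_vec d l' \<in> W" using unit l' by auto
          then show ?case using l' by auto
        qed
        then show ?thesis using j basis_inj by auto
      qed
      have "carrier_vec d \<subseteq> W"
      proof
        fix u :: "complex vec" assume u: "u \<in> carrier_vec d"
        have "vec d (\<lambda>i. if i < m then u $ i else 0) \<in> W" if "m \<le> d" for m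
          using that
        proof (induction m)
          case 0
          have "vec d (\<lambda>i. if i < 0 then u $ i else 0) = 0\<^sub>v d" by auto
          then show ?case using W0 by simp
        next
          case (Suc m)
          have "vec d (\<lambda>i. if i < Suc m then u $ i else 0) = vec d (\<lambda>i. if i < m then u $ i else 0) + u $ m \<cdot>\<^sub>v unit_vec d m"
            using Suc by (intro eq_vecI) (auto simp: less_Suc_eq)
          then show ?case using Suc all Wadd Wsmult by auto
        qed
        from this[of d] have "vec d (\<lambda>i. if i < d then u $ i else 0) \<in> W" by simp
        moreover have "vec d (\<lambda>i. if i < d then u $ i else 0) = u" using u by auto
        ultimately show "u \<in> W" by simp
      qed
      then show False using Wc \<open>W \<noteq> carrier_vec d\<close> by auto
    qed
  qed
qed

lemma rep_mat_trace: "mat_trace (\<rho> \<pi>) = young_char k n R X \<pi>"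
proof -
  have "mat_trace (\<rho> \<pi>) = (\<Sum>i<d. R \<pi> (delta (e i)) (e i))"
    unfolding mat_trace_def by (simp add: rep_mat_def)
  also have "\<dots> = young_char k n R X \<pi>"
    unfolding young_char_def by (rule sum.reindex_bij_betw[OF e])
  finally show ?thesis .
qed

end

section \<open>From equal hook products to equal degrees\<close>

lemma hook_product_pos: "hook_product k X > 0"
  unfolding hook_product_def by (intro prod_pos) auto

text \<open>By the hook length formula every shape in \<open>\<X>\<close> has n!/P tableaux, so all
  degrees agree, and the characters differ by \<open>young_char_inj\<close>. The common
  \<open>k\<close> lets one \<open>R\<close> carry all of them.\<close>

theorem max_multiplicity_ge_card:
  assumes \<X>: "finite \<X>" "\<X> \<noteq> {}"
    and X: "\<And>X. X \<in> \<X> \<Longrightarrow> finite X \<and> X \<subseteq> {..<int k} \<and> card X = k \<and> hook_count k X = n"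
    and P: "\<And>X. X \<in> \<X> \<Longrightarrow> hook_product k X = P"
  shows "max_multiplicity n \<ge> card \<X>"
proof -
  let ?G = "sym_group n"
  obtain R where R: "is_young_rep k n R" using ex_young_rep by blast
  obtain X0 where X0: "X0 \<in> \<X>" using \<X> by auto
  define d where "d = card (paths_to k n X0)"
  have hook: "real (card (paths_to k n X)) * P = fact n" if "X \<in> \<X>" for X
    using hook_length_formula[of X k n] X[OF that] P[OF that] by simp
  have Pne: "P \<noteq> 0" using hook_product_pos[of k X0] P[OF X0] by simp
  have card: "card (paths_to k n X) = d" if "X \<in> \<X>" for X
    using hook[OF that] hook[OF X0] Pne unfolding d_def by (metis mult_right_cancel of_nat_eq_iff)
  have "real d * P = fact n" using hook[OF X0] by (simp add: d_def)
  then have "d \<noteq> 0" by (metis fact_nonzero mult_zero_left of_nat_0)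
  then have d: "d > 0" by simp
  have ne: "paths_to k n X \<noteq> {}" if "X \<in> \<X>" for X using card[OF that] d by auto
  define \<chi> where "\<chi> X = restrict (young_char k n R X) (carrier ?G)" for X
  have ch: "\<chi> X \<in> irreducible_characters ?G \<and> character_degree ?G (\<chi> X) = of_nat d" if XX: "X \<in> \<X>" for X
  proof -
    obtain e where e: "bij_betw e {..<d} (paths_to k n X)"
      using ex_bij_betw_nat_finite[OF finite_paths_to[of k n X]] card[OF XX] by (auto simp: atLeast0LessThan)
    have eq: "character_of ?G (rep_mat R d e) = \<chi> X"
      unfolding character_of_def \<chi>_def by (simp add: rep_mat_trace[OF R e])
    have "character_degree ?G (\<chi> X) = mat_trace (rep_mat R d e id)"
      unfolding character_degree_def \<chi>_def
      by (simp add: rep_mat_trace[OF R e] sym_group_def permutes_id)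
    also have "\<dots> = of_nat d" unfolding rep_mat_id[OF R e] mat_trace_def by simp
    finally have deg: "character_degree ?G (\<chi> X) = of_nat d" .
    have "character_of ?G (rep_mat R d e) \<in> irreducible_characters ?G"
      unfolding irreducible_characters_def using rep_mat_irreducible[OF R e d] by blast
    then show ?thesis using deg eq by simp
  qed
  have inj: "inj_on \<chi> \<X>"
  proof (rule inj_onI)
    fix X Y assume XY: "X \<in> \<X>" "Y \<in> \<X>" "\<chi> X = \<chi> Y"
    have "young_char k n R X \<pi> = young_char k n R Y \<pi>" if "\<pi> permutes {1..n}" for \<pi>
      using fun_cong[OF XY(3), of \<pi>] that by (simp add: \<chi>_def sym_group_carrier)
    then show "X = Y" by (rule young_char_inj[OF R _ ne[OF XY(1)]])
  qed
  have "finite (carrier ?G)" by (simp add: sym_group_def finite_permutations)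
  then have finI: "finite (irreducible_characters ?G)"
    by (rule finite_irreducible_characters[OF sym_group_is_group])
  let ?M = "degree_multiset n"
  have "card \<X> = card (\<chi> ` \<X>)" using inj by (simp add: card_image)
  also have "\<dots> \<le> card {\<psi> \<in> irreducible_characters ?G. character_degree ?G \<psi> = of_nat d}"
    using ch finI by (intro card_mono) auto
  also have "\<dots> = count ?M (of_nat d)"
  proof -
    have "{\<psi> \<in> irreducible_characters ?G. character_degree ?G \<psi> = of_nat d}
       = character_degree ?G -` {of_nat d} \<inter> irreducible_characters ?G" by auto
    moreover have "(\<Sum>\<psi>\<in>character_degree ?G -` {of_nat d} \<inter> irreducible_characters ?G.
        count (mset_set (irreducible_characters ?G)) \<psi>) = card (character_degree ?G -` {of_nat d} \<inter> irreducible_characters ?G)"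
      using finI by simp
    ultimately show ?thesis unfolding degree_multiset_def count_image_mset using finI by simp
  qed
  finally have le: "card \<X> \<le> count ?M (of_nat d)" .
  have "card \<X> > 0" using \<X> by (simp add: card_gt_0_iff)
  then have "of_nat d \<in># ?M" using le by (metis count_greater_zero_iff order_less_le_trans)
  then have "count ?M (of_nat d) \<le> Max (count ?M ` set_mset ?M)" by (intro Max_ge) auto
  then show ?thesis unfolding max_multiplicity_def using le by linarith
qed

section \<open>Words with a prescribed number of inversions\<close>

definition inversions :: "nat \<Rightarrow> nat set \<Rightarrow> nat" where
  "inversions m A = (\<Sum>i\<in>A. card ({i<..<m} - A))"

definition hook_lengths_prod :: "nat \<Rightarrow> nat set \<Rightarrow> nat" where
  "hook_lengths_prod m A = (\<Prod>d\<in>{1..<m}. d ^ hooks m A d)"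

lemma card_hook_pairs:
  fixes A :: "nat set"
  assumes A: "A \<subseteq> {..<m}" and d: "d \<in> {1..<m}"
  shows "card {p \<in> (SIGMA i:A. {i<..<m} - A). snd p - fst p = d} = hooks m A d"
  unfolding hooks_def
  by (rule bij_betw_same_card[of fst])
    (rule bij_betw_byWitness[of _ "\<lambda>i. (i, i + d)"]; use A d in auto)

lemma inversions_eq_sum_hooks:
  assumes A: "A \<subseteq> {..<m}"
  shows "inversions m A = (\<Sum>d\<in>{1..<m}. hooks m A d)"
proof -
  let ?S = "SIGMA i:A. {i<..<m} - A"
  have fin: "finite A" using A finite_subset by blast
  then have finS: "finite ?S" by auto
  have "inversions m A = card ?S" unfolding inversions_def using fin by simp
  also have "\<dots> = (\<Sum>p\<in>?S. 1)" by simp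
  also have "\<dots> = (\<Sum>d\<in>{1..<m}. \<Sum>p\<in>{p\<in>?S. snd p - fst p = d}. 1)"
    by (rule sum.group[symmetric]) (use finS A in auto)
  also have "\<dots> = (\<Sum>d\<in>{1..<m}. hooks m A d)"
    by (rule sum.cong[OF refl]) (simp add: card_hook_pairs[OF A] flip: One_nat_def)
  finally show ?thesis .
qed

lemma prod_hook_lengths:
  assumes A: "A \<subseteq> {..<m}"
  shows "(\<Prod>i\<in>A. \<Prod>j\<in>{i<..<m} - A. real (j - i)) = real (hook_lengths_prod m A)"
proof -
  let ?S = "SIGMA i:A. {i<..<m} - A"
  have fin: "finite A" using A finite_subset by blast
  then have finS: "finite ?S" by auto
  have "(\<Prod>i\<in>A. \<Prod>j\<in>{i<..<m} - A. real (j - i)) = (\<Prod>p\<in>?S. real (snd p - fst p))"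
    using fin by (subst prod.Sigma) (auto simp: case_prod_unfold)
  also have "\<dots> = (\<Prod>d\<in>{1..<m}. \<Prod>p\<in>{p\<in>?S. snd p - fst p = d}. real (snd p - fst p))"
    by (rule prod.group[symmetric]) (use finS A in auto)
  also have "\<dots> = (\<Prod>d\<in>{1..<m}. real d ^ hooks m A d)"
  proof (rule prod.cong[OF refl])
    fix d assume d: "d \<in> {1..<m}"
    have "(\<Prod>p\<in>{p\<in>?S. snd p - fst p = d}. real (snd p - fst p)) = (\<Prod>p\<in>{p\<in>?S. snd p - fst p = d}. real d)"
      by (rule prod.cong) auto
    then show "(\<Prod>p\<in>{p\<in>?S. snd p - fst p = d}. real (snd p - fst p)) = real d ^ hooks m A d"
      using card_hook_pairs[OF A d] by simp
  qed
  finally show ?thesis by (simp add: hook_lengths_prod_def)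
qed

text \<open>Subtracting the number of zeros sends the word with all zeros first to
  \<open>{0..<card A}\<close>, the encoding of the empty partition.\<close>

definition shifted :: "nat \<Rightarrow> nat set \<Rightarrow> int set" where
  "shifted m A = (\<lambda>i. int i - int (m - card A)) ` A"

lemma shifted_props:
  assumes A: "A \<subseteq> {..<m}"
  shows "finite (shifted m A)" "shifted m A \<subseteq> {..<int (card A)}" "card (shifted m A) = card A"
    "hook_count (card A) (shifted m A) = inversions m A"
    "hook_product (card A) (shifted m A) = real (hook_lengths_prod m A)"
proof -
  define c where "c = int (m - card A)"
  let ?f = "\<lambda>i::nat. int i - c"
  have sh: "shifted m A = ?f ` A" by (simp add: shifted_def c_def)
  have fin: "finite A" using A finite_subset by blast
  have inj: "inj_on ?f S" for S by (auto simp: inj_on_def)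
  have cm: "card A \<le> m" using card_mono[OF _ A] by simp
  then have fm: "int (card A) = int m - c" by (simp add: c_def)
  show "finite (shifted m A)" using fin by (simp add: sh)
  show "shifted m A \<subseteq> {..<int (card A)}" using A unfolding sh fm by auto
  show "card (shifted m A) = card A" unfolding sh by (rule card_image[OF inj])
  have gap: "{?f i<..<int (card A)} - shifted m A = ?f ` ({i<..<m} - A)" for i
    unfolding sh fm
  proof (intro equalityI subsetI)
    fix x assume x: "x \<in> {?f i<..<?f m} - ?f ` A"
    define j where "j = nat (x + c)"
    have xj: "x = ?f j" using x by (simp add: j_def)
    have "?f i < ?f j" "?f j < ?f m" using x unfolding xj by simp_all
    then have "i < j" "j < m" by simp_all
    moreover have "j \<notin> A"
    proof
      assume "j \<in> A"
      then have "x \<in> ?f ` A" unfolding xj by (rule imageI)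
      then show False using x by simp
    qed
    ultimately have "j \<in> {i<..<m} - A" by simp
    then show "x \<in> ?f ` ({i<..<m} - A)" unfolding xj by (rule imageI)
  qed auto
  show "hook_count (card A) (shifted m A) = inversions m A"
  proof -
    have "hook_count (card A) (shifted m A) = (\<Sum>i\<in>A. card ({?f i<..<int (card A)} - shifted m A))"
      unfolding hook_count_def by (subst (1) sh) (simp only: sum.reindex[OF inj] comp_def)
    then show ?thesis unfolding gap card_image[OF inj] inversions_def .
  qed
  show "hook_product (card A) (shifted m A) = real (hook_lengths_prod m A)"
  proof -
    have "hook_product (card A) (shifted m A) = (\<Prod>i\<in>A. \<Prod>y\<in>{?f i<..<int (card A)} - shifted m A. real_of_int (y - ?f i))"
      unfolding hook_product_def by (subst (1) sh) (simp only: prod.reindex[OF inj] comp_def)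
    also have "\<dots> = (\<Prod>i\<in>A. \<Prod>j\<in>{i<..<m} - A. real (j - i))"
      unfolding gap prod.reindex[OF inj] comp_def by (intro prod.cong refl) (auto simp: of_nat_diff)
    finally show ?thesis using prod_hook_lengths[OF A] by simp
  qed
qed

lemma shifted_inj:
  assumes "A \<subseteq> {..<m}" "A' \<subseteq> {..<m}" "card A = card A'" "shifted m A = shifted m A'"
  shows "A = A'"
proof -
  have "inj (\<lambda>i::nat. int i - int (m - card A'))" by (auto simp: inj_on_def)
  then show ?thesis using assms unfolding shifted_def by (metis inj_image_eq_iff)
qed

section \<open>Prepending a fixed word\<close>

definition prefixed :: "nat \<Rightarrow> nat set \<Rightarrow> nat set \<Rightarrow> nat set" where
  "prefixed l \<alpha> A = \<alpha> \<union> (\<lambda>i. l + i) ` A"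

text \<open>The hooks from a one of the prefix to a zero of the remaining word, the only ones that
  depend on both words.\<close>

definition cross_hooks :: "nat \<Rightarrow> nat \<Rightarrow> nat set \<Rightarrow> nat set \<Rightarrow> nat \<Rightarrow> nat" where
  "cross_hooks l m \<alpha> A d = card {i \<in> \<alpha>. l \<le> i + d \<and> i + d < l + m \<and> i + d - l \<notin> A}"

lemma prefixed_subset: "\<alpha> \<subseteq> {..<l} \<Longrightarrow> A \<subseteq> {..<m} \<Longrightarrow> prefixed l \<alpha> A \<subseteq> {..<l + m}"
  by (force simp: prefixed_def)

lemma mem_prefixed:
  assumes "\<alpha> \<subseteq> {..<l}"
  shows "i \<in> prefixed l \<alpha> A \<longleftrightarrow> (if i < l then i \<in> \<alpha> else i - l \<in> A)"
proof (cases "i < l")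
  case False
  then obtain i' where "i = l + i'" by (metis le_Suc_ex not_less)
  then show ?thesis using assms by (auto simp: prefixed_def)
qed (auto simp: prefixed_def)

lemma card_prefixed:
  assumes "\<alpha> \<subseteq> {..<l}" "finite A"
  shows "card (prefixed l \<alpha> A) = card \<alpha> + card A"
proof -
  have "finite \<alpha>" using assms finite_subset by blast
  then have "card (prefixed l \<alpha> A) = card \<alpha> + card ((\<lambda>i. l + i) ` A)"
    unfolding prefixed_def using assms by (intro card_Un_disjoint) auto
  then show ?thesis by (simp add: card_image)
qed

lemma hooks_prefixed:
  assumes \<alpha>: "\<alpha> \<subseteq> {..<l}" and A: "A \<subseteq> {..<m}"
  shows "hooks (l + m) (prefixed l \<alpha> A) d = hooks l \<alpha> d + cross_hooks l m \<alpha> A d + hooks m A d"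
proof -
  let ?B = "prefixed l \<alpha> A"
  let ?U = "{i. i \<in> \<alpha> \<and> i + d < l \<and> i + d \<notin> \<alpha>}"
  let ?V = "{i \<in> \<alpha>. l \<le> i + d \<and> i + d < l + m \<and> i + d - l \<notin> A}"
  let ?W = "{i. i \<in> A \<and> i + d < m \<and> i + d \<notin> A}"
  have fin: "finite \<alpha>" "finite A" using assms finite_subset by blast+
  have "{i. i \<in> ?B \<and> i + d < l + m \<and> i + d \<notin> ?B} = (?U \<union> ?V) \<union> (\<lambda>i. l + i) ` ?W" (is "?L = ?R")
  proof (rule Set.set_eqI)
    fix i
    show "i \<in> ?L \<longleftrightarrow> i \<in> ?R"
    proof (cases "i < l")
      case True
      then show ?thesis unfolding mem_Collect_eq mem_prefixed[OF \<alpha>] by auto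
    next
      case False
      then obtain i' where "i = l + i'" by (metis le_Suc_ex not_less)
      then show ?thesis using \<alpha> unfolding mem_Collect_eq mem_prefixed[OF \<alpha>] by auto
    qed
  qed
  moreover have "card ((?U \<union> ?V) \<union> (\<lambda>i. l + i) ` ?W) = card (?U \<union> ?V) + card ((\<lambda>i. l + i) ` ?W)"
    using fin \<alpha> by (intro card_Un_disjoint) auto
  moreover have "card (?U \<union> ?V) = card ?U + card ?V" using fin by (intro card_Un_disjoint) auto
  moreover have "card ((\<lambda>i. l + i) ` ?W) = card ?W" by (simp add: card_image)
  ultimately show ?thesis unfolding hooks_def cross_hooks_def by simp
qed

lemma cross_hooks_le: "finite \<alpha> \<Longrightarrow> cross_hooks l m \<alpha> A d \<le> card \<alpha>"
  unfolding cross_hooks_def by (rule card_mono) auto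

lemma inversions_prefixed:
  assumes \<alpha>: "\<alpha> \<subseteq> {..<l}" and A: "A \<subseteq> {..<m}"
  shows "inversions (l + m) (prefixed l \<alpha> A) = inversions l \<alpha> + card \<alpha> * (m - card A) + inversions m A"
proof -
  let ?B = "prefixed l \<alpha> A"
  have fin: "finite \<alpha>" "finite A" using assms finite_subset by blast+
  have a: "card ({i<..<l + m} - ?B) = card ({i<..<l} - \<alpha>) + (m - card A)" if "i \<in> \<alpha>" for i
  proof -
    have il: "i < l" using that \<alpha> by auto
    have "{i<..<l + m} - ?B = ({i<..<l} - \<alpha>) \<union> (\<lambda>j. l + j) ` ({..<m} - A)" (is "?L = ?R")
    proof (rule Set.set_eqI)
      fix j
      show "j \<in> ?L \<longleftrightarrow> j \<in> ?R"
      proof (cases "j < l")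
        case True
        then show ?thesis by (auto simp: mem_prefixed[OF \<alpha>])
      next
        case False
        then obtain j' where "j = l + j'" by (metis le_Suc_ex not_less)
        then show ?thesis using il by (auto simp: mem_prefixed[OF \<alpha>])
      qed
    qed
    moreover have "card (({i<..<l} - \<alpha>) \<union> (\<lambda>j. l + j) ` ({..<m} - A)) = card ({i<..<l} - \<alpha>) + card ((\<lambda>j. l + j) ` ({..<m} - A))"
      by (intro card_Un_disjoint) auto
    moreover have "card ((\<lambda>j. l + j) ` ({..<m} - A)) = m - card A"
      using fin A by (simp add: card_image card_Diff_subset)
    ultimately show ?thesis by simp
  qed
  have b: "card ({l + i<..<l + m} - ?B) = card ({i<..<m} - A)" for i
  proof -
    have "{l + i<..<l + m} - ?B = (\<lambda>j. l + j) ` ({i<..<m} - A)" (is "?L = ?R")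
    proof (rule Set.set_eqI)
      fix j
      show "j \<in> ?L \<longleftrightarrow> j \<in> ?R"
      proof (cases "j < l")
        case False
        then obtain j' where "j = l + j'" by (metis le_Suc_ex not_less)
        then show ?thesis by (auto simp: mem_prefixed[OF \<alpha>])
      qed auto
    qed
    then show ?thesis by (simp add: card_image)
  qed
  have "inversions (l + m) ?B = (\<Sum>i\<in>\<alpha>. card ({i<..<l + m} - ?B)) + (\<Sum>i\<in>(\<lambda>i. l + i) ` A. card ({i<..<l + m} - ?B))"
    unfolding inversions_def by (subst (1) prefixed_def, rule sum.union_disjoint) (use fin \<alpha> in auto)
  also have "(\<Sum>i\<in>\<alpha>. card ({i<..<l + m} - ?B)) = inversions l \<alpha> + card \<alpha> * (m - card A)"
    unfolding inversions_def using a by (simp add: sum.distrib)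
  also have "(\<Sum>i\<in>(\<lambda>i. l + i) ` A. card ({i<..<l + m} - ?B)) = inversions m A"
    unfolding inversions_def by (subst sum.reindex) (auto simp: b)
  finally show ?thesis .
qed

text \<open>The word $1^q 0^{t-r} 1 0^r 1^{a-q-1}$.\<close>

definition filler :: "nat \<Rightarrow> nat \<Rightarrow> nat \<Rightarrow> nat \<Rightarrow> nat set" where
  "filler t a q r = {..<q} \<union> insert (q + t - r) {q + t + 1..<a + t}"

text \<open>The first \<open>q\<close> ones precede all \<open>t\<close> zeros, the isolated one
  precedes the last \<open>r\<close> of them, the others none. Thus the number of inversions can be
  adjusted while the number of ones stays \<open>a\<close>.\<close>

lemma filler_props:
  assumes "q + 1 \<le> a" "r < t"
  shows "filler t a q r \<subseteq> {..<a + t}" "card (filler t a q r) = a"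
    "inversions (a + t) (filler t a q r) = q * t + r"
proof -
  let ?\<alpha> = "filler t a q r" and ?m = "q + t - r"
  have m: "q < ?m" "?m \<le> q + t" using assms by auto
  show "?\<alpha> \<subseteq> {..<a + t}" using assms by (auto simp: filler_def)
  have "card ?\<alpha> = card {..<q} + card (insert ?m {q + t + 1..<a + t})"
    unfolding filler_def by (rule card_Un_disjoint) (use m in auto)
  also have "\<dots> = q + Suc (card {q + t + 1..<a + t})" using m by simp
  finally show "card ?\<alpha> = a" using assms by simp
  have zeros: "{..<a + t} - ?\<alpha> = {q..<?m} \<union> {?m<..q + t}" using assms m by (auto simp: filler_def)
  have g: "{i<..<a + t} - ?\<alpha> = {i<..} \<inter> ({q..<?m} \<union> {?m<..q + t})" for i
    unfolding zeros[symmetric] by auto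
  have c1: "card ({i<..<a + t} - ?\<alpha>) = t" if "i < q" for i
  proof -
    have "{i<..<a + t} - ?\<alpha> = {q..<?m} \<union> {?m<..q + t}" unfolding g using that m by auto
    then have "card ({i<..<a + t} - ?\<alpha>) = card {q..<?m} + card {?m<..q + t}"
      by (simp only:) (rule card_Un_disjoint, auto)
    then show ?thesis using assms by simp
  qed
  have c2: "card ({?m<..<a + t} - ?\<alpha>) = r"
  proof -
    have "{?m<..<a + t} - ?\<alpha> = {?m<..q + t}" unfolding g by auto
    then show ?thesis using assms by simp
  qed
  have c3: "card ({i<..<a + t} - ?\<alpha>) = 0" if "i \<ge> q + t + 1" for i
  proof -
    have "{i<..<a + t} - ?\<alpha> = {}" unfolding g using that by auto
    then show ?thesis by simp
  qed
  have "inversions (a + t) ?\<alpha> = (\<Sum>i\<in>{..<q}. card ({i<..<a + t} - ?\<alpha>)) + (\<Sum>i\<in>insert ?m {q + t + 1..<a + t}. card ({i<..<a + t} - ?\<alpha>))"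
    unfolding inversions_def by (subst (1) filler_def, rule sum.union_disjoint) (use m in auto)
  also have "(\<Sum>i\<in>{..<q}. card ({i<..<a + t} - ?\<alpha>)) = q * t" using c1 by simp
  also have "(\<Sum>i\<in>insert ?m {q + t + 1..<a + t}. card ({i<..<a + t} - ?\<alpha>)) = r"
    using c2 c3 m by simp
  finally show "inversions (a + t) ?\<alpha> = q * t + r" .
qed

section \<open>Counting the possible hook products\<close>

text \<open>Weight u by x to the power of its l1 norm, so that the sum over all u factors over
  \<open>P\<close>. For x = L/(L + 1) every point of the ball weighs at least exp(-T/L), and each
  factor is at most 2/(1 - x) = 2(L + 1).\<close>

lemma card_int_l1_ball:
  fixes T L :: nat
  assumes fin: "finite P" and L: "L > 0"
  shows "real (card {u \<in> P \<rightarrow>\<^sub>E {- int T..int T}. (\<Sum>p\<in>P. \<bar>u p\<bar>) \<le> int T})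
     \<le> exp (real T / real L) * (2 * (real L + 1)) ^ card P"
proof -
  let ?I = "{- int T..int T}"
  let ?S = "{u \<in> P \<rightarrow>\<^sub>E ?I. (\<Sum>p\<in>P. \<bar>u p\<bar>) \<le> int T}"
  define x :: real where "x = real L / (real L + 1)"
  have x: "0 < x" "x < 1" using L by (auto simp: x_def)
  have finS: "finite (P \<rightarrow>\<^sub>E ?I)" using fin by (intro finite_PiE) auto
  have xT: "x ^ T \<ge> exp (- (real T / real L))"
  proof -
    have "1 / x = 1 + 1 / real L" using L by (simp add: x_def field_simps)
    also have "\<dots> \<le> exp (1 / real L)" by simp
    finally have "(1 / x) ^ T \<le> exp (1 / real L) ^ T" using x by (intro power_mono) auto
    also have "\<dots> = exp (real T / real L)" by (simp flip: exp_of_nat_mult)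
    finally have "1 / x ^ T \<le> exp (real T / real L)" by (simp add: power_one_over)
    then show ?thesis using x by (simp add: exp_minus field_simps)
  qed
  have one: "(\<Sum>v\<in>?I. x ^ nat \<bar>v\<bar>) \<le> 2 * (real L + 1)"
  proof -
    have sub: "?I \<subseteq> int ` {..T} \<union> (\<lambda>k. - int k) ` {..T}"
    proof
      fix v assume "v \<in> ?I"
      then have "v = int (nat v) \<and> nat v \<le> T \<or> v = - int (nat (-v)) \<and> nat (-v) \<le> T"
        by auto
      then show "v \<in> int ` {..T} \<union> (\<lambda>k. - int k) ` {..T}" by blast
    qed
    have geo: "(\<Sum>k\<le>T. x ^ k) \<le> real L + 1"
    proof -
      have "(\<Sum>k\<le>T. x ^ k) = (1 - x ^ Suc T) / (1 - x)"
        using x by (simp add: sum_gp0)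
      also have "\<dots> \<le> 1 / (1 - x)" using x by (intro divide_right_mono) auto
      also have "\<dots> = real L + 1" using L by (simp add: x_def field_simps)
      finally show ?thesis .
    qed
    have "(\<Sum>v\<in>?I. x ^ nat \<bar>v\<bar>) \<le> (\<Sum>v\<in>int ` {..T} \<union> (\<lambda>k. - int k) ` {..T}. x ^ nat \<bar>v\<bar>)"
      using sub x by (intro sum_mono2) auto
    also have "\<dots> \<le> (\<Sum>v\<in>int ` {..T}. x ^ nat \<bar>v\<bar>) + (\<Sum>v\<in>(\<lambda>k. - int k) ` {..T}. x ^ nat \<bar>v\<bar>)"
      using x by (subst sum_Un) (auto intro!: sum_nonneg)
    also have "\<dots> = (\<Sum>k\<le>T. x ^ k) + (\<Sum>k\<le>T. x ^ k)"
      by (subst sum.reindex, simp add: inj_on_def)+ simp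
    finally show ?thesis using geo by simp
  qed
  have "real (card ?S) * x ^ T = (\<Sum>u\<in>?S. x ^ T)" by simp
  also have "\<dots> \<le> (\<Sum>u\<in>?S. \<Prod>p\<in>P. x ^ nat \<bar>u p\<bar>)"
  proof (rule sum_mono)
    fix u assume u: "u \<in> ?S"
    have "(\<Sum>p\<in>P. nat \<bar>u p\<bar>) \<le> T"
    proof -
      have "int (\<Sum>p\<in>P. nat \<bar>u p\<bar>) = (\<Sum>p\<in>P. \<bar>u p\<bar>)" by simp
      then show ?thesis using u by (simp del: of_nat_sum)
    qed
    then have "x ^ T \<le> x ^ (\<Sum>p\<in>P. nat \<bar>u p\<bar>)" using x by (intro power_decreasing) auto
    then show "x ^ T \<le> (\<Prod>p\<in>P. x ^ nat \<bar>u p\<bar>)" by (simp add: power_sum)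
  qed
  also have "\<dots> \<le> (\<Sum>u\<in>P \<rightarrow>\<^sub>E ?I. \<Prod>p\<in>P. x ^ nat \<bar>u p\<bar>)"
    using x by (intro sum_mono2 finS) (auto intro!: prod_nonneg)
  also have "\<dots> = (\<Prod>p\<in>P. \<Sum>v\<in>?I. x ^ nat \<bar>v\<bar>)"
    using fin by (subst prod_sum_PiE) auto
  also have "\<dots> \<le> (\<Prod>p\<in>P. 2 * (real L + 1))"
    using one x by (intro prod_mono conjI sum_nonneg) auto
  finally have "real (card ?S) * x ^ T \<le> (2 * (real L + 1)) ^ card P" by simp
  moreover have "real (card ?S) * exp (- (real T / real L)) \<le> real (card ?S) * x ^ T"
    using xT by (intro mult_left_mono) auto
  ultimately have "real (card ?S) * exp (- (real T / real L)) \<le> (2 * (real L + 1)) ^ card P" by linarith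
  then show ?thesis by (simp add: exp_minus field_simps)
qed

lemma card_image_le_of_determined:
  assumes "finite S" "\<And>x y. x \<in> S \<Longrightarrow> y \<in> S \<Longrightarrow> f x = f y \<Longrightarrow> g x = g y"
  shows "card (g ` S) \<le> card (f ` S)"
proof -
  have "g ` S = (\<lambda>z. g (inv_into S f z)) ` (f ` S)"
  proof -
    have "g (inv_into S f (f x)) = g x" if "x \<in> S" for x
      using that by (intro assms(2)) (auto intro: inv_into_into f_inv_into_f)
    then show ?thesis by (force simp: image_image)
  qed
  then show ?thesis using assms(1) by (metis card_image_le finite_imageI)
qed

lemma ex_large_fibre:
  assumes "finite S" "finite T" "T \<noteq> {}" "f ` S \<subseteq> T"
  shows "\<exists>y\<in>T. card S \<le> card T * card {x\<in>S. f x = y}"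
proof (rule ccontr)
  assume c: "\<not> ?thesis"
  have "card T * card S = (\<Sum>y\<in>T. card T * card {x\<in>S. f x = y})"
    using sum.group[OF assms(1,2,4), of "\<lambda>_. 1::nat"] by (simp flip: sum_distrib_left)
  also have "\<dots> < (\<Sum>y\<in>T. card S)" using c assms by (intro sum_strict_mono) auto
  finally show False by simp
qed

lemma multiplicity_less_self:
  fixes p d :: nat
  assumes "prime p" "d > 0"
  shows "multiplicity p d < d"
proof -
  have "multiplicity p d < 2 ^ multiplicity p d" by (rule less_exp)
  also have "\<dots> \<le> p ^ multiplicity p d" using prime_ge_2_nat[OF assms(1)] by (intro power_mono) auto
  also have "\<dots> \<le> d" using assms by (intro dvd_imp_le multiplicity_dvd)
  finally show ?thesis .
qed

lemma multiplicity_hook_lengths_prod: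
  assumes "prime p"
  shows "multiplicity p (hook_lengths_prod m A) = (\<Sum>d\<in>{1..<m}. hooks m A d * multiplicity p d)"
proof -
  have "prime_elem p" using assms by simp
  then have "multiplicity p (hook_lengths_prod m A) = (\<Sum>d\<in>{1..<m}. multiplicity p (d ^ hooks m A d))"
    unfolding hook_lengths_prod_def by (intro prime_elem_multiplicity_prod_distrib) auto
  also have "\<dots> = (\<Sum>d\<in>{1..<m}. hooks m A d * multiplicity p d)"
    using \<open>prime_elem p\<close> by (intro sum.cong refl prime_elem_multiplicity_power_distrib) auto
  finally show ?thesis .
qed

lemma hook_lengths_prod_pos: "hook_lengths_prod m A > 0"
  unfolding hook_lengths_prod_def by (intro prod_pos) auto

lemma hooks_le: "A \<subseteq> {..<m} \<Longrightarrow> hooks m A d \<le> m"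
  unfolding hooks_def using card_mono[of "{..<m}" "{i. i \<in> A \<and> i + d < m \<and> i + d \<notin> A}"] by auto

lemma multiplicity_hook_lengths_prod_le:
  assumes p: "prime p" and A: "A \<subseteq> {..<m}"
  shows "multiplicity p (hook_lengths_prod m A) \<le> m ^ 3"
proof -
  have "(\<Sum>d\<in>{1..<m}. hooks m A d * multiplicity p d) \<le> (\<Sum>d\<in>{1..<m}. m * m)"
  proof (intro sum_mono mult_le_mono hooks_le[OF A])
    fix d assume "d \<in> {1..<m}"
    then show "multiplicity p d \<le> m" using multiplicity_less_self[OF p, of d] by simp
  qed
  also have "\<dots> \<le> m * (m * m)" by simp
  finally show ?thesis unfolding multiplicity_hook_lengths_prod[OF p] by (simp add: power3_eq_cube)
qed

lemma multiplicity_large_prime: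
  fixes p d y :: nat
  assumes p: "prime p" "y < p" "0 < d" "d \<le> y\<^sup>2"
  shows "multiplicity p d = (if p dvd d then 1 else 0)"
proof (cases "p dvd d")
  case True
  have "\<not> p ^ 2 dvd d"
  proof
    assume "p ^ 2 dvd d"
    then have "p ^ 2 \<le> d" using p by (intro dvd_imp_le)
    moreover have "y\<^sup>2 < p\<^sup>2" using p by (intro power_strict_mono) auto
    ultimately show False using p by simp
  qed
  then have "multiplicity p d = 1" using True p by (intro multiplicity_eqI) (auto simp: numeral_2_eq_2)
  then show ?thesis using True by simp
qed (simp add: not_dvd_imp_multiplicity_0)

lemma card_large_prime_divisors_le_1:
  fixes y d :: nat
  assumes "0 < d" "d \<le> y\<^sup>2" "finite P" "\<And>p. p \<in> P \<Longrightarrow> prime p \<and> y < p"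
  shows "card {p\<in>P. p dvd d} \<le> 1"
proof (rule card_le_Suc0_iff_eq[THEN iffD2, folded One_nat_def], simp add: assms, intro ballI)
  fix p q assume "p \<in> {p\<in>P. p dvd d}" "q \<in> {p\<in>P. p dvd d}"
  then have pq: "prime p" "y < p" "p dvd d" "prime q" "y < q" "q dvd d" using assms by auto
  show "p = q"
  proof (rule ccontr)
    assume "p \<noteq> q"
    then have "coprime p q" using pq by (simp add: primes_coprime)
    then have "p * q dvd d" using pq by (simp add: divides_mult)
    then have "p * q \<le> d" using assms by (intro dvd_imp_le)
    moreover have "y * y < p * q" using pq by (intro mult_strict_mono) auto
    ultimately show False using assms by (simp add: power2_eq_square)
  qed
qed

text \<open>The exponents of the primes determine the hook product. Each of the at most y primes up
  to \<open>y\<close> has at most M^3 + 1 possible exponents; four times the exponents of the larger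
  primes differ from fixed values by a point of an l1 ball of radius \<open>T\<close>. The summand
  with \<open>card \<alpha>\<close> in \<open>T\<close> covers the hooks that leave the
  prefix.\<close>

lemma card_hook_products:
  fixes D L y :: nat
  assumes \<alpha>: "\<alpha> \<subseteq> {..<l}" and M: "M = l + m" and yM: "M \<le> y\<^sup>2" and L: "L > 0"
    and F: "\<F> \<subseteq> {A \<in> Pow {..<m}. (\<Sum>d\<in>{1..<m}. \<bar>hook_dev m A d\<bar>) \<le> int D}"
    and T: "T = D + 4 * card \<alpha> * M"
  shows "real (card ((\<lambda>A. hook_lengths_prod M (prefixed l \<alpha> A)) ` \<F>))
    \<le> real (M ^ 3 + 1) ^ y * (exp (real T / real L) * (2 * (real L + 1)) ^ card {p. prime p \<and> y < p \<and> p \<le> M})"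
proof -
  define P1 where "P1 = {p. prime p \<and> p \<le> y}"
  define P2 where "P2 = {p. prime p \<and> y < p \<and> p \<le> M}"
  have "P1 \<subseteq> {..y}" "P2 \<subseteq> {..M}" by (auto simp: P1_def P2_def)
  then have fin: "finite P1" "finite P2" using finite_subset by blast+
  have finF: "finite \<F>" using F by (rule finite_subset) simp
  have FA: "A \<subseteq> {..<m}" if "A \<in> \<F>" for A using that F by auto
  have fin\<alpha>: "finite \<alpha>" using \<alpha> finite_subset by blast
  let ?h = "\<lambda>A. hook_lengths_prod M (prefixed l \<alpha> A)"
  \<comment> \<open>The part of four times the number of hooks that varies with \<open>A\<close>;
    the mean and the hooks inside the prefix are constants.\<close>
  define w where "w A d = hook_dev m A d + 4 * int (cross_hooks l m \<alpha> A d)" for A d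
  define u where "u A p = (\<Sum>d\<in>{d\<in>{1..<M}. p dvd d}. w A d)" for A p
  \<comment> \<open>A prime above y divides a hook length at most once, so its exponent is a sum of numbers of hooks.\<close>
  define sig where "sig A = (restrict (\<lambda>p. multiplicity p (?h A)) P1, restrict (u A) P2)" for A
  have hook4: "4 * int (hooks M (prefixed l \<alpha> A) d) = w A d + (4 * int (hooks l \<alpha> d) + int (m - d))" if "A \<in> \<F>" for A d
    using hooks_prefixed[OF \<alpha> FA[OF that], of d] unfolding M w_def hook_dev_def by simp
  have det: "?h A = ?h A'" if AA: "A \<in> \<F>" "A' \<in> \<F>" and eq: "sig A = sig A'" for A A'
  proof (rule multiplicity_eq_nat)
    show "?h A > 0" "?h A' > 0" by (rule hook_lengths_prod_pos)+
    fix p :: nat assume p: "prime p"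
    have eq1: "restrict (\<lambda>p. multiplicity p (?h A)) P1 = restrict (\<lambda>p. multiplicity p (?h A')) P1"
      and eq2: "restrict (u A) P2 = restrict (u A') P2"
      using eq unfolding sig_def by simp_all
    consider "p \<in> P1" | "p \<in> P2" | "p > y" "p > M" using p unfolding P1_def P2_def by force
    then show "multiplicity p (?h A) = multiplicity p (?h A')"
    proof cases
      case 1
      then show ?thesis using fun_cong[OF eq1, of p] by simp
    next
      case 2
      then have py: "y < p" by (simp add: P2_def)
      have m4: "4 * int (multiplicity p (?h A)) = u A p + (\<Sum>d\<in>{d\<in>{1..<M}. p dvd d}. 4 * int (hooks l \<alpha> d) + int (m - d))"
        if A: "A \<in> \<F>" for A
      proof -
        have "multiplicity p (?h A) = (\<Sum>d\<in>{1..<M}. if p dvd d then hooks M (prefixed l \<alpha> A) d else 0)"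
          unfolding multiplicity_hook_lengths_prod[OF p]
          by (intro sum.cong refl) (use multiplicity_large_prime[OF p py] yM in auto)
        also have "\<dots> = (\<Sum>d\<in>{d\<in>{1..<M}. p dvd d}. hooks M (prefixed l \<alpha> A) d)"
          by (rule sum.inter_filter[symmetric]) simp
        finally have "4 * int (multiplicity p (?h A)) = (\<Sum>d\<in>{d\<in>{1..<M}. p dvd d}. 4 * int (hooks M (prefixed l \<alpha> A) d))"
          by (simp add: sum_distrib_left)
        then show ?thesis unfolding hook4[OF A] u_def by (simp add: sum.distrib)
      qed
      have "u A p = u A' p" using fun_cong[OF eq2, of p] 2 by simp
      then show ?thesis using m4[OF AA(1)] m4[OF AA(2)] by simp
    next
      case 3
      have "multiplicity p d = 0" if "d \<in> {1..<M}" for d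
        using that 3 by (intro not_dvd_imp_multiplicity_0) (auto dest: dvd_imp_le)
      then show ?thesis unfolding multiplicity_hook_lengths_prod[OF p] by simp
    qed
  qed
  let ?U = "{v \<in> P2 \<rightarrow>\<^sub>E {- int T..int T}. (\<Sum>p\<in>P2. \<bar>v p\<bar>) \<le> int T}"
  have finU: "finite ?U" by (rule finite_subset[of _ "P2 \<rightarrow>\<^sub>E {- int T..int T}"]) (use fin in \<open>auto intro!: finite_PiE\<close>)
  \<comment> \<open>After the interchange of sums each length d is charged to at most one large
    prime.\<close>
  have usum: "(\<Sum>p\<in>P2. \<bar>u A p\<bar>) \<le> int T" if A: "A \<in> \<F>" for A
  proof -
    have "(\<Sum>p\<in>P2. \<bar>u A p\<bar>) \<le> (\<Sum>p\<in>P2. \<Sum>d\<in>{1..<M}. if p dvd d then \<bar>w A d\<bar> else 0)"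
    proof (rule sum_mono)
      fix p
      have "\<bar>u A p\<bar> \<le> (\<Sum>d\<in>{d\<in>{1..<M}. p dvd d}. \<bar>w A d\<bar>)" unfolding u_def by (rule sum_abs)
      also have "\<dots> = (\<Sum>d\<in>{1..<M}. if p dvd d then \<bar>w A d\<bar> else 0)" by (rule sum.inter_filter) simp
      finally show "\<bar>u A p\<bar> \<le> (\<Sum>d\<in>{1..<M}. if p dvd d then \<bar>w A d\<bar> else 0)" .
    qed
    also have "\<dots> = (\<Sum>d\<in>{1..<M}. \<Sum>p\<in>P2. if p dvd d then \<bar>w A d\<bar> else 0)" by (rule sum.swap)
    also have "\<dots> \<le> (\<Sum>d\<in>{1..<M}. \<bar>w A d\<bar>)"
    proof (rule sum_mono)
      fix d assume d: "d \<in> {1..<M}"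
      have "(\<Sum>p\<in>P2. if p dvd d then \<bar>w A d\<bar> else 0) = int (card {p\<in>P2. p dvd d}) * \<bar>w A d\<bar>"
        using fin by (simp flip: sum.inter_filter)
      also have "\<dots> \<le> 1 * \<bar>w A d\<bar>"
      proof (rule mult_right_mono)
        have "prime p \<and> y < p" if "p \<in> P2" for p using that by (simp add: P2_def)
        moreover have "0 < d" "d \<le> y\<^sup>2" using d yM by simp_all
        ultimately have "card {p\<in>P2. p dvd d} \<le> 1" using card_large_prime_divisors_le_1 fin(2) by blast
        then show "int (card {p\<in>P2. p dvd d}) \<le> 1" by simp
      qed simp
      finally show "(\<Sum>p\<in>P2. if p dvd d then \<bar>w A d\<bar> else 0) \<le> \<bar>w A d\<bar>" by simp
    qed
    also have "\<dots> \<le> (\<Sum>d\<in>{1..<M}. \<bar>hook_dev m A d\<bar> + 4 * int (card \<alpha>))"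
      using cross_hooks_le[OF fin\<alpha>, of l m A] unfolding w_def
      by (intro sum_mono) (smt (verit) of_nat_0_le_iff of_nat_le_iff)
    also have "\<dots> = (\<Sum>d\<in>{1..<M}. \<bar>hook_dev m A d\<bar>) + 4 * int (card \<alpha>) * int (card {1..<M})"
      by (simp add: sum.distrib)
    also have "(\<Sum>d\<in>{1..<M}. \<bar>hook_dev m A d\<bar>) = (\<Sum>d\<in>{1..<m}. \<bar>hook_dev m A d\<bar>)"
    proof (rule sum.mono_neutral_right)
      show "\<forall>d\<in>{1..<M} - {1..<m}. \<bar>hook_dev m A d\<bar> = 0"
      proof
        fix d assume "d \<in> {1..<M} - {1..<m}"
        then have d: "m \<le> d" by auto
        then have "{i. i \<in> A \<and> i + d < m \<and> i + d \<notin> A} = {}" by auto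
        then show "\<bar>hook_dev m A d\<bar> = 0" using d by (simp add: hook_dev_def hooks_def)
      qed
    qed (auto simp: M)
    also have "(\<Sum>d\<in>{1..<m}. \<bar>hook_dev m A d\<bar>) \<le> int D" using A F by auto
    also have "int D + 4 * int (card \<alpha>) * int (card {1..<M}) \<le> int T"
      unfolding T by (simp add: mult_left_mono)
    finally show ?thesis by simp
  qed
  have "sig ` \<F> \<subseteq> (P1 \<rightarrow>\<^sub>E {..M ^ 3}) \<times> ?U"
  proof
    fix s assume "s \<in> sig ` \<F>"
    then obtain A where A: "A \<in> \<F>" "s = sig A" by auto
    have "multiplicity p (?h A) \<le> M ^ 3" if "p \<in> P1" for p
      using that prefixed_subset[OF \<alpha> FA[OF A(1)]] unfolding P1_def M
      by (intro multiplicity_hook_lengths_prod_le) auto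
    moreover have "\<bar>u A p\<bar> \<le> int T" if "p \<in> P2" for p
      using member_le_sum[OF that, of "\<lambda>p. \<bar>u A p\<bar>"] usum[OF A(1)] fin by simp
    then have "- int T \<le> u A p \<and> u A p \<le> int T" if "p \<in> P2" for p using that by (metis abs_le_iff minus_le_iff)
    ultimately show "s \<in> (P1 \<rightarrow>\<^sub>E {..M ^ 3}) \<times> ?U"
      unfolding A(2) sig_def using usum[OF A(1)] by (auto simp: PiE_def)
  qed
  then have "card (sig ` \<F>) \<le> card ((P1 \<rightarrow>\<^sub>E {..M ^ 3}) \<times> ?U)"
    using fin finU by (intro card_mono finite_cartesian_product finite_PiE) auto
  also have "\<dots> = (M ^ 3 + 1) ^ card P1 * card ?U"
    using fin by (simp add: card_cartesian_product card_PiE)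
  finally have "real (card (?h ` \<F>)) \<le> real ((M ^ 3 + 1) ^ card P1 * card ?U)"
    using card_image_le_of_determined[OF finF, of sig ?h] det by (metis (no_types, lifting) le_trans of_nat_le_iff)
  also have "\<dots> = real (M ^ 3 + 1) ^ card P1 * real (card ?U)" by simp
  also have "\<dots> \<le> real (M ^ 3 + 1) ^ y * (exp (real T / real L) * (2 * (real L + 1)) ^ card P2)"
  proof (rule mult_mono)
    have "P1 \<subseteq> {1..y}" unfolding P1_def by (auto dest: prime_gt_0_nat)
    then have "card P1 \<le> y" using card_mono[of "{1..y}" P1] by simp
    then show "real (M ^ 3 + 1) ^ card P1 \<le> real (M ^ 3 + 1) ^ y" by (intro power_increasing) auto
    show "real (card ?U) \<le> exp (real T / real L) * (2 * (real L + 1)) ^ card P2"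
      by (rule card_int_l1_ball[OF fin(2) L])
  qed auto
  finally show ?thesis unfolding P2_def .
qed

section \<open>Many words with exactly n inversions\<close>

lemma inversions_le:
  assumes "A \<subseteq> {..<m}"
  shows "inversions m A \<le> card A * (m - card A)"
proof -
  have fin: "finite A" using assms finite_subset by blast
  have "card ({i<..<m} - A) \<le> m - card A" for i
  proof -
    have "card ({i<..<m} - A) \<le> card ({..<m} - A)" by (rule card_mono) auto
    then show ?thesis using fin assms by (simp add: card_Diff_subset)
  qed
  then show ?thesis unfolding inversions_def using sum_bounded_above[of A "\<lambda>i. card ({i<..<m} - A)" "m - card A"] by simp
qed

lemma inversions_hook_dev:
  assumes "A \<subseteq> {..<m}"
  shows "8 * int (inversions m A) = 2 * (\<Sum>d\<in>{1..<m}. hook_dev m A d) + int m * (int m - 1)"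
proof -
  have g: "2 * (\<Sum>d\<in>{1..<m}. int (m - d)) = int m * (int m - 1)"
  proof (induction m)
    case (Suc m)
    have "(\<Sum>d\<in>{1..<Suc m}. int (Suc m - d)) = (\<Sum>d\<in>{1..<Suc m}. int (m - d) + 1)"
      by (intro sum.cong) auto
    also have "\<dots> = (\<Sum>d\<in>{1..<m}. int (m - d)) + int m"
      by (cases "m = 0") (simp_all add: sum.distrib sum.atLeastLessThan_Suc)
    finally show ?case using Suc by (simp add: algebra_simps)
  qed simp
  have "4 * int (inversions m A) = (\<Sum>d\<in>{1..<m}. hook_dev m A d + int (m - d))"
    unfolding inversions_eq_sum_hooks[OF assms] hook_dev_def by (simp add: sum_distrib_left)
  then have "8 * int (inversions m A) = 2 * (\<Sum>d\<in>{1..<m}. hook_dev m A d) + 2 * (\<Sum>d\<in>{1..<m}. int (m - d))"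
    by (simp add: sum.distrib)
  then show ?thesis unfolding g .
qed

text \<open>Eight times the number of inversions of a typical word of length t^2 is t^4 up to about
  12 t^3. The hypotheses place n above this number by an excess E between t^3 and 5 t^3, which a
  common prefix supplies.\<close>

lemma large_family_of_words:
  fixes t n :: nat
  assumes t: "t \<ge> 100" and lo: "t ^ 4 + 20 * t ^ 3 \<le> 8 * n" and hi: "8 * n < (t + 1) ^ 4 + 20 * (t + 1) ^ 3"
    and m: "m = t\<^sup>2"
  obtains l \<alpha> \<F> \<kappa> where "\<alpha> \<subseteq> {..<l}" "l \<le> 81 * t" "card \<alpha> \<le> 80 * t"
    "\<F> \<subseteq> {A \<in> Pow {..<m}. (\<Sum>d\<in>{1..<m}. \<bar>hook_dev m A d\<bar>) \<le> int (6 * t ^ 3)}"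
    "\<And>A. A \<in> \<F> \<Longrightarrow> card A = \<kappa>"
    "\<And>A. A \<in> \<F> \<Longrightarrow> inversions (l + m) (prefixed l \<alpha> A) = n"
    "2 ^ m \<le> 2 * ((t\<^sup>2 + 1) * (t ^ 4 + 1)) * card \<F>"
proof -
  let ?G = "{A \<in> Pow {..<m}. (\<Sum>d\<in>{1..<m}. \<bar>hook_dev m A d\<bar>) \<le> int (6 * t ^ 3)}"
  have G: "2 ^ m \<le> 2 * card ?G" using card_small_hook_dev[OF _ m] t by simp
  have finG: "finite ?G" by simp
  have inv_m: "inversions m A \<le> m * m" if "A \<subseteq> {..<m}" for A
  proof -
    have "card A \<le> m" using card_mono[OF _ that] by simp
    then have "card A * (m - card A) \<le> m * m" by (intro mult_le_mono) auto
    then show ?thesis using inversions_le[OF that] by simp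
  qed
  \<comment> \<open>Fixing the numbers of ones and of inversions costs a polynomial factor and lets
    a single prefix serve the whole family.\<close>
  have "(\<lambda>A. (card A, inversions m A)) ` ?G \<subseteq> {..m} \<times> {..m * m}"
  proof
    fix x assume "x \<in> (\<lambda>A. (card A, inversions m A)) ` ?G"
    then obtain A where A: "x = (card A, inversions m A)" "A \<subseteq> {..<m}" by auto
    then show "x \<in> {..m} \<times> {..m * m}" using inv_m[OF A(2)] card_mono[OF _ A(2)] by simp
  qed
  from ex_large_fibre[OF finG _ _ this] obtain y where
    y: "card ?G \<le> card ({..m} \<times> {..m * m}) * card {A \<in> ?G. (card A, inversions m A) = y}"
    by auto
  obtain \<kappa> I where yI: "y = (\<kappa>, I)" by (cases y)
  define \<F> where "\<F> = {A \<in> ?G. (card A, inversions m A) = y}"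
  have F: "\<F> \<subseteq> ?G" "\<And>A. A \<in> \<F> \<Longrightarrow> card A = \<kappa>" "\<And>A. A \<in> \<F> \<Longrightarrow> inversions m A = I"
    by (auto simp: \<F>_def yI)
  have cP: "card ({..m} \<times> {..m * m}) = (t\<^sup>2 + 1) * (t ^ 4 + 1)"
    unfolding m by (simp add: card_cartesian_product flip: power_add power2_eq_square power_mult)
  have big: "2 ^ m \<le> 2 * ((t\<^sup>2 + 1) * (t ^ 4 + 1)) * card \<F>"
    using G y unfolding cP \<F>_def[symmetric] by linarith
  then have "\<F> \<noteq> {}" by (intro notI) simp
  then obtain A where A: "A \<in> \<F>" by auto
  then have Am: "A \<subseteq> {..<m}" and dev: "(\<Sum>d\<in>{1..<m}. \<bar>hook_dev m A d\<bar>) \<le> int (6 * t ^ 3)" using F by auto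
  have AI: "inversions m A = I" and Ak: "card A = \<kappa>" using F A by auto
  have km: "\<kappa> \<le> m" using card_mono[OF _ Am] Ak by simp
  define z where "z = m - \<kappa>"
  have "\<bar>\<Sum>d\<in>{1..<m}. hook_dev m A d\<bar> \<le> 6 * int t ^ 3"
    by (rule order_trans[OF sum_abs]) (use dev in simp)
  then have I8: "8 * int I \<le> int t ^ 4 + 12 * int t ^ 3" "int t ^ 4 - (int t)\<^sup>2 - 12 * int t ^ 3 \<le> 8 * int I"
  proof -
    have "int m * (int m - 1) = int t ^ 4 - (int t)\<^sup>2"
      by (simp add: m algebra_simps power2_eq_square power4_eq_xxxx)
    then have "8 * int I = 2 * (\<Sum>d\<in>{1..<m}. hook_dev m A d) + (int t ^ 4 - (int t)\<^sup>2)"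
      using inversions_hook_dev[OF Am] AI by simp
    moreover have "(int t)\<^sup>2 \<ge> 0" by simp
    ultimately show "8 * int I \<le> int t ^ 4 + 12 * int t ^ 3" "int t ^ 4 - (int t)\<^sup>2 - 12 * int t ^ 3 \<le> 8 * int I"
      using \<open>\<bar>\<Sum>d\<in>{1..<m}. hook_dev m A d\<bar> \<le> 6 * int t ^ 3\<close> by linarith+
  qed
  have t100: "100 * int t \<le> (int t)\<^sup>2" "100 * (int t)\<^sup>2 \<le> int t ^ 3" "100 * int t ^ 3 \<le> int t ^ 4"
    using t by (simp_all add: power2_eq_square power3_eq_cube power4_eq_xxxx mult_right_mono)
  have lo': "int t ^ 4 + 20 * int t ^ 3 \<le> 8 * int n"
    using lo by (metis (mono_tags) of_nat_add of_nat_le_iff of_nat_mult of_nat_numeral of_nat_power)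
  have "int (8 * n) < int ((t + 1) ^ 4 + 20 * (t + 1) ^ 3)" using hi by (simp only: of_nat_less_iff)
  then have hi': "8 * int n < int t ^ 4 + 24 * int t ^ 3 + 66 * (int t)\<^sup>2 + 64 * int t + 21"
    by (simp add: power4_eq_xxxx power3_eq_cube power2_eq_square algebra_simps)
  define E where "E = n - I"
  have "I \<le> n" using I8 lo' t100 by linarith
  then have En: "n = E + I" and E8: "8 * int E = 8 * int n - 8 * int I" by (simp_all add: E_def)
  have tpos: "(int t)\<^sup>2 \<ge> 0" by simp
  \<comment> \<open>The 20 t^3 in \<open>lo\<close> exceeds the possible deviation 12 t^3 by 8 t^3.
    The resulting E >= t^3 gives a >= t below, so that \<open>filler\<close> has room for its
    \<open>q\<close> ones.\<close>
  have "int t ^ 3 \<le> int E" using E8 I8 lo' t100 tpos by linarith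
  then have Elo: "t ^ 3 \<le> E" by (metis of_nat_le_iff of_nat_power)
  have "int E \<le> 5 * int t ^ 3" using E8 I8 hi' t100 t by linarith
  then have Ehi: "E \<le> 5 * t ^ 3" by (metis (mono_tags) of_nat_le_iff of_nat_mult of_nat_numeral of_nat_power)
  have zm: "z \<le> t\<^sup>2" by (simp add: z_def m)
  have "I \<le> t\<^sup>2 * z"
  proof -
    have "I \<le> \<kappa> * z" using inversions_le[OF Am] by (simp add: AI Ak z_def)
    also have "\<dots> \<le> t\<^sup>2 * z" using km m by simp
    finally show ?thesis .
  qed
  then have "int I \<le> (int t)\<^sup>2 * int z" by (metis of_nat_le_iff of_nat_mult of_nat_power)
  then have "int t ^ 4 \<le> 16 * ((int t)\<^sup>2 * int z)" using I8 t100 tpos by linarith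
  then have "(int t)\<^sup>2 * (int t)\<^sup>2 \<le> (int t)\<^sup>2 * (16 * int z)" by (simp add: power2_eq_square power4_eq_xxxx)
  then have "(int t)\<^sup>2 \<le> 16 * int z" by (rule mult_left_le_imp_le) (use t in simp)
  \<comment> \<open>Many zeros keep the prefix short: each of its ones gains at least t^2/16
    inversions, so an excess of 5 t^3 needs at most 80 t ones.\<close>
  then have zlo: "t\<^sup>2 \<le> 16 * z" by (metis (mono_tags) of_nat_le_iff of_nat_mult of_nat_numeral of_nat_power)
  have zpos: "z > 0" using zlo t by (intro Nat.gr0I) simp
  \<comment> \<open>Each of the \<open>a\<close> ones of the prefix precedes the \<open>z\<close>
    zeros of the word; the remaining s < z inversions lie inside the prefix, with s = q t +
    r.\<close>
  define a s where "a = E div z" and "s = E mod z"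
  have Eaz: "E = a * z + s" by (simp add: a_def s_def)
  have s: "s < z" using zpos by (simp add: s_def)
  have at: "t \<le> a"
  proof -
    have "t * z \<le> t * t\<^sup>2" using zm by simp
    also have "\<dots> \<le> E" using Elo by (simp add: power3_eq_cube power2_eq_square)
    finally show ?thesis unfolding a_def using zpos by (simp add: less_eq_div_iff_mult_less_eq)
  qed
  have a80: "a \<le> 80 * t"
  proof -
    have "t\<^sup>2 * a \<le> 16 * z * a" using zlo by simp
    also have "\<dots> \<le> 16 * E" using Eaz by simp
    also have "\<dots> \<le> t\<^sup>2 * (80 * t)" using Ehi by (simp add: power3_eq_cube power2_eq_square)
    finally show ?thesis using t by simp
  qed
  define q r where "q = s div t" and "r = s mod t"
  have "s < t * t" using s zm by (simp add: power2_eq_square)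
  then have qt: "q < t" by (simp add: q_def less_mult_imp_div_less)
  have rt: "r < t" using t by (simp add: r_def)
  have sqr: "s = q * t + r" by (simp add: q_def r_def)
  have qa: "q + 1 \<le> a" using qt at by simp
  note fil = filler_props[OF qa rt]
  show ?thesis
  proof (rule that[of "filler t a q r" "a + t" \<F> \<kappa>])
    show "filler t a q r \<subseteq> {..<a + t}" by (rule fil)
    show "a + t \<le> 81 * t" using a80 by simp
    show "card (filler t a q r) \<le> 80 * t" using fil a80 by simp
    show "\<F> \<subseteq> ?G" by (rule F)
    show "card A = \<kappa>" if "A \<in> \<F>" for A by (rule F(2)[OF that])
    show "inversions (a + t + m) (prefixed (a + t) (filler t a q r) A) = n" if "A \<in> \<F>" for A
    proof -
      have "A \<subseteq> {..<m}" using that F by auto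
      then show ?thesis
        using inversions_prefixed[OF fil(1), of A m] fil F(2,3)[OF that] sqr Eaz En by (simp add: z_def)
    qed
    show "2 ^ m \<le> 2 * ((t\<^sup>2 + 1) * (t ^ 4 + 1)) * card \<F>" by (rule big)
  qed
qed

section \<open>The pigeonhole argument\<close>

text \<open>A restatement of 17^13 <= 2^23 * 5^13. As 13/25 > 1/2 and 23/25 < 1, it leaves a factor
  2^(2m/25) between the primorial bound and the 2^m words.\<close>

lemma constant_power_bound: "(17 / 5 :: real) powr (13 / 25) \<le> 2 powr (23 / 25)"
proof -
  have num: "(17 :: real) ^ 13 \<le> 2 ^ 23 * 5 ^ 13" by simp
  have "(17 / 5 :: real) ^ 13 = 17 ^ 13 / 5 ^ 13" by (rule power_divide)
  also have "\<dots> \<le> 2 ^ 23" by (rule mult_imp_div_pos_le[OF _ num]) (rule zero_less_power, simp)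
  finally have "(17 / 5 :: real) powr 13 \<le> 2 powr 23" by (simp only: powr_numeral)
  then have "((17 / 5 :: real) powr 13) powr (1 / 25) \<le> (2 powr 23) powr (1 / 25)"
    by (intro powr_mono2) auto
  then show ?thesis unfolding powr_powr by simp
qed

text \<open>Each prime p > y pays for its own factor, as c <= p^(13/25).\<close>

lemma power_card_large_primes_le:
  assumes c: "0 \<le> c" "c \<le> real y powr (13 / 25)"
  shows "c ^ card {p. prime p \<and> y < p \<and> p \<le> M} \<le> real (primorial M) powr (13 / 25)"
proof -
  let ?P = "{p. prime p \<and> y < p \<and> p \<le> M}"
  have fin: "finite ?P" by (rule finite_subset[of _ "{..M}"]) auto
  have "c ^ card ?P = (\<Prod>p\<in>?P. c)" by simp
  also have "\<dots> \<le> (\<Prod>p\<in>?P. real p powr (13 / 25))"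
  proof (intro prod_mono conjI c)
    fix p assume "p \<in> ?P"
    then have "real y powr (13 / 25) \<le> real p powr (13 / 25)" by (intro powr_mono2) auto
    then show "c \<le> real p powr (13 / 25)" using c by linarith
  qed
  also have "\<dots> = (\<Prod>p\<in>?P. real p) powr (13 / 25)" by (rule prod_powr_distrib[symmetric])
  also have "\<dots> \<le> real (primorial M) powr (13 / 25)"
  proof (intro powr_mono2)
    have "\<Prod>?P dvd primorial M" unfolding primorial_def
      by (rule prod_dvd_prod_subset[OF finite_primes_upto]) auto
    then have "\<Prod>?P \<le> primorial M" using primorial_pos by (rule dvd_imp_le)
    then show "(\<Prod>p\<in>?P. real p) \<le> real (primorial M)" unfolding of_nat_prod[symmetric] of_nat_le_iff .
  qed (auto intro: prod_nonneg)
  finally show ?thesis .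
qed

text \<open>t^(39/20) is the threshold between small and large primes. The exponent is below 2, so
  the small primes cost only exp(o(t^2)); above 1, so the square of the threshold exceeds all hook
  lengths; and 39/20 * 13/25 = 507/500 > 1, so its power 13/25 outgrows every linear term.\<close>

lemma asymptotic_estimates:
  fixes c :: real
  shows "eventually (\<lambda>t::nat. 100 \<le> t \<and> real (2 * (65000 * t + 1)) \<le> (real t powr (39 / 20)) powr (13 / 25) \<and>
     2 * (real t)\<^sup>2 \<le> (real t powr (39 / 20))\<^sup>2 \<and>
     ln (2 * ((real t)\<^sup>2 + 1) * (real t ^ 4 + 1) * real t ^ 4) + (real t powr (39 / 20) + 1) * ln (8 * real t ^ 6 + 1) + c + 75 * real t
      \<le> 3 / 100 * (real t)\<^sup>2) at_top"
proof (intro eventually_conj)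
  show "eventually (\<lambda>t::nat. 100 \<le> t) at_top" by (rule eventually_ge_at_top)
  show "eventually (\<lambda>t::nat. real (2 * (65000 * t + 1)) \<le> (real t powr (39 / 20)) powr (13 / 25)) at_top"
    by (simp add: powr_powr) real_asymp
  show "eventually (\<lambda>t::nat. 2 * (real t)\<^sup>2 \<le> (real t powr (39 / 20))\<^sup>2) at_top" by real_asymp
  show "eventually (\<lambda>t::nat. ln (2 * ((real t)\<^sup>2 + 1) * (real t ^ 4 + 1) * real t ^ 4) + (real t powr (39 / 20) + 1) * ln (8 * real t ^ 6 + 1) + c + 75 * real t
      \<le> 3 / 100 * (real t)\<^sup>2) at_top" by real_asymp
qed

text \<open>The surplus of words over hook products is exponential in t^2, which is of the order of
  the square root of n; a further factor n is therefore harmless.\<close>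

lemma eventually_max_multiplicity_ge: "\<exists>N. \<forall>n\<ge>N. n \<le> max_multiplicity n"
proof -
  obtain K :: real where K: "K > 0" "\<And>n. real (primorial n) \<le> K * (17 / 5) ^ n"
    using primorial_bound by blast
  obtain t0 where t0: "\<And>t::nat. t \<ge> t0 \<Longrightarrow> 100 \<le> t \<and> real (2 * (65000 * t + 1)) \<le> (real t powr (39 / 20)) powr (13 / 25) \<and>
     2 * (real t)\<^sup>2 \<le> (real t powr (39 / 20))\<^sup>2 \<and>
     ln (2 * ((real t)\<^sup>2 + 1) * (real t ^ 4 + 1) * real t ^ 4) + (real t powr (39 / 20) + 1) * ln (8 * real t ^ 6 + 1) + 13 / 25 * ln K + 75 * real t
      \<le> 3 / 100 * (real t)\<^sup>2"
    using asymptotic_estimates[of "13 / 25 * ln K"] unfolding eventually_at_top_linorder by blast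
  have "n \<le> max_multiplicity n" if n: "n \<ge> t0 ^ 4 + 20 * t0 ^ 3" for n
  proof -
    let ?P = "\<lambda>t. t ^ 4 + 20 * t ^ 3 \<le> 8 * n"
    have bnd: "\<forall>t. ?P t \<longrightarrow> t \<le> 8 * n"
    proof (intro allI impI)
      fix t :: nat assume "?P t"
      moreover have "t \<le> t ^ 4" by (cases "t = 0") (simp_all add: self_le_power)
      ultimately show "t \<le> 8 * n" by linarith
    qed
    have P0: "?P t0" using n by simp
    \<comment> \<open>The largest admissible \<open>t\<close>: its own inequality is
      \<open>lo\<close>, and the failure for t + 1 is \<open>hi\<close>.\<close>
    define t where "t = (GREATEST t. ?P t)"
    have lo: "?P t" unfolding t_def using GreatestI_nat[of ?P, OF P0] bnd by blast
    have tt0: "t \<ge> t0" unfolding t_def using Greatest_le_nat[of ?P, OF P0] bnd by blast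
    have hi: "8 * n < (t + 1) ^ 4 + 20 * (t + 1) ^ 3"
    proof (rule ccontr)
      assume "\<not> ?thesis"
      then have "?P (t + 1)" by simp
      then have "t + 1 \<le> t" unfolding t_def using Greatest_le_nat[of ?P] bnd by blast
      then show False by simp
    qed
    note est = t0[OF tt0]
    have t: "t \<ge> 100" using est by simp
    define m where "m = t\<^sup>2"
    obtain l \<alpha> \<F> \<kappa> where \<alpha>: "\<alpha> \<subseteq> {..<l}" "l \<le> 81 * t" "card \<alpha> \<le> 80 * t"
      and F: "\<F> \<subseteq> {A \<in> Pow {..<m}. (\<Sum>d\<in>{1..<m}. \<bar>hook_dev m A d\<bar>) \<le> int (6 * t ^ 3)}"
      and \<kappa>: "\<And>A. A \<in> \<F> \<Longrightarrow> card A = \<kappa>"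
      and inv: "\<And>A. A \<in> \<F> \<Longrightarrow> inversions (l + m) (prefixed l \<alpha> A) = n"
      and big: "2 ^ m \<le> 2 * ((t\<^sup>2 + 1) * (t ^ 4 + 1)) * card \<F>"
      by (rule large_family_of_words[OF t lo hi m_def]) (rule that; assumption)
    define M where "M = l + m"
    define y where "y = nat \<lceil>real t powr (39 / 20)\<rceil>"
    have y: "real t powr (39 / 20) \<le> real y" "real y \<le> real t powr (39 / 20) + 1"
    proof -
      have "real t powr (39 / 20) \<ge> 0" by simp
      then have "real y = real_of_int \<lceil>real t powr (39 / 20)\<rceil>" unfolding y_def by (simp del: powr_ge_zero)
      then show "real t powr (39 / 20) \<le> real y" "real y \<le> real t powr (39 / 20) + 1" by linarith+
    qed
    have tt: "100 * t \<le> t\<^sup>2" using t by (simp add: power2_eq_square)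
    have M2: "M \<le> t\<^sup>2 + 81 * t" "M \<le> 2 * t\<^sup>2" using \<alpha> tt by (simp_all add: M_def m_def)
    have yM: "M \<le> y\<^sup>2"
    proof -
      have "real M \<le> 2 * (real t)\<^sup>2" using M2(2) by (metis (mono_tags) of_nat_le_iff of_nat_mult of_nat_numeral of_nat_power)
      also have "\<dots> \<le> (real t powr (39 / 20))\<^sup>2" using est by blast
      also have "\<dots> \<le> (real y)\<^sup>2" using y by (intro power_mono) auto
      finally show ?thesis by (metis of_nat_le_iff of_nat_power)
    qed
    let ?h = "\<lambda>A. hook_lengths_prod M (prefixed l \<alpha> A)"
    \<comment> \<open>\<open>T\<close> is at most 650 t^3, so this \<open>L\<close> gives T/L <=
      t^2/100 while staying linear in t.\<close>
    define T L where "T = 6 * t ^ 3 + 4 * card \<alpha> * M" and "L = 65000 * t"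
    have L: "L > 0" using t by (simp add: L_def)
    have TL: "real T / real L \<le> (real t)\<^sup>2 / 100"
    proof -
      have "card \<alpha> * M \<le> 80 * t * (2 * t\<^sup>2)" using \<alpha> M2 by (intro mult_le_mono)
      also have "\<dots> = 160 * t ^ 3" by (simp add: power2_eq_square power3_eq_cube)
      finally have "4 * card \<alpha> * M \<le> 640 * t ^ 3" by (simp add: mult.commute)
      then have "T \<le> 650 * t ^ 3" by (simp add: T_def)
      then have "real T \<le> 650 * real t ^ 3" by (metis (mono_tags) of_nat_le_iff of_nat_mult of_nat_numeral of_nat_power)
      also have "\<dots> = (real t)\<^sup>2 / 100 * real L" by (simp add: L_def power2_eq_square power3_eq_cube)
      finally show ?thesis using L by (simp add: pos_divide_le_eq)
    qed
    let ?V = "real (M ^ 3 + 1) ^ y * (exp (real T / real L) * (2 * (real L + 1)) ^ card {p. prime p \<and> y < p \<and> p \<le> M})"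
    have V: "real (card (?h ` \<F>)) \<le> ?V"
      by (rule card_hook_products[OF \<alpha>(1) M_def yM L F T_def])
    have v1: "real (M ^ 3 + 1) ^ y \<le> exp ((real t powr (39 / 20) + 1) * ln (8 * real t ^ 6 + 1))"
    proof -
      have "M ^ 3 \<le> (2 * t\<^sup>2) ^ 3" using M2 by (intro power_mono) auto
      then have "M ^ 3 \<le> 8 * t ^ 6" by (simp add: power_mult_distrib flip: power_mult)
      then have "real (M ^ 3 + 1) \<le> 8 * real t ^ 6 + 1" by (simp flip: of_nat_power) 
      then have "real (M ^ 3 + 1) ^ y \<le> (8 * real t ^ 6 + 1) ^ y" by (intro power_mono) auto
      also have "\<dots> = exp (real y * ln (8 * real t ^ 6 + 1))"
        by (subst exp_of_nat_mult) (simp add: add_nonneg_pos)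
      also have "\<dots> \<le> exp ((real t powr (39 / 20) + 1) * ln (8 * real t ^ 6 + 1))"
        using y by (intro iffD2[OF exp_le_cancel_iff] mult_right_mono ln_ge_zero) auto
      finally show ?thesis .
    qed
    have v2: "exp (real T / real L) \<le> exp ((real t)\<^sup>2 / 100)" using TL by simp
    have v3: "(2 * (real L + 1)) ^ card {p. prime p \<and> y < p \<and> p \<le> M}
       \<le> exp (13 / 25 * ln K + 23 / 25 * ln 2 * ((real t)\<^sup>2 + 81 * real t))"
    proof -
      have "2 * (real L + 1) \<le> (real t powr (39 / 20)) powr (13 / 25)" using est by (simp add: L_def)
      also have "\<dots> \<le> real y powr (13 / 25)" using y by (intro powr_mono2) auto
      finally have "(2 * (real L + 1)) ^ card {p. prime p \<and> y < p \<and> p \<le> M} \<le> real (primorial M) powr (13 / 25)"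
        by (intro power_card_large_primes_le) auto
      also have "\<dots> \<le> (K * (17 / 5) ^ M) powr (13 / 25)" using K by (intro powr_mono2) auto
      also have "\<dots> = K powr (13 / 25) * ((17 / 5) powr (13 / 25)) ^ M"
        using K by (simp add: powr_mult powr_powr flip: powr_realpow) (simp add: mult.commute)
      also have "\<dots> \<le> K powr (13 / 25) * (2 powr (23 / 25)) ^ M"
        by (intro mult_left_mono power_mono constant_power_bound) auto
      also have "\<dots> = exp (13 / 25 * ln K) * exp (real M * (23 / 25 * ln 2))"
        using K unfolding exp_of_nat_mult by (simp add: powr_def)
      also have "\<dots> = exp (13 / 25 * ln K + 23 / 25 * ln 2 * real M)" by (simp add: exp_add mult_ac)
      also have "\<dots> \<le> exp (13 / 25 * ln K + 23 / 25 * ln 2 * ((real t)\<^sup>2 + 81 * real t))"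
      proof -
        have "real M \<le> real (t\<^sup>2 + 81 * t)" using M2(1) by (simp only: of_nat_le_iff)
        then have "real M \<le> (real t)\<^sup>2 + 81 * real t" by simp
        then have "23 / 25 * ln 2 * real M \<le> 23 / 25 * ln 2 * ((real t)\<^sup>2 + 81 * real t)"
          by (intro mult_left_mono) auto
        then show ?thesis by simp
      qed
      finally show ?thesis .
    qed
    have "?V \<le> exp ((real t powr (39 / 20) + 1) * ln (8 * real t ^ 6 + 1)) *
        (exp ((real t)\<^sup>2 / 100) * exp (13 / 25 * ln K + 23 / 25 * ln 2 * ((real t)\<^sup>2 + 81 * real t)))"
      by (intro mult_mono v1 v2 v3) auto
    with V have V': "real (card (?h ` \<F>)) \<le> exp ((real t powr (39 / 20) + 1) * ln (8 * real t ^ 6 + 1) +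
        ((real t)\<^sup>2 / 100 + (13 / 25 * ln K + 23 / 25 * ln 2 * ((real t)\<^sup>2 + 81 * real t))))"
      by (simp only: exp_add)
    \<comment> \<open>Lets the desired multiplicity n be accounted for by the factor t^4 inside the
      logarithm of \<open>asymptotic_estimates\<close>.\<close>
    have nt: "n \<le> t ^ 4"
    proof -
      have t34: "100 * t ^ 3 \<le> t ^ 4" using t by (simp add: power3_eq_cube power4_eq_xxxx)
      have p: "t\<^sup>2 \<le> t ^ 3" "t \<le> t ^ 3" "1 \<le> t ^ 3"
        using t by (simp_all add: power_increasing self_le_power)
      have "(t + 1) ^ 3 = t ^ 3 + 3 * t\<^sup>2 + 3 * t + 1" "(t + 1) ^ 4 = t ^ 4 + 4 * t ^ 3 + 6 * t\<^sup>2 + 4 * t + 1"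
        by (simp_all add: power4_eq_xxxx power3_eq_cube power2_eq_square algebra_simps)
      then have "(t + 1) ^ 3 \<le> 8 * t ^ 3" "(t + 1) ^ 4 \<le> t ^ 4 + 15 * t ^ 3" using p by linarith+
      then show ?thesis using hi t34 by linarith
    qed
    have "real (2 * ((t\<^sup>2 + 1) * (t ^ 4 + 1))) * (real n * real (card (?h ` \<F>))) \<le> 2 ^ m"
    proof -
      let ?X = "2 * ((real t)\<^sup>2 + 1) * (real t ^ 4 + 1) * real t ^ 4"
      have Xpos: "?X > 0" using t by (intro mult_pos_pos add_nonneg_pos) auto
      have "real (2 * ((t\<^sup>2 + 1) * (t ^ 4 + 1))) * (real n * real (card (?h ` \<F>)))
         \<le> real (2 * ((t\<^sup>2 + 1) * (t ^ 4 + 1))) * (real t ^ 4 * real (card (?h ` \<F>)))"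
        using nt by (intro mult_left_mono mult_right_mono) (simp_all flip: of_nat_power)
      also have "\<dots> = ?X * real (card (?h ` \<F>))"
        by (simp only: of_nat_mult of_nat_add of_nat_power of_nat_numeral of_nat_1 mult_ac)
      also have "\<dots> \<le> exp (ln ?X) * exp ((real t powr (39 / 20) + 1) * ln (8 * real t ^ 6 + 1) +
        ((real t)\<^sup>2 / 100 + (13 / 25 * ln K + 23 / 25 * ln 2 * ((real t)\<^sup>2 + 81 * real t))))"
        using V' Xpos by (intro mult_mono) auto
      also have "\<dots> \<le> exp ((real t)\<^sup>2 * ln 2)"
      proof -
        \<comment> \<open>Of the exponent t^2 ln 2 the primorial takes 23/25. The rest, 2/25 ln 2 >=
          1/25, covers 1/100 from T/L and the 3/100 in \<open>asymptotic_estimates\<close>; the term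
          75 t there dominates 81 * 23/25 * ln 2 * t, caused by the prefix.\<close>
        have l2: "1 / 2 \<le> ln (2 :: real)" "ln (2 :: real) \<le> 1"
        proof -
          have "ln (1 / 2 :: real) \<le> 1 / 2 - 1" by (rule ln_le_minus_one) simp
          then show "1 / 2 \<le> ln (2 :: real)" by (simp add: ln_div)
          show "ln (2 :: real) \<le> 1" using ln_2_less_1 by simp
        qed
        have "(real t)\<^sup>2 * (1 / 2) \<le> (real t)\<^sup>2 * ln 2" using l2 by (intro mult_left_mono) auto
        moreover have "real t * ln 2 \<le> real t * 1" using l2 by (intro mult_left_mono) auto
        moreover have "23 / 25 * ln 2 * ((real t)\<^sup>2 + 81 * real t) = 23 / 25 * ((real t)\<^sup>2 * ln 2) + 1863 / 25 * (real t * ln 2)"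
          by (simp add: algebra_simps)
        ultimately have "ln ?X + ((real t powr (39 / 20) + 1) * ln (8 * real t ^ 6 + 1) +
            ((real t)\<^sup>2 / 100 + (13 / 25 * ln K + 23 / 25 * ln 2 * ((real t)\<^sup>2 + 81 * real t)))) \<le> (real t)\<^sup>2 * ln 2"
          using est[THEN conjunct2, THEN conjunct2, THEN conjunct2] by linarith
        then show ?thesis by (simp flip: exp_add)
      qed
      also have "\<dots> = 2 ^ m" by (simp add: m_def exp_of_nat_mult flip: of_nat_power)
      finally show ?thesis .
    qed
    also have "(2::real) ^ m \<le> real (2 * ((t\<^sup>2 + 1) * (t ^ 4 + 1))) * real (card \<F>)"
      using big by (metis of_nat_le_iff of_nat_mult of_nat_numeral of_nat_power)
    finally have "real n * real (card (?h ` \<F>)) \<le> real (card \<F>)"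
    proof (rule mult_left_le_imp_le)
      have "0 < 2 * ((t\<^sup>2 + 1) * (t ^ 4 + 1))" by simp
      then show "0 < real (2 * ((t\<^sup>2 + 1) * (t ^ 4 + 1)))" unfolding of_nat_0_less_iff .
    qed
    then have nF: "n * card (?h ` \<F>) \<le> card \<F>" by (metis of_nat_le_iff of_nat_mult)
    have finF: "finite \<F>" using F by (rule finite_subset) simp
    have F0: "\<F> \<noteq> {}"
    proof
      assume "\<F> = {}"
      then show False using big by simp
    qed
    then obtain P where P: "P \<in> ?h ` \<F>" and cP: "card \<F> \<le> card (?h ` \<F>) * card {A \<in> \<F>. ?h A = P}"
      using ex_large_fibre[OF finF, of "?h ` \<F>" ?h] finF by auto
    have "card (?h ` \<F>) > 0" using P finF by (auto simp: card_gt_0_iff)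
    moreover have "card (?h ` \<F>) * n \<le> card (?h ` \<F>) * card {A \<in> \<F>. ?h A = P}"
      using order_trans[OF nF cP] by (simp only: mult.commute)
    ultimately have nP: "n \<le> card {A \<in> \<F>. ?h A = P}" by (simp only: mult_le_cancel1)
    define \<X> where "\<X> = (\<lambda>A. shifted M (prefixed l \<alpha> A)) ` {A \<in> \<F>. ?h A = P}"
    have FA: "A \<subseteq> {..<m}" "prefixed l \<alpha> A \<subseteq> {..<M}" "card (prefixed l \<alpha> A) = card \<alpha> + \<kappa>" if "A \<in> \<F>" for A
    proof -
      show A: "A \<subseteq> {..<m}" using that F by auto
      then show "prefixed l \<alpha> A \<subseteq> {..<M}" unfolding M_def by (rule prefixed_subset[OF \<alpha>(1)])
      show "card (prefixed l \<alpha> A) = card \<alpha> + \<kappa>"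
        using card_prefixed[OF \<alpha>(1), of A] finite_subset[OF A] \<kappa>[OF that] by simp
    qed
    have "inj_on (\<lambda>A. shifted M (prefixed l \<alpha> A)) {A \<in> \<F>. ?h A = P}"
    proof (rule inj_onI)
      fix A A' assume AA: "A \<in> {A \<in> \<F>. ?h A = P}" "A' \<in> {A \<in> \<F>. ?h A = P}"
        and eq: "shifted M (prefixed l \<alpha> A) = shifted M (prefixed l \<alpha> A')"
      have "prefixed l \<alpha> A = prefixed l \<alpha> A'"
        by (rule shifted_inj[OF _ _ _ eq]) (use FA AA in auto)
      then have "l + i \<in> prefixed l \<alpha> A \<longleftrightarrow> l + i \<in> prefixed l \<alpha> A'" for i by simp
      then show "A = A'" by (auto simp: mem_prefixed[OF \<alpha>(1)])
    qed
    then have "card \<X> = card {A \<in> \<F>. ?h A = P}" unfolding \<X>_def by (rule card_image)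
    moreover have "max_multiplicity n \<ge> card \<X>"
    proof (rule max_multiplicity_ge_card[where k = "card \<alpha> + \<kappa>" and P = "real P"])
      show "finite \<X>" unfolding \<X>_def using finF by simp
      show "\<X> \<noteq> {}" unfolding \<X>_def using P by auto
      fix X assume "X \<in> \<X>"
      then obtain A where A: "A \<in> \<F>" "?h A = P" and X: "X = shifted M (prefixed l \<alpha> A)" by (auto simp: \<X>_def)
      note S = shifted_props[OF FA(2)[OF A(1)], unfolded FA(3)[OF A(1)], folded X]
      show "finite X \<and> X \<subseteq> {..<int (card \<alpha> + \<kappa>)} \<and> card X = card \<alpha> + \<kappa> \<and> hook_count (card \<alpha> + \<kappa>) X = n"
        using S(1-4) inv[OF A(1)] by (simp add: M_def)
      show "hook_product (card \<alpha> + \<kappa>) X = real P" using S(5) A by simp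
    qed
    ultimately show ?thesis using nP by simp
  qed
  then show ?thesis by blast
qed

text \<open>Both bounds are weak consequences of n <= \<open>max_multiplicity n\<close> for large n,
  through 2^i <= 81^i <= n and n^(1/7) <= n. For the first, N <= i < 2^i <= n makes \<open>N\<close>
  itself a threshold for i.\<close>

theorem theoremD:
  shows "(\<exists>i0::nat. \<forall>i\<ge>i0. \<forall>n::nat. n \<ge> 3 * 81 ^ i \<longrightarrow> max_multiplicity n \<ge> 2 ^ i)
       \<and> (\<exists>N::nat. \<forall>n\<ge>N. real (max_multiplicity n) \<ge> real n powr (1 / 7))"
proof -
  obtain N where N: "\<And>n. n \<ge> N \<Longrightarrow> n \<le> max_multiplicity n"
    using eventually_max_multiplicity_ge by blast
  show ?thesis
  proof (intro conjI exI allI impI)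
    fix i n :: nat assume i: "i \<ge> N" and n: "n \<ge> 3 * 81 ^ i"
    have "i < 2 ^ i" by (rule less_exp)
    moreover have "(2::nat) ^ i \<le> 81 ^ i" by (rule power_mono) auto
    ultimately have "N \<le> n" "2 ^ i \<le> n" using i n by linarith+
    then show "2 ^ i \<le> max_multiplicity n" using N[of n] by linarith
  next
    fix n assume n: "n \<ge> N + 1"
    have "real n powr (1 / 7) \<le> real n powr 1" using n by (intro powr_mono) auto
    also have "\<dots> = real n" using n by simp
    also have "\<dots> \<le> real (max_multiplicity n)" using N[of n] n by simp
    finally show "real n powr (1 / 7) \<le> real (max_multiplicity n)" .
  qed
qed

end
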